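(* Let $C=\mathcal{C}_\mu(R,\sigma,t)$ be a regular, $\mu$-consistent TGWC of rank $m$ with canonical generators $X_1^{\pm},\dots,X_m^{\pm}$ and canonical ideal $\mathcal J$, and let $A=C/\mathcal J=\mathcal{A}_\mu(R,\sigma,t)$. Let $\chi:\mathbb Z^m\to\mathrm{Aut}_k(C)$, $\alpha\mapsto\chi_\alpha$, be a group homomorphism such that every $\chi_\alpha$ is a graded automorphism of $C$ and there are scalars $q_{ij}^{(\pm,\pm)}\in k^\times$ with $$\chi_{\mathbf e_i}(X_j^{\pm})=q_{ij}^{(+,\pm)}X_j^{\pm},\qquad \chi_{-\mathbf e_i}(X_j^{\pm})=q_{ij}^{(-,\pm)}X_j^{\pm}\qquad(i,j\in[m]).$$ Write $\chi^{-1}\sigma=(\chi_{\mathbf e_1}^{-1}\sigma_1,\dots,\chi_{\mathbf e_m}^{-1}\sigma_m)$, an $m$-tuple of automorphisms of $R$ (with $\chi_{\mathbf e_i}$ restricted to $R=C_{\mathbf 0}$). (1) If $\nu_{ij}=\mu_{ij}\,q_{ji}^{(-,+)}q_{ij}^{(-,-)}$ for all $i\ne j$, then ${}^{\chi}C\cong\mathcal{C}_\nu(R,\chi^{-1}\sigma,t)$ is a TGWC. (2) If ${}^{\chi}\!\mathcal J$ denotes the canonical ideal of the TGWC ${}^{\chi}C$, then $\mathcal J={}^{\chi}\!\mathcal J$ as sets. (3) ${}^{\chi}\!A\cong{}^{\chi}C/{}^{\chi}\!\mathcal J$. So, with $\nu$ as in (1), ${}^{\chi}\!A\cong\mathcal{A}_\nu(R,\chi^{-1}\sigma,t)$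 is a rank $m$ TGWA.
   Context: $k$ is a field; algebras are unital $k$-algebras; $[m]=\{1,\dots,m\}$; $Z(R)$ is the center of $R$; $\mathbf e_i$ is the $i$-th standard basis vector; $\mathrm{Aut}_k$ denotes $k$-algebra automorphisms. A twisted generalized Weyl datum (TGWD) of rank $m$ is a triple $(R,\sigma,t)$ with $R$ an algebra, $\sigma=(\sigma_1,\dots,\sigma_m)$ commuting automorphisms of $R$, and $t=(t_1,\dots,t_m)\in Z(R)^m$. For $\mu=(\mu_{ij})\in M_m(k^\times)$, the twisted generalized Weyl construction (TGWC) $\mathcal{C}_\mu(R,\sigma,t)$ is the algebra generated over $R$ by $X_1^{\pm},\dots,X_m^{\pm}$ (the canonical generators) with relations $X_i^{\pm}r=\sigma_i^{\pm1}(r)X_i^{\pm}$, $X_i^-X_i^+=t_i$, $X_i^+X_i^-=\sigma_i(t_i)$ for $r\in R$, $i\in[m]$, and $X_i^+X_j^-=\mu_{ij}X_j^-X_i^+$ for $i\ne j$. It is $\mathbb Z^m$-graded by $\deg r=\mathbf 0$, $\deg X_i^{\pm}=\pm\mathbf e_i$. The canonical ideal $\mathcal J$ is the sum of all graded ideals $J$ with $J_{\mathbf 0}=\{0\}$, and the twisted generalized Weyl algebra (TGWA) is $\mathcal{A}_\mu(R,\sigma,t)=\mathcal{C}_\mu(R,\sigma,t)/\mathcal J$. The datum is regular if every $t_i$ is a regular element (non-zero-divisor) of $R$, and $\mu$-consistent if the canonical map $R\to\mathcal{A}_\mu(R,\sigma,t)$ is injective; a TGWC is regular (resp. $\mu$-consistent)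 if its datum is. The graded twist ${}^{\chi}C$ is $C$ as a graded vector space with multiplication $a\star b=\chi_\beta(a)b$ for $a\in C_\alpha$, $b\in C_\beta$. The automorphisms $\chi_\alpha$ descend to graded automorphisms of $A=C/\mathcal J$, and ${}^{\chi}\!A$ is defined in the same way from these. *)

theory Defs
  imports "HOL-Algebra.QuotRing" "HOL-Algebra.Module" "HOL-Algebra.Bij"
    "HOL-Algebra.Free_Abelian_Groups"
begin

section \<open>Algebras over a field\<close>

text \<open>
  The library's \<^locale>\<open>algebra\<close> is restricted to commutative algebras, so unital associative
  algebras are introduced here on the same record type. The zero algebra is allowed.
\<close>

locale assoc_algebra = module K A + A: ring A for K (structure) and A (structure) +
  assumes smult_mult_left:
      "\<lbrakk>c \<in> carrier K; x \<in> carrier A; y \<in> carrier A\<rbrakk> \<Longrightarrow>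
       (c \<odot>\<^bsub>A\<^esub> x) \<otimes>\<^bsub>A\<^esub> y = c \<odot>\<^bsub>A\<^esub> (x \<otimes>\<^bsub>A\<^esub> y)"
    and smult_mult_right:
      "\<lbrakk>c \<in> carrier K; x \<in> carrier A; y \<in> carrier A\<rbrakk> \<Longrightarrow>
       x \<otimes>\<^bsub>A\<^esub> (c \<odot>\<^bsub>A\<^esub> y) = c \<odot>\<^bsub>A\<^esub> (x \<otimes>\<^bsub>A\<^esub> y)"

definition alg_hom ::
    "('k, 'x) ring_scheme \<Rightarrow> ('k, 'a, 'y) module_scheme \<Rightarrow> ('k, 'b, 'z) module_scheme \<Rightarrow> ('a \<Rightarrow> 'b) set"
  where "alg_hom K A B =
    {f \<in> ring_hom A B. \<forall>c\<in>carrier K. \<forall>x\<in>carrier A. f (c \<odot>\<^bsub>A\<^esub> x) = c \<odot>\<^bsub>B\<^esub> f x}"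

definition alg_Aut ::
    "('k, 'x) ring_scheme \<Rightarrow> ('k, 'a, 'y) module_scheme \<Rightarrow> ('a \<Rightarrow> 'a) monoid"
  where "alg_Aut K A =
    BijGroup (carrier A) \<lparr>carrier := {f \<in> Bij (carrier A). f \<in> alg_hom K A A}\<rparr>"

definition ring_center :: "('a, 'x) ring_scheme \<Rightarrow> 'a set"
  where "ring_center R = {z \<in> carrier R. \<forall>r\<in>carrier R. z \<otimes>\<^bsub>R\<^esub> r = r \<otimes>\<^bsub>R\<^esub> z}"

definition regular_element :: "('a, 'x) ring_scheme \<Rightarrow> 'a \<Rightarrow> bool"
  where "regular_element R a \<longleftrightarrow> a \<in> carrier R \<and>
    (\<forall>r\<in>carrier R. (a \<otimes>\<^bsub>R\<^esub> r = \<zero>\<^bsub>R\<^esub> \<longrightarrow> r = \<zero>\<^bsub>R\<^esub>) \<and> (r \<otimes>\<^bsub>R\<^esub> a = \<zero>\<^bsub>R\<^esub> \<longrightarrow> r = \<zero>\<^bsub>R\<^esub>))"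


section \<open>Graded algebras\<close>

record ('k, 'g, 'a) graded_algebra = "('k, 'a) module" +
  homog :: "'g \<Rightarrow> 'a set"

text \<open>
  The family of homogeneous components of \<open>x\<close>: the unique finitely supported family
  \<open>f\<close> with \<open>f \<alpha> \<in> homog A \<alpha>\<close> and \<open>x = \<Sum>\<^sub>\<alpha> f \<alpha>\<close>.
\<close>

definition component ::
    "('k, 'g, 'a, 'x) graded_algebra_scheme \<Rightarrow> 'a \<Rightarrow> 'g \<Rightarrow> 'a"
  where "component A x = (THE f. (\<forall>\<alpha>. f \<alpha> \<in> homog A \<alpha>) \<and> finite {\<alpha>. f \<alpha> \<noteq> \<zero>\<^bsub>A\<^esub>} \<and>
    x = (\<Oplus>\<^bsub>A\<^esub>\<alpha>\<in>{\<alpha>. f \<alpha> \<noteq> \<zero>\<^bsub>A\<^esub>}. f \<alpha>))"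

definition graded_ideal :: "('k, 'g, 'a, 'x) graded_algebra_scheme \<Rightarrow> 'a set \<Rightarrow> bool"
  where "graded_ideal A J \<longleftrightarrow> ideal J A \<and> (\<forall>x\<in>J. \<forall>\<alpha>. component A x \<alpha> \<in> J)"

definition graded_map ::
    "('k, 'g, 'a, 'x) graded_algebra_scheme \<Rightarrow> ('k, 'g, 'b, 'y) graded_algebra_scheme \<Rightarrow>
     ('a \<Rightarrow> 'b) \<Rightarrow> bool"
  where "graded_map A B f \<longleftrightarrow> (\<forall>\<alpha>. f ` homog A \<alpha> \<subseteq> homog B \<alpha>)"

definition graded_alg_iso ::
    "('k, 'z) ring_scheme \<Rightarrow> ('k, 'g, 'a, 'x) graded_algebra_scheme \<Rightarrow>
     ('k, 'g, 'b, 'y) graded_algebra_scheme \<Rightarrow> bool"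
  where "graded_alg_iso K A B \<longleftrightarrow>
    (\<exists>f\<in>alg_hom K A B. bij_betw f (carrier A) (carrier B) \<and> graded_map A B f)"

text \<open>\<open>A Quot I\<close>, with the induced scalar multiplication and grading.\<close>

definition graded_quot ::
    "('k, 'g, 'a, 'x) graded_algebra_scheme \<Rightarrow> 'a set \<Rightarrow> ('k, 'g, 'a set) graded_algebra"
  where "graded_quot A I =
    \<lparr>carrier = carrier (A Quot I), mult = mult (A Quot I), one = one (A Quot I),
     ring.zero = ring.zero (A Quot I), add = add (A Quot I),
     smult = (\<lambda>c X. \<Union>x\<in>X. I +>\<^bsub>A\<^esub> (c \<odot>\<^bsub>A\<^esub> x)),
     homog = (\<lambda>\<alpha>. (\<lambda>x. I +>\<^bsub>A\<^esub> x) ` homog A \<alpha>)\<rparr>"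

definition ideal_sum :: "('a, 'x) ring_scheme \<Rightarrow> 'a set set \<Rightarrow> 'a set"
  where "ideal_sum A \<J> =
    {\<Oplus>\<^bsub>A\<^esub>J\<in>F. f J | F f. finite F \<and> F \<subseteq> \<J> \<and> (\<forall>J\<in>F. f J \<in> J)}"

definition canonical_ideal :: "('k, 'g::zero, 'a, 'x) graded_algebra_scheme \<Rightarrow> 'a set"
  where "canonical_ideal A =
    ideal_sum A {J. graded_ideal A J \<and> J \<inter> homog A 0 = {\<zero>\<^bsub>A\<^esub>}}"

text \<open>
  The graded twist: \<open>a \<star> b = \<chi>\<^sub>\<beta>(a) b\<close> for \<open>b\<close> homogeneous of degree \<open>\<beta>\<close>, extended additively in \<open>b\<close>.
  Since \<open>\<chi>\<^sub>0\<close> is the identity and \<open>\<chi>\<^sub>\<beta>(1) = 1\<close>, the identity element is unchanged.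
\<close>

definition graded_twist ::
    "('g \<Rightarrow> 'a \<Rightarrow> 'a) \<Rightarrow> ('k, 'g, 'a, 'x) graded_algebra_scheme \<Rightarrow> ('k, 'g, 'a, 'x) graded_algebra_scheme"
  where "graded_twist \<chi> A = A\<lparr>mult :=
    (\<lambda>a b. \<Oplus>\<^bsub>A\<^esub>\<beta>\<in>{\<beta>. component A b \<beta> \<noteq> \<zero>\<^bsub>A\<^esub>}. \<chi> \<beta> a \<otimes>\<^bsub>A\<^esub> component A b \<beta>)\<rparr>"

text \<open>The maps induced by the \<open>\<chi>\<^sub>\<alpha>\<close> on the quotient by \<open>I\<close>.\<close>

definition induced_action ::
    "('k, 'g, 'a, 'x) graded_algebra_scheme \<Rightarrow> 'a set \<Rightarrow> ('g \<Rightarrow> 'a \<Rightarrow> 'a) \<Rightarrow> 'g \<Rightarrow> 'a set \<Rightarrow> 'a set"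
  where "induced_action A I \<chi> \<alpha> = (\<lambda>X\<in>carrier (graded_quot A I). \<Union>x\<in>X. I +>\<^bsub>A\<^esub> \<chi> \<alpha> x)"


section \<open>Free algebras\<close>

text \<open>
  The free algebra on a set of letters: finitely supported functions on words, multiplied by
  convolution along concatenation, and graded by a degree function on the letters.
\<close>

definition free_algebra ::
    "('k, 'x) ring_scheme \<Rightarrow> 'l set \<Rightarrow> ('l \<Rightarrow> 'g::comm_monoid_add) \<Rightarrow>
     ('k, 'g, 'l list \<Rightarrow> 'k) graded_algebra"
  where "free_algebra K L d =
    (let F = {f. (\<forall>w. f w \<in> carrier K) \<and> finite {w. f w \<noteq> \<zero>\<^bsub>K\<^esub>} \<and>
                 (\<forall>w. f w \<noteq> \<zero>\<^bsub>K\<^esub> \<longrightarrow> set w \<subseteq> L)}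
     in \<lparr>carrier = F,
         mult = (\<lambda>f g w. \<Oplus>\<^bsub>K\<^esub>n\<in>{0..length w}. f (take n w) \<otimes>\<^bsub>K\<^esub> g (drop n w)),
         one = (\<lambda>w. if w = [] then \<one>\<^bsub>K\<^esub> else \<zero>\<^bsub>K\<^esub>),
         ring.zero = (\<lambda>w. \<zero>\<^bsub>K\<^esub>),
         add = (\<lambda>f g w. f w \<oplus>\<^bsub>K\<^esub> g w),
         smult = (\<lambda>c f w. c \<otimes>\<^bsub>K\<^esub> f w),
         homog = (\<lambda>\<alpha>. {f \<in> F. \<forall>w. f w \<noteq> \<zero>\<^bsub>K\<^esub> \<longrightarrow> sum_list (map d w) = \<alpha>})\<rparr>)"

definition free_gen :: "('k, 'x) ring_scheme \<Rightarrow> 'l \<Rightarrow> 'l list \<Rightarrow> 'k"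
  where "free_gen K l = (\<lambda>w. if w = [l] then \<one>\<^bsub>K\<^esub> else \<zero>\<^bsub>K\<^esub>)"


section \<open>Twisted generalized Weyl constructions and algebras\<close>

definition tgwd ::
    "('k, 'x) ring_scheme \<Rightarrow> ('k, 'r, 'y) module_scheme \<Rightarrow> nat \<Rightarrow> (nat \<Rightarrow> 'r \<Rightarrow> 'r) \<Rightarrow> (nat \<Rightarrow> 'r) \<Rightarrow> bool"
  where "tgwd K R m \<sigma> t \<longleftrightarrow> assoc_algebra K R \<and>
    (\<forall>i\<in>{1..m}. \<sigma> i \<in> carrier (alg_Aut K R)) \<and>
    (\<forall>i\<in>{1..m}. \<forall>j\<in>{1..m}. \<sigma> i \<otimes>\<^bsub>alg_Aut K R\<^esub> \<sigma> j = \<sigma> j \<otimes>\<^bsub>alg_Aut K R\<^esub> \<sigma> i) \<and>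
    (\<forall>i\<in>{1..m}. t i \<in> ring_center R)"

definition tgwd_regular :: "('r, 'y) ring_scheme \<Rightarrow> nat \<Rightarrow> (nat \<Rightarrow> 'r) \<Rightarrow> bool"
  where "tgwd_regular R m t \<longleftrightarrow> (\<forall>i\<in>{1..m}. regular_element R (t i))"

text \<open>
  The group \<open>\<int>\<^sup>m\<close>, with standard basis \<open>frag_of 1, \<dots>, frag_of m\<close>. Gradings below are
  indexed by the whole type \<open>nat \<Rightarrow>\<^sub>0 int\<close>, but letters only have degrees in \<open>\<int>\<^sup>m\<close>,
  so the homogeneous parts in all other degrees are zero.
\<close>

abbreviation Z_pow :: "nat \<Rightarrow> (nat \<Rightarrow>\<^sub>0 int) monoid"
  where "Z_pow m \<equiv> free_Abelian_group {1..m}"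

datatype sign = Plus | Minus

datatype 'r tgw_letter = Coeff 'r | Gen sign nat

fun letter_degree :: "'r tgw_letter \<Rightarrow> (nat \<Rightarrow>\<^sub>0 int)"
  where
    "letter_degree (Coeff r) = 0"
  | "letter_degree (Gen Plus i) = frag_of i"
  | "letter_degree (Gen Minus i) = - frag_of i"

definition tgw_free ::
    "('k, 'x) ring_scheme \<Rightarrow> ('k, 'r, 'y) module_scheme \<Rightarrow> nat \<Rightarrow>
     ('k, nat \<Rightarrow>\<^sub>0 int, 'r tgw_letter list \<Rightarrow> 'k) graded_algebra"
  where "tgw_free K R m =
    free_algebra K (Coeff ` carrier R \<union> {Gen s i | s i. i \<in> {1..m}}) letter_degree"

fun signed_aut ::
    "('k, 'x) ring_scheme \<Rightarrow> ('k, 'r, 'y) module_scheme \<Rightarrow> (nat \<Rightarrow> 'r \<Rightarrow> 'r) \<Rightarrow> sign \<Rightarrow> nat \<Rightarrow> 'r \<Rightarrow> 'r"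
  where
    "signed_aut K R \<sigma> Plus i = \<sigma> i"
  | "signed_aut K R \<sigma> Minus i = inv\<^bsub>alg_Aut K R\<^esub> (\<sigma> i)"

text \<open>
  The pairs \<open>(u, v)\<close> stand for relations \<open>u = v\<close>. The first four families make
  the letters \<open>Coeff r\<close> generate a homomorphic image of the algebra \<open>R\<close>.
\<close>

inductive_set tgw_rels ::
    "('k, 'x) ring_scheme \<Rightarrow> ('k, 'r, 'y) module_scheme \<Rightarrow> nat \<Rightarrow> (nat \<Rightarrow> 'r \<Rightarrow> 'r) \<Rightarrow> (nat \<Rightarrow> 'r) \<Rightarrow>
     (nat \<Rightarrow> nat \<Rightarrow> 'k) \<Rightarrow> (('r tgw_letter list \<Rightarrow> 'k) \<times> ('r tgw_letter list \<Rightarrow> 'k)) set"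
  for K :: "('k, 'x) ring_scheme" and R :: "('k, 'r, 'y) module_scheme"
    and m :: nat and \<sigma> :: "nat \<Rightarrow> 'r \<Rightarrow> 'r" and t :: "nat \<Rightarrow> 'r" and \<mu> :: "nat \<Rightarrow> nat \<Rightarrow> 'k"
  where
    coeff_one: "(free_gen K (Coeff \<one>\<^bsub>R\<^esub>), \<one>\<^bsub>tgw_free K R m\<^esub>) \<in> tgw_rels K R m \<sigma> t \<mu>"
  | coeff_add: "\<lbrakk>r \<in> carrier R; s \<in> carrier R\<rbrakk> \<Longrightarrow>
      (free_gen K (Coeff (r \<oplus>\<^bsub>R\<^esub> s)),
       free_gen K (Coeff r) \<oplus>\<^bsub>tgw_free K R m\<^esub> free_gen K (Coeff s)) \<in> tgw_rels K R m \<sigma> t \<mu>"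
  | coeff_mult: "\<lbrakk>r \<in> carrier R; s \<in> carrier R\<rbrakk> \<Longrightarrow>
      (free_gen K (Coeff (r \<otimes>\<^bsub>R\<^esub> s)),
       free_gen K (Coeff r) \<otimes>\<^bsub>tgw_free K R m\<^esub> free_gen K (Coeff s)) \<in> tgw_rels K R m \<sigma> t \<mu>"
  | coeff_smult: "\<lbrakk>c \<in> carrier K; r \<in> carrier R\<rbrakk> \<Longrightarrow>
      (free_gen K (Coeff (c \<odot>\<^bsub>R\<^esub> r)),
       c \<odot>\<^bsub>tgw_free K R m\<^esub> free_gen K (Coeff r)) \<in> tgw_rels K R m \<sigma> t \<mu>"
  | gen_coeff: "\<lbrakk>i \<in> {1..m}; r \<in> carrier R\<rbrakk> \<Longrightarrow>
      (free_gen K (Gen s i) \<otimes>\<^bsub>tgw_free K R m\<^esub> free_gen K (Coeff r),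
       free_gen K (Coeff (signed_aut K R \<sigma> s i r)) \<otimes>\<^bsub>tgw_free K R m\<^esub> free_gen K (Gen s i))
      \<in> tgw_rels K R m \<sigma> t \<mu>"
  | minus_plus: "i \<in> {1..m} \<Longrightarrow>
      (free_gen K (Gen Minus i) \<otimes>\<^bsub>tgw_free K R m\<^esub> free_gen K (Gen Plus i),
       free_gen K (Coeff (t i))) \<in> tgw_rels K R m \<sigma> t \<mu>"
  | plus_minus: "i \<in> {1..m} \<Longrightarrow>
      (free_gen K (Gen Plus i) \<otimes>\<^bsub>tgw_free K R m\<^esub> free_gen K (Gen Minus i),
       free_gen K (Coeff (\<sigma> i (t i)))) \<in> tgw_rels K R m \<sigma> t \<mu>"
  | mixed: "\<lbrakk>i \<in> {1..m}; j \<in> {1..m}; i \<noteq> j\<rbrakk> \<Longrightarrow>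
      (free_gen K (Gen Plus i) \<otimes>\<^bsub>tgw_free K R m\<^esub> free_gen K (Gen Minus j),
       \<mu> i j \<odot>\<^bsub>tgw_free K R m\<^esub>
         (free_gen K (Gen Minus j) \<otimes>\<^bsub>tgw_free K R m\<^esub> free_gen K (Gen Plus i)))
      \<in> tgw_rels K R m \<sigma> t \<mu>"

definition tgw_rel_ideal ::
    "('k, 'x) ring_scheme \<Rightarrow> ('k, 'r, 'y) module_scheme \<Rightarrow> nat \<Rightarrow> (nat \<Rightarrow> 'r \<Rightarrow> 'r) \<Rightarrow> (nat \<Rightarrow> 'r) \<Rightarrow>
     (nat \<Rightarrow> nat \<Rightarrow> 'k) \<Rightarrow> ('r tgw_letter list \<Rightarrow> 'k) set"
  where "tgw_rel_ideal K R m \<sigma> t \<mu> =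
    Idl\<^bsub>tgw_free K R m\<^esub> {u \<ominus>\<^bsub>tgw_free K R m\<^esub> v | u v. (u, v) \<in> tgw_rels K R m \<sigma> t \<mu>}"

definition tgwc ::
    "('k, 'x) ring_scheme \<Rightarrow> ('k, 'r, 'y) module_scheme \<Rightarrow> nat \<Rightarrow> (nat \<Rightarrow> 'r \<Rightarrow> 'r) \<Rightarrow> (nat \<Rightarrow> 'r) \<Rightarrow>
     (nat \<Rightarrow> nat \<Rightarrow> 'k) \<Rightarrow>
     ('k, nat \<Rightarrow>\<^sub>0 int, ('r tgw_letter list \<Rightarrow> 'k) set) graded_algebra"
  where "tgwc K R m \<sigma> t \<mu> = graded_quot (tgw_free K R m) (tgw_rel_ideal K R m \<sigma> t \<mu>)"

definition tgwc_letter ::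
    "('k, 'x) ring_scheme \<Rightarrow> ('k, 'r, 'y) module_scheme \<Rightarrow> nat \<Rightarrow> (nat \<Rightarrow> 'r \<Rightarrow> 'r) \<Rightarrow> (nat \<Rightarrow> 'r) \<Rightarrow>
     (nat \<Rightarrow> nat \<Rightarrow> 'k) \<Rightarrow> 'r tgw_letter \<Rightarrow> ('r tgw_letter list \<Rightarrow> 'k) set"
  where "tgwc_letter K R m \<sigma> t \<mu> l =
    tgw_rel_ideal K R m \<sigma> t \<mu> +>\<^bsub>tgw_free K R m\<^esub> free_gen K l"

abbreviation tgwc_gen ::
    "('k, 'x) ring_scheme \<Rightarrow> ('k, 'r, 'y) module_scheme \<Rightarrow> nat \<Rightarrow> (nat \<Rightarrow> 'r \<Rightarrow> 'r) \<Rightarrow> (nat \<Rightarrow> 'r) \<Rightarrow>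
     (nat \<Rightarrow> nat \<Rightarrow> 'k) \<Rightarrow> sign \<Rightarrow> nat \<Rightarrow> ('r tgw_letter list \<Rightarrow> 'k) set"
  where "tgwc_gen K R m \<sigma> t \<mu> s i \<equiv> tgwc_letter K R m \<sigma> t \<mu> (Gen s i)"

abbreviation tgwc_coeff ::
    "('k, 'x) ring_scheme \<Rightarrow> ('k, 'r, 'y) module_scheme \<Rightarrow> nat \<Rightarrow> (nat \<Rightarrow> 'r \<Rightarrow> 'r) \<Rightarrow> (nat \<Rightarrow> 'r) \<Rightarrow>
     (nat \<Rightarrow> nat \<Rightarrow> 'k) \<Rightarrow> 'r \<Rightarrow> ('r tgw_letter list \<Rightarrow> 'k) set"
  where "tgwc_coeff K R m \<sigma> t \<mu> r \<equiv> tgwc_letter K R m \<sigma> t \<mu> (Coeff r)"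

definition tgwa ::
    "('k, 'x) ring_scheme \<Rightarrow> ('k, 'r, 'y) module_scheme \<Rightarrow> nat \<Rightarrow> (nat \<Rightarrow> 'r \<Rightarrow> 'r) \<Rightarrow> (nat \<Rightarrow> 'r) \<Rightarrow>
     (nat \<Rightarrow> nat \<Rightarrow> 'k) \<Rightarrow>
     ('k, nat \<Rightarrow>\<^sub>0 int, ('r tgw_letter list \<Rightarrow> 'k) set set) graded_algebra"
  where "tgwa K R m \<sigma> t \<mu> =
    graded_quot (tgwc K R m \<sigma> t \<mu>) (canonical_ideal (tgwc K R m \<sigma> t \<mu>))"

definition tgwd_consistent ::
    "('k, 'x) ring_scheme \<Rightarrow> ('k, 'r, 'y) module_scheme \<Rightarrow> nat \<Rightarrow> (nat \<Rightarrow> 'r \<Rightarrow> 'r) \<Rightarrow> (nat \<Rightarrow> 'r) \<Rightarrow>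
     (nat \<Rightarrow> nat \<Rightarrow> 'k) \<Rightarrow> bool"
  where "tgwd_consistent K R m \<sigma> t \<mu> \<longleftrightarrow>
    inj_on (\<lambda>r. canonical_ideal (tgwc K R m \<sigma> t \<mu>) +>\<^bsub>tgwc K R m \<sigma> t \<mu>\<^esub> tgwc_coeff K R m \<sigma> t \<mu> r)
      (carrier R)"

text \<open>
  The restriction to \<open>R\<close> of a degree-preserving automorphism \<open>f\<close> of the construction, where \<open>R\<close> is
  identified with the degree-zero part along the canonical map.
\<close>

definition restrict_to_coeff ::
    "('k, 'x) ring_scheme \<Rightarrow> ('k, 'r, 'y) module_scheme \<Rightarrow> nat \<Rightarrow> (nat \<Rightarrow> 'r \<Rightarrow> 'r) \<Rightarrow> (nat \<Rightarrow> 'r) \<Rightarrow>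
     (nat \<Rightarrow> nat \<Rightarrow> 'k) \<Rightarrow>
     (('r tgw_letter list \<Rightarrow> 'k) set \<Rightarrow> ('r tgw_letter list \<Rightarrow> 'k) set) \<Rightarrow> 'r \<Rightarrow> 'r"
  where "restrict_to_coeff K R m \<sigma> t \<mu> f =
    (\<lambda>r\<in>carrier R. inv_into (carrier R) (tgwc_coeff K R m \<sigma> t \<mu>) (f (tgwc_coeff K R m \<sigma> t \<mu> r)))"

definition twisted_sigma ::
    "('k, 'x) ring_scheme \<Rightarrow> ('k, 'r, 'y) module_scheme \<Rightarrow> nat \<Rightarrow> (nat \<Rightarrow> 'r \<Rightarrow> 'r) \<Rightarrow> (nat \<Rightarrow> 'r) \<Rightarrow>
     (nat \<Rightarrow> nat \<Rightarrow> 'k) \<Rightarrow>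
     ((nat \<Rightarrow>\<^sub>0 int) \<Rightarrow> ('r tgw_letter list \<Rightarrow> 'k) set \<Rightarrow> ('r tgw_letter list \<Rightarrow> 'k) set) \<Rightarrow>
     nat \<Rightarrow> 'r \<Rightarrow> 'r"
  where "twisted_sigma K R m \<sigma> t \<mu> \<chi> i =
    inv\<^bsub>alg_Aut K R\<^esub> (restrict_to_coeff K R m \<sigma> t \<mu> (\<chi> (frag_of i))) \<otimes>\<^bsub>alg_Aut K R\<^esub> \<sigma> i"

end

theory Submission
  imports Defs
begin

text \<open>
  Write \<open>\<star>\<close> for the product of the twist. In the twist of \<open>C\<close> the coefficients are unchanged, and
  \<open>X\<^sup>+\<^sub>i \<star> r = X\<^sup>+\<^sub>i r = \<sigma>\<^sub>i(r) X\<^sup>+\<^sub>i = \<chi>\<^sub>i\<^sup>-\<^sup>1\<sigma>\<^sub>i(r) \<star> X\<^sup>+\<^sub>i\<close>, where \<open>\<chi>\<^sub>i\<close> is the automorphism in degree \<open>\<^bold>e\<^sub>i\<close>. For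
  \<open>i \<noteq> j\<close> the generators \<open>X\<^sup>+\<^sub>i\<close> and \<open>X\<^sup>-\<^sub>j\<close> still commute up to a scalar, which changes from \<open>\<mu>\<^sub>i\<^sub>j\<close> to \<open>\<nu>\<^sub>i\<^sub>j\<close>.
  The product of \<open>X\<^sup>-\<^sub>i\<close> and \<open>X\<^sup>+\<^sub>i\<close> is a scalar multiple of \<open>t\<^sub>i\<close>, and rescaling \<open>X\<^sup>+\<^sub>i\<close> removes the scalar. So the
  twist satisfies the relations of the twisted datum, and the universal property yields a homomorphism
  from the construction of that datum to the twist (\<open>twisted_model\<close>, \<open>twist_hom\<close>).

  Two points need the hypotheses on \<open>C\<close>. First, \<open>\<chi>\<^sub>i\<close> restricts to \<open>R\<close>: the degree zero part of \<open>C\<close> is the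
  image of \<open>R\<close>, by a normal form for products of generators (\<open>homog_zero_eq_coeff\<close>), and \<open>R\<close> embeds into \<open>C\<close> by
  consistency. Second, the relations for \<open>X\<^sup>-\<^sub>i\<close> and the commutation of the twisted automorphisms require that \<open>\<chi>\<^sub>i\<close>
  commutes with the \<open>\<sigma>\<^sub>j\<close> on \<open>R\<close>. This follows from regularity (\<open>\<rho>_commute\<close>).

  Bijectivity comes from symmetry instead of a basis. The conditions under which an action with prescribed restriction
  to \<open>R\<close> and prescribed scalars exists are the same for a datum and for its twist. So the construction of the twisted
  datum carries the inverse action, its twist by that action receives a homomorphism from \<open>C\<close>, and
  both composites are endomorphisms that fix the letters (\<open>twist_hom_comp\<close>).

  The canonical ideal consists of the elements whose components \<open>x\<close> satisfy \<open>a x c = 0\<close> for all homogeneous \<open>a\<close>, \<open>c\<close>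
  such that the product has degree zero (\<open>canonical_ideal_eq\<close>). Up to automorphisms the twist has the same
  products of homogeneous elements, so it has the same canonical ideal (\<open>canonical_ideal_twist\<close>), and the third
  part holds with the identity on cosets (\<open>graded_twist_quot_iso\<close>).
\<close>

section \<open>Associative algebras and their homomorphisms\<close>

lemma (in abelian_group) diff_eq_zeroD:
  assumes "a \<in> carrier G" "b \<in> carrier G" "a \<ominus> b = \<zero>"
  shows "a = b"
proof -
  have "a = (a \<ominus> b) \<oplus> b" using assms(1,2) by (simp add: a_minus_def a_assoc l_neg)
  then show ?thesis using assms by simp
qed

lemma assoc_algebraI:
  assumes "cring K" "abelian_group A"
    and "\<And>c x. \<lbrakk>c \<in> carrier K; x \<in> carrier A\<rbrakk> \<Longrightarrow> c \<odot>\<^bsub>A\<^esub> x \<in> carrier A"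
    and "\<And>c d x. \<lbrakk>c \<in> carrier K; d \<in> carrier K; x \<in> carrier A\<rbrakk> \<Longrightarrow>
      (c \<oplus>\<^bsub>K\<^esub> d) \<odot>\<^bsub>A\<^esub> x = c \<odot>\<^bsub>A\<^esub> x \<oplus>\<^bsub>A\<^esub> d \<odot>\<^bsub>A\<^esub> x"
    and "\<And>c x y. \<lbrakk>c \<in> carrier K; x \<in> carrier A; y \<in> carrier A\<rbrakk> \<Longrightarrow>
      c \<odot>\<^bsub>A\<^esub> (x \<oplus>\<^bsub>A\<^esub> y) = c \<odot>\<^bsub>A\<^esub> x \<oplus>\<^bsub>A\<^esub> c \<odot>\<^bsub>A\<^esub> y"
    and "\<And>c d x. \<lbrakk>c \<in> carrier K; d \<in> carrier K; x \<in> carrier A\<rbrakk> \<Longrightarrow>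
      (c \<otimes>\<^bsub>K\<^esub> d) \<odot>\<^bsub>A\<^esub> x = c \<odot>\<^bsub>A\<^esub> (d \<odot>\<^bsub>A\<^esub> x)"
    and "\<And>x. x \<in> carrier A \<Longrightarrow> \<one>\<^bsub>K\<^esub> \<odot>\<^bsub>A\<^esub> x = x"
    and "\<one>\<^bsub>A\<^esub> \<in> carrier A"
    and "\<And>x y. \<lbrakk>x \<in> carrier A; y \<in> carrier A\<rbrakk> \<Longrightarrow> x \<otimes>\<^bsub>A\<^esub> y \<in> carrier A"
    and "\<And>x y z. \<lbrakk>x \<in> carrier A; y \<in> carrier A; z \<in> carrier A\<rbrakk> \<Longrightarrow>
      (x \<otimes>\<^bsub>A\<^esub> y) \<otimes>\<^bsub>A\<^esub> z = x \<otimes>\<^bsub>A\<^esub> (y \<otimes>\<^bsub>A\<^esub> z)"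
    and "\<And>x. x \<in> carrier A \<Longrightarrow> \<one>\<^bsub>A\<^esub> \<otimes>\<^bsub>A\<^esub> x = x"
    and "\<And>x. x \<in> carrier A \<Longrightarrow> x \<otimes>\<^bsub>A\<^esub> \<one>\<^bsub>A\<^esub> = x"
    and "\<And>x y z. \<lbrakk>x \<in> carrier A; y \<in> carrier A; z \<in> carrier A\<rbrakk> \<Longrightarrow>
      (x \<oplus>\<^bsub>A\<^esub> y) \<otimes>\<^bsub>A\<^esub> z = x \<otimes>\<^bsub>A\<^esub> z \<oplus>\<^bsub>A\<^esub> y \<otimes>\<^bsub>A\<^esub> z"
    and "\<And>x y z. \<lbrakk>x \<in> carrier A; y \<in> carrier A; z \<in> carrier A\<rbrakk> \<Longrightarrow>
      z \<otimes>\<^bsub>A\<^esub> (x \<oplus>\<^bsub>A\<^esub> y) = z \<otimes>\<^bsub>A\<^esub> x \<oplus>\<^bsub>A\<^esub> z \<otimes>\<^bsub>A\<^esub> y"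
    and "\<And>c x y. \<lbrakk>c \<in> carrier K; x \<in> carrier A; y \<in> carrier A\<rbrakk> \<Longrightarrow>
      (c \<odot>\<^bsub>A\<^esub> x) \<otimes>\<^bsub>A\<^esub> y = c \<odot>\<^bsub>A\<^esub> (x \<otimes>\<^bsub>A\<^esub> y)"
    and "\<And>c x y. \<lbrakk>c \<in> carrier K; x \<in> carrier A; y \<in> carrier A\<rbrakk> \<Longrightarrow>
      x \<otimes>\<^bsub>A\<^esub> (c \<odot>\<^bsub>A\<^esub> y) = c \<odot>\<^bsub>A\<^esub> (x \<otimes>\<^bsub>A\<^esub> y)"
  shows "assoc_algebra K A"
proof -
  have "module K A" using assms(1-7) by (rule moduleI)
  moreover have "ring A"
  proof (rule ringI)
    show "monoid A" using assms(8-12) by (intro monoidI) auto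
  qed (use assms(2,13,14) in auto)
  ultimately show ?thesis
    using assms(15,16) by (simp add: assoc_algebra_def assoc_algebra_axioms_def)
qed

context assoc_algebra
begin

lemmas smult_mult_simps = smult_mult_left smult_mult_right

lemma smult_lcomm:
  "\<lbrakk>c \<in> carrier K; e \<in> carrier K; x \<in> carrier A\<rbrakk> \<Longrightarrow>
    c \<odot>\<^bsub>A\<^esub> (e \<odot>\<^bsub>A\<^esub> x) = e \<odot>\<^bsub>A\<^esub> (c \<odot>\<^bsub>A\<^esub> x)"
  by (simp add: smult_assoc1[symmetric] R.m_comm)

lemma ideal_smult_closed:
  assumes "ideal I A" "c \<in> carrier K" "x \<in> I"
  shows "c \<odot>\<^bsub>A\<^esub> x \<in> I"
proof -
  interpret ideal I A by fact
  have "c \<odot>\<^bsub>A\<^esub> x = (c \<odot>\<^bsub>A\<^esub> \<one>\<^bsub>A\<^esub>) \<otimes>\<^bsub>A\<^esub> x"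
    using assms Icarr by (simp add: smult_mult_left)
  then show ?thesis
    using assms by (simp add: I_l_closed)
qed

lemma Units_smult_cancel:
  assumes "c \<in> Units K" "x \<in> carrier A" "y \<in> carrier A" "c \<odot>\<^bsub>A\<^esub> x = c \<odot>\<^bsub>A\<^esub> y"
  shows "x = y"
proof -
  have "inv\<^bsub>K\<^esub> c \<odot>\<^bsub>A\<^esub> (c \<odot>\<^bsub>A\<^esub> z) = z" if "z \<in> carrier A" for z
    using assms(1) that by (simp add: smult_assoc1[symmetric] R.Units_closed)
  then show ?thesis
    using assms by metis
qed

end

lemma alg_homI:
  assumes "\<And>x. x \<in> carrier A \<Longrightarrow> f x \<in> carrier B"
    and "\<And>x y. \<lbrakk>x \<in> carrier A; y \<in> carrier A\<rbrakk> \<Longrightarrow> f (x \<otimes>\<^bsub>A\<^esub> y) = f x \<otimes>\<^bsub>B\<^esub> f y"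
    and "\<And>x y. \<lbrakk>x \<in> carrier A; y \<in> carrier A\<rbrakk> \<Longrightarrow> f (x \<oplus>\<^bsub>A\<^esub> y) = f x \<oplus>\<^bsub>B\<^esub> f y"
    and "f \<one>\<^bsub>A\<^esub> = \<one>\<^bsub>B\<^esub>"
    and "\<And>c x. \<lbrakk>c \<in> carrier K; x \<in> carrier A\<rbrakk> \<Longrightarrow> f (c \<odot>\<^bsub>A\<^esub> x) = c \<odot>\<^bsub>B\<^esub> f x"
  shows "f \<in> alg_hom K A B"
  using assms by (auto simp: alg_hom_def intro!: ring_hom_memI)

lemma alg_homD:
  assumes "f \<in> alg_hom K A B"
  shows "x \<in> carrier A \<Longrightarrow> f x \<in> carrier B"
    and "\<lbrakk>x \<in> carrier A; y \<in> carrier A\<rbrakk> \<Longrightarrow> f (x \<otimes>\<^bsub>A\<^esub> y) = f x \<otimes>\<^bsub>B\<^esub> f y"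
    and "\<lbrakk>x \<in> carrier A; y \<in> carrier A\<rbrakk> \<Longrightarrow> f (x \<oplus>\<^bsub>A\<^esub> y) = f x \<oplus>\<^bsub>B\<^esub> f y"
    and "f \<one>\<^bsub>A\<^esub> = \<one>\<^bsub>B\<^esub>"
    and "\<lbrakk>c \<in> carrier K; x \<in> carrier A\<rbrakk> \<Longrightarrow> f (c \<odot>\<^bsub>A\<^esub> x) = c \<odot>\<^bsub>B\<^esub> f x"
  using assms by (auto simp: alg_hom_def ring_hom_def)

lemma alg_hom_zero_minus:
  assumes "f \<in> alg_hom K A B" "assoc_algebra K A" "assoc_algebra K B"
  shows "f \<zero>\<^bsub>A\<^esub> = \<zero>\<^bsub>B\<^esub>"
    and "x \<in> carrier A \<Longrightarrow> f (\<ominus>\<^bsub>A\<^esub> x) = \<ominus>\<^bsub>B\<^esub> f x"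
    and "\<lbrakk>x \<in> carrier A; y \<in> carrier A\<rbrakk> \<Longrightarrow> f (x \<ominus>\<^bsub>A\<^esub> y) = f x \<ominus>\<^bsub>B\<^esub> f y"
proof -
  interpret A: assoc_algebra K A by fact
  interpret B: assoc_algebra K B by fact
  note f = alg_homD[OF assms(1)]
  have "f \<zero>\<^bsub>A\<^esub> \<oplus>\<^bsub>B\<^esub> f \<zero>\<^bsub>A\<^esub> = f \<zero>\<^bsub>A\<^esub>"
    using f(3)[of "\<zero>\<^bsub>A\<^esub>" "\<zero>\<^bsub>A\<^esub>"] by simp
  then show zero: "f \<zero>\<^bsub>A\<^esub> = \<zero>\<^bsub>B\<^esub>"
    using f(1)[of "\<zero>\<^bsub>A\<^esub>"] by simp
  show minus: "f (\<ominus>\<^bsub>A\<^esub> x) = \<ominus>\<^bsub>B\<^esub> f x" if "x \<in> carrier A" for x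
    using f(3)[of "\<ominus>\<^bsub>A\<^esub> x" x] f(1) zero that
    by (simp add: A.M.l_neg B.M.minus_equality)
  show "f (x \<ominus>\<^bsub>A\<^esub> y) = f x \<ominus>\<^bsub>B\<^esub> f y" if "x \<in> carrier A" "y \<in> carrier A" for x y
    using that f(1,3) minus by (simp add: a_minus_def)
qed

lemma alg_hom_comp:
  assumes "f \<in> alg_hom K A B" "g \<in> alg_hom K B C"
  shows "(\<lambda>x. g (f x)) \<in> alg_hom K A C"
  using alg_homD[OF assms(1)] alg_homD[OF assms(2)] by (intro alg_homI) simp_all

lemma alg_hom_id: "(\<lambda>x. x) \<in> alg_hom K A A"
  by (rule alg_homI) auto

lemma graded_mapD: "graded_map A B f \<Longrightarrow> x \<in> homog A \<alpha> \<Longrightarrow> f x \<in> homog B \<alpha>"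
  by (auto simp: graded_map_def)

lemma alg_Aut_carrierD:
  assumes "f \<in> carrier (alg_Aut K A)"
  shows "f \<in> alg_hom K A A" "bij_betw f (carrier A) (carrier A)" "f \<in> extensional (carrier A)"
  using assms by (auto simp: alg_Aut_def BijGroup_def Bij_def)

lemma alg_Aut_carrierI:
  assumes "f \<in> alg_hom K A A" "bij_betw f (carrier A) (carrier A)" "f \<in> extensional (carrier A)"
  shows "f \<in> carrier (alg_Aut K A)"
  using assms by (auto simp: alg_Aut_def BijGroup_def Bij_def)

lemma alg_Aut_mult:
  assumes "f \<in> carrier (alg_Aut K A)" "g \<in> carrier (alg_Aut K A)" 
  shows "f \<otimes>\<^bsub>alg_Aut K A\<^esub> g = compose (carrier A) f g"
  using assms by (auto simp: alg_Aut_def BijGroup_def)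

lemma alg_Aut_one: "\<one>\<^bsub>alg_Aut K A\<^esub> = (\<lambda>x\<in>carrier A. x)"
  by (simp add: alg_Aut_def BijGroup_def)

lemma alg_Aut_eqI:
  assumes "f \<in> carrier (alg_Aut K A)" "g \<in> carrier (alg_Aut K A)"
    and "\<And>x. x \<in> carrier A \<Longrightarrow> f x = g x"
  shows "f = g"
  using assms by (meson alg_Aut_carrierD(3) extensionalityI)

lemma alg_hom_inv_into:
  assumes f: "f \<in> alg_hom K A B" and bij: "bij_betw f (carrier A) (carrier B)"
    and "assoc_algebra K A" 
  shows "inv_into (carrier A) f \<in> alg_hom K B A"
proof -
  interpret A: assoc_algebra K A by fact
  let ?g = "inv_into (carrier A) f"
  note f = alg_homD[OF f]
  have g: "?g y \<in> carrier A" "f (?g y) = y" if "y \<in> carrier B" for y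
    using that bij by (auto simp: bij_betw_def inv_into_into f_inv_into_f)
  have gf: "?g (f x) = x" if "x \<in> carrier A" for x
    using that bij by (auto simp: bij_betw_def)
  show ?thesis
  proof (rule alg_homI)
    fix x y assume "x \<in> carrier B" "y \<in> carrier B"
    then show "?g (x \<otimes>\<^bsub>B\<^esub> y) = ?g x \<otimes>\<^bsub>A\<^esub> ?g y"
      using f(2)[of "?g x" "?g y"] gf[of "?g x \<otimes>\<^bsub>A\<^esub> ?g y"] g by simp
  next
    fix x y assume "x \<in> carrier B" "y \<in> carrier B"
    then show "?g (x \<oplus>\<^bsub>B\<^esub> y) = ?g x \<oplus>\<^bsub>A\<^esub> ?g y"
      using f(3)[of "?g x" "?g y"] gf[of "?g x \<oplus>\<^bsub>A\<^esub> ?g y"] g by simp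
  next
    show "?g \<one>\<^bsub>B\<^esub> = \<one>\<^bsub>A\<^esub>" using gf[of "\<one>\<^bsub>A\<^esub>"] f(4) by simp
  next
    fix c x assume "c \<in> carrier K" "x \<in> carrier B"
    then show "?g (c \<odot>\<^bsub>B\<^esub> x) = c \<odot>\<^bsub>A\<^esub> ?g x"
      using f(5)[of c "?g x"] gf[of "c \<odot>\<^bsub>A\<^esub> ?g x"] g by simp
  qed (use g in auto)
qed

lemma group_alg_Aut:
  assumes "assoc_algebra K A"
  shows "group (alg_Aut K A)"
proof (rule groupI)
  fix f g assume fg: "f \<in> carrier (alg_Aut K A)" "g \<in> carrier (alg_Aut K A)"
  show "f \<otimes>\<^bsub>alg_Aut K A\<^esub> g \<in> carrier (alg_Aut K A)"
    unfolding alg_Aut_mult[OF fg]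
  proof (rule alg_Aut_carrierI)
    have "(\<lambda>x. f (g x)) \<in> alg_hom K A A"
      using fg by (blast intro: alg_hom_comp dest: alg_Aut_carrierD(1))
    moreover interpret assoc_algebra K A by fact
    show "compose (carrier A) f g \<in> alg_hom K A A"
      using alg_homD[OF calculation] by (intro alg_homI) (auto simp: compose_def)
    show "bij_betw (compose (carrier A) f g) (carrier A) (carrier A)"
      using fg by (meson alg_Aut_carrierD(2) bij_betw_compose)
  qed auto
next
  interpret assoc_algebra K A by fact
  show "\<one>\<^bsub>alg_Aut K A\<^esub> \<in> carrier (alg_Aut K A)"
    unfolding alg_Aut_one by (rule alg_Aut_carrierI) (auto intro!: alg_homI simp: bij_betw_def inj_on_def)
next
  fix f g h assume fg: "f \<in> carrier (alg_Aut K A)" "g \<in> carrier (alg_Aut K A)" "h \<in> carrier (alg_Aut K A)"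
  have Bij: "f \<in> Bij (carrier A)" "g \<in> Bij (carrier A)" "h \<in> Bij (carrier A)"
    using fg by (auto simp: alg_Aut_def)
  show "f \<otimes>\<^bsub>alg_Aut K A\<^esub> g \<otimes>\<^bsub>alg_Aut K A\<^esub> h = f \<otimes>\<^bsub>alg_Aut K A\<^esub> (g \<otimes>\<^bsub>alg_Aut K A\<^esub> h)"
    using Bij group.is_monoid[OF group_BijGroup[of "carrier A"], THEN monoid.m_assoc, of f g h]
    by (simp add: alg_Aut_def BijGroup_def)
next
  fix f assume f: "f \<in> carrier (alg_Aut K A)"
  then show "\<one>\<^bsub>alg_Aut K A\<^esub> \<otimes>\<^bsub>alg_Aut K A\<^esub> f = f"
    using group.is_monoid[OF group_BijGroup[of "carrier A"], THEN monoid.l_one, of f]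
    by (simp add: alg_Aut_def) (simp add: BijGroup_def)
  let ?g = "\<lambda>x\<in>carrier A. inv_into (carrier A) f x"
  interpret A: assoc_algebra K A by fact
  note f' = alg_Aut_carrierD[OF f]
  have "?g \<in> alg_hom K A A"
    using alg_homD[OF alg_hom_inv_into[OF f'(1,2) assms]] by (intro alg_homI) auto
  then have g: "?g \<in> carrier (alg_Aut K A)"
    using f'(2) by (intro alg_Aut_carrierI) (auto simp: bij_betw_inv_into)
  moreover have "?g \<otimes>\<^bsub>alg_Aut K A\<^esub> f = \<one>\<^bsub>alg_Aut K A\<^esub>"
    unfolding alg_Aut_mult[OF g f] alg_Aut_one
    using f by (intro Bij_compose_restrict_eq) (simp add: alg_Aut_def)
  ultimately show "\<exists>g\<in>carrier (alg_Aut K A). g \<otimes>\<^bsub>alg_Aut K A\<^esub> f = \<one>\<^bsub>alg_Aut K A\<^esub>"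
    by blast
qed

lemma alg_Aut_inv:
  assumes A: "assoc_algebra K A" and f: "f \<in> carrier (alg_Aut K A)" and x: "x \<in> carrier A"
  shows "f ((inv\<^bsub>alg_Aut K A\<^esub> f) x) = x" "(inv\<^bsub>alg_Aut K A\<^esub> f) (f x) = x"
    "(inv\<^bsub>alg_Aut K A\<^esub> f) x \<in> carrier A"
proof -
  interpret group "alg_Aut K A" by (rule group_alg_Aut[OF A])
  have i: "inv\<^bsub>alg_Aut K A\<^esub> f \<in> carrier (alg_Aut K A)" using f by simp
  show "f ((inv\<^bsub>alg_Aut K A\<^esub> f) x) = x" "(inv\<^bsub>alg_Aut K A\<^esub> f) (f x) = x"
    using r_inv[OF f] l_inv[OF f] x unfolding alg_Aut_mult[OF f i] alg_Aut_mult[OF i f] alg_Aut_one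
    by (metis compose_eq restrict_apply')+
  show "(inv\<^bsub>alg_Aut K A\<^esub> f) x \<in> carrier A"
    using alg_homD(1)[OF alg_Aut_carrierD(1)[OF i] x] .
qed

section \<open>Graded algebras\<close>

locale graded_alg = assoc_algebra K A
  for K :: "('k, 'z) ring_scheme"
    and A :: "('k, 'g::ab_group_add, 'a, 'x) graded_algebra_scheme" (structure) +
  assumes homog_closed: "x \<in> homog A \<alpha> \<Longrightarrow> x \<in> carrier A"
    and homog_zero: "\<zero> \<in> homog A \<alpha>"
    and homog_add: "\<lbrakk>x \<in> homog A \<alpha>; y \<in> homog A \<alpha>\<rbrakk> \<Longrightarrow> x \<oplus> y \<in> homog A \<alpha>"
    and homog_smult: "\<lbrakk>c \<in> carrier K; x \<in> homog A \<alpha>\<rbrakk> \<Longrightarrow> c \<odot> x \<in> homog A \<alpha>"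
    and homog_one: "\<one> \<in> homog A 0"
    and homog_mult: "\<lbrakk>x \<in> homog A \<alpha>; y \<in> homog A \<beta>\<rbrakk> \<Longrightarrow> x \<otimes> y \<in> homog A (\<alpha> + \<beta>)"
    and component_homog: "x \<in> carrier A \<Longrightarrow> component A x \<alpha> \<in> homog A \<alpha>"
    and component_finite: "x \<in> carrier A \<Longrightarrow> finite {\<alpha>. component A x \<alpha> \<noteq> \<zero>}"
    and component_sum:
      "x \<in> carrier A \<Longrightarrow> x = (\<Oplus>\<alpha>\<in>{\<alpha>. component A x \<alpha> \<noteq> \<zero>}. component A x \<alpha>)"
    and component_add: "\<lbrakk>x \<in> carrier A; y \<in> carrier A\<rbrakk> \<Longrightarrow>
      component A (x \<oplus> y) \<alpha> = component A x \<alpha> \<oplus> component A y \<alpha>"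
    and component_of_homog:
      "x \<in> homog A \<alpha> \<Longrightarrow> component A x \<beta> = (if \<beta> = \<alpha> then x else \<zero>)"

text \<open>Projections are additive, so applied to any decomposition into homogeneous elements they return its
  summands. This gives the uniqueness on which the definition of the components relies.\<close>

lemma components_from_projection:
  fixes A :: "('k, 'g, 'a, 'x) graded_algebra_scheme"
  assumes A: "abelian_group A"
    and closed: "\<And>\<alpha> x. x \<in> homog A \<alpha> \<Longrightarrow> x \<in> carrier A"
    and zero: "\<And>\<alpha>. \<zero>\<^bsub>A\<^esub> \<in> homog A \<alpha>"
    and p_homog: "\<And>x \<alpha>. x \<in> carrier A \<Longrightarrow> p x \<alpha> \<in> homog A \<alpha>"
    and p_finite: "\<And>x. x \<in> carrier A \<Longrightarrow> finite {\<alpha>. p x \<alpha> \<noteq> \<zero>\<^bsub>A\<^esub>}"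
    and p_sum: "\<And>x. x \<in> carrier A \<Longrightarrow> x = (\<Oplus>\<^bsub>A\<^esub>\<alpha>\<in>{\<alpha>. p x \<alpha> \<noteq> \<zero>\<^bsub>A\<^esub>}. p x \<alpha>)"
    and p_add: "\<And>x y \<alpha>. \<lbrakk>x \<in> carrier A; y \<in> carrier A\<rbrakk> \<Longrightarrow> p (x \<oplus>\<^bsub>A\<^esub> y) \<alpha> = p x \<alpha> \<oplus>\<^bsub>A\<^esub> p y \<alpha>"
    and p_of_homog: "\<And>x \<alpha> \<beta>. x \<in> homog A \<alpha> \<Longrightarrow> p x \<beta> = (if \<beta> = \<alpha> then x else \<zero>\<^bsub>A\<^esub>)"
    and x: "x \<in> carrier A"
  shows "component A x = p x"
  unfolding component_def
proof (rule the_equality)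
  show "(\<forall>\<alpha>. p x \<alpha> \<in> homog A \<alpha>) \<and> finite {\<alpha>. p x \<alpha> \<noteq> \<zero>\<^bsub>A\<^esub>} \<and>
    x = (\<Oplus>\<^bsub>A\<^esub>\<alpha>\<in>{\<alpha>. p x \<alpha> \<noteq> \<zero>\<^bsub>A\<^esub>}. p x \<alpha>)"
    using x p_homog p_finite p_sum by blast
next
  interpret abelian_group A by fact
  have p0: "p \<zero>\<^bsub>A\<^esub> \<alpha> = \<zero>\<^bsub>A\<^esub>" for \<alpha>
    using p_of_homog[OF zero, of \<alpha> \<alpha>] by simp
  fix f assume f: "(\<forall>\<alpha>. f \<alpha> \<in> homog A \<alpha>) \<and> finite {\<alpha>. f \<alpha> \<noteq> \<zero>\<^bsub>A\<^esub>} \<and>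
    x = (\<Oplus>\<^bsub>A\<^esub>\<alpha>\<in>{\<alpha>. f \<alpha> \<noteq> \<zero>\<^bsub>A\<^esub>}. f \<alpha>)"
  have fc: "f \<alpha> \<in> carrier A" for \<alpha> using f closed by blast
  have sum: "p (\<Oplus>\<^bsub>A\<^esub>\<alpha>\<in>S. f \<alpha>) \<beta> = (if \<beta> \<in> S then f \<beta> else \<zero>\<^bsub>A\<^esub>)" if "finite S" for S \<beta>
    using that
  proof (induction S)
    case (insert \<gamma> S)
    have "p (\<Oplus>\<^bsub>A\<^esub>\<alpha>\<in>insert \<gamma> S. f \<alpha>) \<beta> = p (f \<gamma> \<oplus>\<^bsub>A\<^esub> (\<Oplus>\<^bsub>A\<^esub>\<alpha>\<in>S. f \<alpha>)) \<beta>"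
      using insert fc by (simp add: finsum_insert)
    also have "\<dots> = p (f \<gamma>) \<beta> \<oplus>\<^bsub>A\<^esub> p (\<Oplus>\<^bsub>A\<^esub>\<alpha>\<in>S. f \<alpha>) \<beta>"
      using fc by (intro p_add) auto
    also have "\<dots> = (if \<beta> = \<gamma> then f \<gamma> else \<zero>\<^bsub>A\<^esub>) \<oplus>\<^bsub>A\<^esub> (if \<beta> \<in> S then f \<beta> else \<zero>\<^bsub>A\<^esub>)"
      using f p_of_homog[of "f \<gamma>" \<gamma> \<beta>] insert by simp
    finally show ?case using insert fc by auto
  qed (simp add: p0)
  show "f = p x"
  proof
    fix \<beta> show "f \<beta> = p x \<beta>"
      using f sum[of "{\<alpha>. f \<alpha> \<noteq> \<zero>\<^bsub>A\<^esub>}" \<beta>] by auto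
  qed
qed

lemma graded_algI:
  fixes A :: "('k, 'g::ab_group_add, 'a, 'x) graded_algebra_scheme"
  assumes A: "assoc_algebra K A"
    and closed: "\<And>\<alpha> x. x \<in> homog A \<alpha> \<Longrightarrow> x \<in> carrier A"
    and zero: "\<And>\<alpha>. \<zero>\<^bsub>A\<^esub> \<in> homog A \<alpha>"
    and "\<And>\<alpha> x y. \<lbrakk>x \<in> homog A \<alpha>; y \<in> homog A \<alpha>\<rbrakk> \<Longrightarrow> x \<oplus>\<^bsub>A\<^esub> y \<in> homog A \<alpha>"
    and "\<And>\<alpha> c x. \<lbrakk>c \<in> carrier K; x \<in> homog A \<alpha>\<rbrakk> \<Longrightarrow> c \<odot>\<^bsub>A\<^esub> x \<in> homog A \<alpha>"
    and "\<one>\<^bsub>A\<^esub> \<in> homog A 0"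
    and "\<And>\<alpha> \<beta> x y. \<lbrakk>x \<in> homog A \<alpha>; y \<in> homog A \<beta>\<rbrakk> \<Longrightarrow> x \<otimes>\<^bsub>A\<^esub> y \<in> homog A (\<alpha> + \<beta>)"
    and "\<And>x \<alpha>. x \<in> carrier A \<Longrightarrow> p x \<alpha> \<in> homog A \<alpha>"
    and "\<And>x. x \<in> carrier A \<Longrightarrow> finite {\<alpha>. p x \<alpha> \<noteq> \<zero>\<^bsub>A\<^esub>}"
    and "\<And>x. x \<in> carrier A \<Longrightarrow> x = (\<Oplus>\<^bsub>A\<^esub>\<alpha>\<in>{\<alpha>. p x \<alpha> \<noteq> \<zero>\<^bsub>A\<^esub>}. p x \<alpha>)"
    and "\<And>x y \<alpha>. \<lbrakk>x \<in> carrier A; y \<in> carrier A\<rbrakk> \<Longrightarrow> p (x \<oplus>\<^bsub>A\<^esub> y) \<alpha> = p x \<alpha> \<oplus>\<^bsub>A\<^esub> p y \<alpha>"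
    and "\<And>x \<alpha> \<beta>. x \<in> homog A \<alpha> \<Longrightarrow> p x \<beta> = (if \<beta> = \<alpha> then x else \<zero>\<^bsub>A\<^esub>)"
  shows "graded_alg K A \<and> (\<forall>x\<in>carrier A. component A x = p x)"
proof -
  interpret assoc_algebra K A by fact
  have comp: "component A x = p x" if "x \<in> carrier A" for x
    by (rule components_from_projection[of A p, OF M.abelian_group_axioms]) (use that assms in auto)
  have "graded_alg_axioms K A"
  proof
    fix x assume "x \<in> carrier A"
    then show "x = (\<Oplus>\<^bsub>A\<^esub>\<alpha>\<in>{\<alpha>. component A x \<alpha> \<noteq> \<zero>\<^bsub>A\<^esub>}. component A x \<alpha>)"
      using assms(10) comp by metis
  qed (use assms comp in auto)
  then show ?thesis
    using A comp by (simp add: graded_alg_def)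
qed

context graded_alg
begin

lemma component_closed: "x \<in> carrier A \<Longrightarrow> component A x \<alpha> \<in> carrier A"
  by (meson component_homog homog_closed)

lemma homog_induct [consumes 1, case_names homog add]:
  assumes x: "x \<in> carrier A"
    and homog: "\<And>\<alpha> y. y \<in> homog A \<alpha> \<Longrightarrow> P y"
    and add: "\<And>y z. \<lbrakk>y \<in> carrier A; z \<in> carrier A; P y; P z\<rbrakk> \<Longrightarrow> P (y \<oplus> z)"
  shows "P x"
proof -
  have "P (\<Oplus>\<alpha>\<in>S. component A x \<alpha>)" if "finite S" for S
    using that
  proof (induction S)
    case empty
    then show ?case using homog[OF homog_zero] by simp
  next
    case (insert \<gamma> S)
    then show ?case
      using x component_closed homog[OF component_homog[OF x]] add
      by (simp add: Pi_def)
  qed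
  then show ?thesis
    using component_sum[OF x] component_finite[OF x] by metis
qed

lemma component_zero: "component A \<zero> \<alpha> = \<zero>"
  using component_of_homog[OF homog_zero[of \<alpha>], of \<alpha>] by simp

lemma component_smult:
  assumes "c \<in> carrier K" "x \<in> carrier A"
  shows "component A (c \<odot> x) \<alpha> = c \<odot> component A x \<alpha>"
  using assms(2)
proof (induction rule: homog_induct)
  case (homog \<beta> y)
  then show ?case
    using assms(1) by (simp add: component_of_homog[OF homog] component_of_homog[OF homog_smult[OF _ homog]])
next
  case (add y z)
  then show ?case
    using assms(1) component_closed by (simp add: component_add smult_r_distr)
qed

lemma homog_uminus: "x \<in> homog A \<alpha> \<Longrightarrow> \<ominus> x \<in> homog A \<alpha>"
  using homog_smult[of "\<ominus>\<^bsub>K\<^esub> \<one>\<^bsub>K\<^esub>" x \<alpha>] homog_closed[of x \<alpha>] by (simp add: smult_l_minus)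

lemma homog_diff: "\<lbrakk>x \<in> homog A \<alpha>; y \<in> homog A \<alpha>\<rbrakk> \<Longrightarrow> x \<ominus> y \<in> homog A \<alpha>"
  by (simp add: a_minus_def homog_uminus homog_add)

lemma component_uminus:
  "x \<in> carrier A \<Longrightarrow> component A (\<ominus> x) \<alpha> = \<ominus> component A x \<alpha>"
  using component_smult[of "\<ominus>\<^bsub>K\<^esub> \<one>\<^bsub>K\<^esub>" x \<alpha>] component_closed[of x \<alpha>] by (simp add: smult_l_minus)

lemma component_diff:
  "\<lbrakk>x \<in> carrier A; y \<in> carrier A\<rbrakk> \<Longrightarrow>
    component A (x \<ominus> y) \<alpha> = component A x \<alpha> \<ominus> component A y \<alpha>"
  by (simp add: a_minus_def component_uminus component_add)

lemma component_mult_left: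
  assumes a: "a \<in> homog A \<beta>" and x: "x \<in> carrier A"
  shows "component A (a \<otimes> x) \<alpha> = a \<otimes> component A x (\<alpha> - \<beta>)"
  using x
proof (induction rule: homog_induct)
  case (homog \<gamma> y)
  have "a \<in> carrier A" using a homog_closed by blast
  then show ?case
    by (auto simp: component_of_homog[OF homog] component_of_homog[OF homog_mult[OF a homog]]
        algebra_simps)
next
  case (add y z)
  then show ?case
    using homog_closed[OF a] component_closed by (simp add: component_add A.r_distr)
qed

lemma component_mult_right:
  assumes a: "a \<in> homog A \<beta>" and x: "x \<in> carrier A"
  shows "component A (x \<otimes> a) \<alpha> = component A x (\<alpha> - \<beta>) \<otimes> a"
  using x
proof (induction rule: homog_induct)
  case (homog \<gamma> y)
  have "a \<in> carrier A" using a homog_closed by blast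
  then show ?case
    by (auto simp: component_of_homog[OF homog] component_of_homog[OF homog_mult[OF homog a]]
        algebra_simps)
next
  case (add y z)
  then show ?case
    using homog_closed[OF a] component_closed by (simp add: component_add A.l_distr)
qed

text \<open>Multiples by homogeneous elements suffice: a product is additive in the multiplier, and
  multiplying by a homogeneous element only shifts the components.\<close>

lemma graded_idealI_components:
  assumes zero: "\<And>\<alpha>. P \<alpha> \<zero>"
    and add: "\<And>x y \<alpha>. \<lbrakk>x \<in> homog A \<alpha>; y \<in> homog A \<alpha>; P \<alpha> x; P \<alpha> y\<rbrakk> \<Longrightarrow> P \<alpha> (x \<oplus> y)"
    and left: "\<And>a x \<alpha> \<beta>. \<lbrakk>a \<in> homog A \<beta>; x \<in> homog A \<alpha>; P \<alpha> x\<rbrakk> \<Longrightarrow> P (\<beta> + \<alpha>) (a \<otimes> x)"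
    and right: "\<And>a x \<alpha> \<beta>. \<lbrakk>a \<in> homog A \<beta>; x \<in> homog A \<alpha>; P \<alpha> x\<rbrakk> \<Longrightarrow> P (\<alpha> + \<beta>) (x \<otimes> a)"
  shows "graded_ideal A {x \<in> carrier A. \<forall>\<alpha>. P \<alpha> (component A x \<alpha>)}"
proof -
  let ?N = "{x \<in> carrier A. \<forall>\<alpha>. P \<alpha> (component A x \<alpha>)}"
  have sum: "x \<oplus> y \<in> ?N" if "x \<in> ?N" "y \<in> ?N" for x y
    using that by (auto simp: component_add intro!: add[OF component_homog component_homog])
  have l: "a \<otimes> x \<in> ?N" if x: "x \<in> ?N" and a: "a \<in> carrier A" for a x
    using a
  proof (induction rule: homog_induct)
    case (homog \<alpha> y)
    then show ?case
      using x homog_closed[OF homog]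
      by (auto simp: component_mult_left[OF homog]
          dest!: spec[of _ "_ - \<alpha>"] left[OF homog component_homog, rotated])
  next
    case (add y z)
    then show ?case using x sum[of "y \<otimes> x" "z \<otimes> x"] by (simp add: A.l_distr)
  qed
  have r: "x \<otimes> a \<in> ?N" if x: "x \<in> ?N" and a: "a \<in> carrier A" for a x
    using a
  proof (induction rule: homog_induct)
    case (homog \<alpha> y)
    then show ?case
      using x homog_closed[OF homog]
      by (auto simp: component_mult_right[OF homog]
          dest!: spec[of _ "_ - \<alpha>"] right[OF homog component_homog, rotated])
  next
    case (add y z)
    then show ?case using x sum[of "x \<otimes> y" "x \<otimes> z"] by (simp add: A.r_distr)
  qed
  have "ideal ?N A"
  proof (rule idealI)
    show "subgroup ?N (add_monoid A)"
    proof (rule M.add.subgroupI)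
      show "?N \<noteq> {}" using zero component_zero by auto
      fix x assume x: "x \<in> ?N"
      have "\<ominus> x = (\<ominus> \<one>) \<otimes> x" using x by (simp add: A.l_minus)
      then show "\<ominus> x \<in> ?N" using l[OF x, of "\<ominus> \<one>"] by simp
    qed (use sum in auto)
  qed (use l r A.ring_axioms in auto)
  then show ?thesis
    by (auto simp: graded_ideal_def component_closed zero component_of_homog[OF component_homog])
qed

text \<open>The elements all of whose components lie in the generated ideal form an ideal that contains the
  homogeneous generators, hence everything.\<close>

lemma graded_ideal_genideal:
  assumes S: "\<And>s. s \<in> S \<Longrightarrow> \<exists>\<alpha>. s \<in> homog A \<alpha>"
  shows "graded_ideal A (Idl S)"
proof -
  have SC: "S \<subseteq> carrier A" using S homog_closed by blast
  interpret I: ideal "Idl S" A by (rule A.genideal_ideal[OF SC])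
  let ?N = "{x \<in> carrier A. \<forall>\<alpha>. component A x \<alpha> \<in> Idl S}"
  have "graded_ideal A ?N"
    by (rule graded_idealI_components)
      (use homog_closed in \<open>auto simp: I.I_l_closed I.I_r_closed\<close>)
  then have "ideal ?N A" by (simp add: graded_ideal_def)
  moreover have "S \<subseteq> ?N"
  proof
    fix s assume s: "s \<in> S"
    then obtain \<alpha> where "s \<in> homog A \<alpha>" using S by blast
    then show "s \<in> ?N"
      using s SC A.genideal_self[OF SC] by (auto simp: component_of_homog)
  qed
  ultimately have "Idl S \<subseteq> ?N" by (rule A.genideal_minimal)
  then show ?thesis
    using I.is_ideal by (auto simp: graded_ideal_def)
qed

end

section \<open>Graded homomorphisms and graded quotients\<close>

lemma graded_hom_component:
  assumes "graded_alg K A" "graded_alg K B" "f \<in> alg_hom K A B" "graded_map A B f" "x \<in> carrier A"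
  shows "component B (f x) \<alpha> = f (component A x \<alpha>)"
proof -
  interpret A: graded_alg K A by fact
  interpret B: graded_alg K B by fact
  note f = alg_homD[OF assms(3)]
  note f0 = alg_hom_zero_minus(1)[OF assms(3) A.assoc_algebra_axioms B.assoc_algebra_axioms]
  show ?thesis
    using assms(5)
  proof (induction rule: A.homog_induct)
    case (homog \<beta> y)
    then show ?case
      using graded_mapD[OF assms(4) homog]
      by (simp add: A.component_of_homog[OF homog] B.component_of_homog f0)
  next
    case (add y z)
    then show ?case
      using f(1,3) A.component_closed by (simp add: A.component_add B.component_add)
  qed
qed

lemma graded_bij_homog:
  assumes A: "graded_alg K A" and B: "graded_alg K B" and f: "f \<in> alg_hom K A B" "graded_map A B f"
    and bij: "bij_betw f (carrier A) (carrier B)"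
  shows "f ` homog A \<alpha> = homog B \<alpha>"
proof
  interpret A: graded_alg K A by fact
  interpret B: graded_alg K B by fact
  show "f ` homog A \<alpha> \<subseteq> homog B \<alpha>" using f(2) by (simp add: graded_map_def)
  show "homog B \<alpha> \<subseteq> f ` homog A \<alpha>"
  proof
    fix y assume y: "y \<in> homog B \<alpha>"
    then obtain x where x: "x \<in> carrier A" "y = f x"
      using bij B.homog_closed by (metis bij_betw_def imageE)
    have "y = f (component A x \<alpha>)"
      using y x B.component_of_homog[OF y, of \<alpha>] graded_hom_component[OF A B f x(1)] by simp
    then show "y \<in> f ` homog A \<alpha>" using A.component_homog[OF x(1)] by blast
  qed
qed

lemma graded_alg_isoI:
  assumes "f \<in> alg_hom K A B" "bij_betw f (carrier A) (carrier B)" "graded_map A B f"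
  shows "graded_alg_iso K A B"
  using assms by (auto simp: graded_alg_iso_def)

lemma graded_alg_iso_trans:
  assumes "graded_alg_iso K A B" "graded_alg_iso K B C"
  shows "graded_alg_iso K A C"
proof -
  obtain f where f: "f \<in> alg_hom K A B" "bij_betw f (carrier A) (carrier B)" "graded_map A B f"
    using assms(1) by (auto simp: graded_alg_iso_def)
  obtain g where g: "g \<in> alg_hom K B C" "bij_betw g (carrier B) (carrier C)" "graded_map B C g"
    using assms(2) by (auto simp: graded_alg_iso_def)
  show ?thesis
  proof (rule graded_alg_isoI)
    show "(\<lambda>x. g (f x)) \<in> alg_hom K A C" by (rule alg_hom_comp[OF f(1) g(1)])
    show "bij_betw (\<lambda>x. g (f x)) (carrier A) (carrier C)"
      using bij_betw_trans[OF f(2) g(2)] by (simp add: comp_def)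
    show "graded_map A C (\<lambda>x. g (f x))"
      using f(3) g(3) by (fastforce simp: graded_map_def)
  qed
qed

lemma graded_alg_iso_sym:
  assumes A: "graded_alg K A" and B: "graded_alg K B" and iso: "graded_alg_iso K A B"
  shows "graded_alg_iso K B A"
proof -
  obtain f where f: "f \<in> alg_hom K A B" "bij_betw f (carrier A) (carrier B)" "graded_map A B f"
    using iso by (auto simp: graded_alg_iso_def)
  interpret A: graded_alg K A by fact
  show ?thesis
  proof (rule graded_alg_isoI)
    show "inv_into (carrier A) f \<in> alg_hom K B A"
      by (rule alg_hom_inv_into[OF f(1,2) A.assoc_algebra_axioms])
    show "bij_betw (inv_into (carrier A) f) (carrier B) (carrier A)"
      by (rule bij_betw_inv_into[OF f(2)])
    have "inv_into (carrier A) f (f x) = x" if "x \<in> homog A \<alpha>" for x \<alpha>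
      using that f(2) A.homog_closed by (auto simp: bij_betw_def)
    then show "graded_map B A (inv_into (carrier A) f)"
      unfolding graded_map_def graded_bij_homog[OF A B f(1,3,2), symmetric] by auto
  qed
qed

text \<open>This covers the degenerate case of a zero coefficient algebra.\<close>

lemma graded_alg_iso_zero:
  assumes "graded_alg K A" "graded_alg K B" "carrier A = {\<zero>\<^bsub>A\<^esub>}" "carrier B = {\<zero>\<^bsub>B\<^esub>}"
  shows "graded_alg_iso K A B"
proof -
  interpret A: graded_alg K A by fact
  interpret B: graded_alg K B by fact
  show ?thesis
  proof (rule graded_alg_isoI[of "\<lambda>_. \<zero>\<^bsub>B\<^esub>"])
    have "\<one>\<^bsub>B\<^esub> = \<zero>\<^bsub>B\<^esub>" using assms(4) B.A.one_closed by blast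
    then show "(\<lambda>_. \<zero>\<^bsub>B\<^esub>) \<in> alg_hom K A B" by (intro alg_homI) (auto simp: B.smult_r_null)
    show "bij_betw (\<lambda>_. \<zero>\<^bsub>B\<^esub>) (carrier A) (carrier B)"
      unfolding assms(3,4) by (auto simp: bij_betw_def)
    show "graded_map A B (\<lambda>_. \<zero>\<^bsub>B\<^esub>)" using B.homog_zero by (auto simp: graded_map_def)
  qed
qed

context graded_alg
begin

lemma coset_eq_iff:
  assumes "ideal I A" "x \<in> carrier A" "y \<in> carrier A"
  shows "I +> x = I +> y \<longleftrightarrow> x \<ominus> y \<in> I"
  using A.quotient_eq_iff_same_a_r_cos[OF assms] by simp

lemma coset_eq_zero_iff:
  assumes "ideal I A" "x \<in> carrier A"
  shows "I +> x = I +> \<zero> \<longleftrightarrow> x \<in> I"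
  using coset_eq_iff[OF assms, of "\<zero>"] assms by (simp add: a_minus_def)

lemma graded_quot_simps:
  assumes "ideal I A"
  shows "carrier (graded_quot A I) = (\<lambda>x. I +> x) ` carrier A"
    and "\<lbrakk>x \<in> carrier A; y \<in> carrier A\<rbrakk> \<Longrightarrow>
      (I +> x) \<otimes>\<^bsub>graded_quot A I\<^esub> (I +> y) = I +> (x \<otimes> y)"
    and "\<lbrakk>x \<in> carrier A; y \<in> carrier A\<rbrakk> \<Longrightarrow>
      (I +> x) \<oplus>\<^bsub>graded_quot A I\<^esub> (I +> y) = I +> (x \<oplus> y)"
    and "\<one>\<^bsub>graded_quot A I\<^esub> = I +> \<one>"
    and "\<zero>\<^bsub>graded_quot A I\<^esub> = I +> \<zero>"
    and "\<lbrakk>c \<in> carrier K; x \<in> carrier A\<rbrakk> \<Longrightarrow>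
      c \<odot>\<^bsub>graded_quot A I\<^esub> (I +> x) = I +> (c \<odot> x)"
    and "homog (graded_quot A I) \<alpha> = (\<lambda>x. I +> x) ` homog A \<alpha>"
proof -
  interpret ideal I A by fact
  show "carrier (graded_quot A I) = (\<lambda>x. I +> x) ` carrier A"
    by (auto simp: graded_quot_def FactRing_def A_RCOSETS_def')
  show "(I +> x) \<otimes>\<^bsub>graded_quot A I\<^esub> (I +> y) = I +> (x \<otimes> y)"
    if "x \<in> carrier A" "y \<in> carrier A"
    using rcoset_mult_add[OF that] by (simp add: graded_quot_def FactRing_def)
  show "(I +> x) \<oplus>\<^bsub>graded_quot A I\<^esub> (I +> y) = I +> (x \<oplus> y)"
    if "x \<in> carrier A" "y \<in> carrier A"
    using a_rcos_sum[OF that] by (simp add: graded_quot_def FactRing_def)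
  show "\<one>\<^bsub>graded_quot A I\<^esub> = I +> \<one>" by (simp add: graded_quot_def FactRing_def)
  show "\<zero>\<^bsub>graded_quot A I\<^esub> = I +> \<zero>"
    using a_subset by (simp add: graded_quot_def FactRing_def)
  show "homog (graded_quot A I) \<alpha> = (\<lambda>x. I +> x) ` homog A \<alpha>"
    by (simp add: graded_quot_def)
  show "c \<odot>\<^bsub>graded_quot A I\<^esub> (I +> x) = I +> (c \<odot> x)"
    if c: "c \<in> carrier K" and x: "x \<in> carrier A"
  proof -
    have "I +> (c \<odot> y) = I +> (c \<odot> x)" if y: "y \<in> I +> x" for y
    proof -
      obtain h where h: "h \<in> I" "y = h \<oplus> x" using y by (auto simp: a_r_coset_def')
      have hc: "h \<in> carrier A" using h(1) by (rule Icarr)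
      have "c \<odot> y \<ominus> c \<odot> x = c \<odot> h"
        using c x hc h(2) by (simp add: smult_r_distr a_minus_def M.a_assoc M.r_neg)
      then show ?thesis
        using c x hc h ideal_smult_closed[OF assms c h(1)] by (subst coset_eq_iff[OF assms]) simp_all
    qed
    then show ?thesis
      unfolding graded_quot_def module.simps using a_rcos_self[OF x] by (intro SUP_eq_const) blast+
  qed
qed

lemma assoc_algebra_graded_quot:
  assumes "ideal I A"
  shows "assoc_algebra K (graded_quot A I)"
proof -
  note simps = graded_quot_simps[OF assms]
  have "abelian_group (graded_quot A I)"
  proof (rule abelian_groupI)
    fix X assume "X \<in> carrier (graded_quot A I)"
    then obtain x where x: "x \<in> carrier A" "X = I +> x" by (auto simp: simps)
    then show "\<exists>Y\<in>carrier (graded_quot A I). Y \<oplus>\<^bsub>graded_quot A I\<^esub> X = \<zero>\<^bsub>graded_quot A I\<^esub>"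
      by (intro bexI[of _ "I +> (\<ominus> x)"]) (auto simp: simps M.l_neg)
  qed (auto simp: simps M.a_ac)
  then show ?thesis
    by (rule assoc_algebraI[OF R.cring_axioms]; (unfold simps(1))?; (elim imageE)?;
        auto simp: simps(2-6) smult_l_distr smult_r_distr smult_assoc1 A.m_assoc A.l_distr A.r_distr smult_mult_simps)
qed

lemma finsum_coset:
  assumes "ideal I A" "finite S" "\<And>\<alpha>. f \<alpha> \<in> carrier A"
  shows "(\<Oplus>\<^bsub>graded_quot A I\<^esub>\<alpha>\<in>S. I +> f \<alpha>) = I +> (\<Oplus>\<alpha>\<in>S. f \<alpha>)"
proof -
  interpret Q: assoc_algebra K "graded_quot A I" by (rule assoc_algebra_graded_quot[OF assms(1)])
  show ?thesis
    using assms(2)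
  proof (induction S)
    case empty
    then show ?case by (simp add: graded_quot_simps[OF assms(1)])
  next
    case (insert \<gamma> S)
    have c: "I +> f \<alpha> \<in> carrier (graded_quot A I)" for \<alpha>
      using assms(3) by (auto simp: graded_quot_simps(1)[OF assms(1)])
    have "(\<Oplus>\<^bsub>graded_quot A I\<^esub>\<alpha>\<in>insert \<gamma> S. I +> f \<alpha>) =
        (I +> f \<gamma>) \<oplus>\<^bsub>graded_quot A I\<^esub> (I +> (\<Oplus>\<alpha>\<in>S. f \<alpha>))"
      using c by (subst Q.M.finsum_insert) (use insert in auto)
    also have "\<dots> = I +> (f \<gamma> \<oplus> (\<Oplus>\<alpha>\<in>S. f \<alpha>))"
      using assms(3) by (intro graded_quot_simps(3)[OF assms(1)]) auto
    also have "f \<gamma> \<oplus> (\<Oplus>\<alpha>\<in>S. f \<alpha>) = (\<Oplus>\<alpha>\<in>insert \<gamma> S. f \<alpha>)"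
      using assms(3) insert by (simp add: Pi_def)
    finally show ?case .
  qed
qed

text \<open>The components of a coset are the cosets of the components of any representative, which is well
  defined because components of elements of \<open>I\<close> stay in \<open>I\<close>.\<close>

lemma graded_alg_graded_quot:
  assumes I: "graded_ideal A I"
  shows "graded_alg K (graded_quot A I)"
    and "x \<in> carrier A \<Longrightarrow> component (graded_quot A I) (I +> x) \<alpha> = I +> component A x \<alpha>"
proof -
  let ?Q = "graded_quot A I"
  have id: "ideal I A" and comp: "\<And>x \<alpha>. x \<in> I \<Longrightarrow> component A x \<alpha> \<in> I"
    using I by (auto simp: graded_ideal_def)
  note simps = graded_quot_simps[OF id]
  define rep where "rep X = (SOME x. x \<in> carrier A \<and> X = I +> x)" for X
  define p where "p X \<alpha> = I +> component A (rep X) \<alpha>" for X \<alpha>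
  have p: "p (I +> x) \<alpha> = I +> component A x \<alpha>" if x: "x \<in> carrier A" for x \<alpha>
  proof -
    have "rep (I +> x) \<in> carrier A \<and> I +> x = I +> rep (I +> x)"
      unfolding rep_def by (rule someI[of _ x]) (use x in simp)
    then show ?thesis
      unfolding p_def using x coset_eq_iff[OF id] comp
      by (metis component_closed component_diff)
  qed
  have fin: "finite {\<alpha>. I +> component A x \<alpha> \<noteq> \<zero>\<^bsub>?Q\<^esub>}" if "x \<in> carrier A" for x
    by (rule finite_subset[OF _ component_finite[OF that]]) (auto simp: simps)
  have sum: "I +> x = (\<Oplus>\<^bsub>?Q\<^esub>\<alpha>\<in>{\<alpha>. I +> component A x \<alpha> \<noteq> \<zero>\<^bsub>?Q\<^esub>}. I +> component A x \<alpha>)"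
    if x: "x \<in> carrier A" for x
  proof -
    interpret Q: assoc_algebra K ?Q by (rule assoc_algebra_graded_quot[OF id])
    have "I +> x = I +> (\<Oplus>\<alpha>\<in>{\<alpha>. component A x \<alpha> \<noteq> \<zero>}. component A x \<alpha>)"
      using component_sum[OF x] by simp
    also have "\<dots> = (\<Oplus>\<^bsub>?Q\<^esub>\<alpha>\<in>{\<alpha>. component A x \<alpha> \<noteq> \<zero>}. I +> component A x \<alpha>)"
      by (rule finsum_coset[symmetric, OF id component_finite[OF x] component_closed[OF x]])
    also have "\<dots> = (\<Oplus>\<^bsub>?Q\<^esub>\<alpha>\<in>{\<alpha>. I +> component A x \<alpha> \<noteq> \<zero>\<^bsub>?Q\<^esub>}. I +> component A x \<alpha>)"
      by (rule Q.M.add.finprod_mono_neutral_cong_right)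
        (use component_finite[OF x] component_closed[OF x] in \<open>auto simp: simps\<close>)
    finally show ?thesis .
  qed
  have *: "graded_alg K ?Q \<and> (\<forall>X\<in>carrier ?Q. component ?Q X = p X)"
  proof (rule graded_algI[OF assoc_algebra_graded_quot[OF id]])
    fix \<alpha> X Y assume "X \<in> homog ?Q \<alpha>" "Y \<in> homog ?Q \<alpha>"
    then show "X \<oplus>\<^bsub>?Q\<^esub> Y \<in> homog ?Q \<alpha>"
      by (auto simp: simps homog_closed intro!: homog_add)
  next
    fix \<alpha> \<beta> X Y assume "X \<in> homog ?Q \<alpha>" "Y \<in> homog ?Q \<beta>"
    then show "X \<otimes>\<^bsub>?Q\<^esub> Y \<in> homog ?Q (\<alpha> + \<beta>)"
      by (auto simp: simps homog_closed intro!: homog_mult)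
  next
    fix X \<alpha> \<beta> assume "X \<in> homog ?Q \<alpha>"
    then show "p X \<beta> = (if \<beta> = \<alpha> then X else \<zero>\<^bsub>?Q\<^esub>)"
      by (auto simp: simps p homog_closed component_of_homog)
  next
    fix X assume "X \<in> carrier ?Q"
    then obtain x where x: "x \<in> carrier A" "X = I +> x" by (auto simp: simps)
    have pX: "p X = (\<lambda>\<alpha>. I +> component A x \<alpha>)" using p[OF x(1)] x(2) by blast
    show "X = (\<Oplus>\<^bsub>?Q\<^esub>\<alpha>\<in>{\<alpha>. p X \<alpha> \<noteq> \<zero>\<^bsub>?Q\<^esub>}. p X \<alpha>)"
      unfolding pX unfolding x(2) by (rule sum[OF x(1)])
  qed (use fin in \<open>auto simp: simps homog_closed homog_zero homog_smult homog_one p component_homog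
      component_closed component_add\<close>)
  then show "graded_alg K ?Q" by simp
  show "component ?Q (I +> x) \<alpha> = I +> component A x \<alpha>" if "x \<in> carrier A"
    using * that p by (auto simp: simps)
qed

lemma coset_alg_hom:
  assumes "ideal I A"
  shows "(\<lambda>x. I +> x) \<in> alg_hom K A (graded_quot A I)"
  by (rule alg_homI) (auto simp: graded_quot_simps[OF assms])

lemma graded_quot_factor:
  fixes B :: "('k, 'b, 'y) module_scheme"
  assumes I: "ideal I A" and B: "assoc_algebra K B" and f: "f \<in> alg_hom K A B"
    and ker: "\<And>x. x \<in> I \<Longrightarrow> f x = \<zero>\<^bsub>B\<^esub>"
  obtains g where "g \<in> alg_hom K (graded_quot A I) B" "\<And>x. x \<in> carrier A \<Longrightarrow> g (I +> x) = f x"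
proof -
  interpret I: ideal I A by fact
  interpret B: assoc_algebra K B by fact
  note simps = graded_quot_simps[OF I]
  define rep where "rep X = (SOME x. x \<in> carrier A \<and> X = I +> x)" for X
  define g where "g X = f (rep X)" for X
  have g: "g (I +> x) = f x" if x: "x \<in> carrier A" for x
  proof -
    let ?r = "rep (I +> x)"
    have r: "?r \<in> carrier A \<and> I +> x = I +> ?r"
      unfolding rep_def by (rule someI[of _ x]) (use x in simp)
    then have "?r \<ominus> x \<in> I" using x coset_eq_iff[OF I, of "?r" x] by simp
    then have "f ?r \<ominus>\<^bsub>B\<^esub> f x = \<zero>\<^bsub>B\<^esub>"
      using ker alg_hom_zero_minus(3)[OF f assoc_algebra_axioms B] r x by metis
    then show ?thesis
      using r x alg_homD(1)[OF f] B.M.diff_eq_zeroD[of "f ?r" "f x"] by (simp add: g_def)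
  qed
  show thesis
  proof
    show "g \<in> alg_hom K (graded_quot A I) B"
      using alg_homD[OF f] by (intro alg_homI) (auto simp: simps g)
  qed (rule g)
qed

end

lemma graded_alg_iso_quot:
  assumes A: "graded_alg K A" and B: "graded_alg K B" and f: "f \<in> alg_hom K A B" "graded_map A B f"
    and bij: "bij_betw f (carrier A) (carrier B)"
    and I: "graded_ideal A I" and I': "graded_ideal B (f ` I)"
  shows "graded_alg_iso K (graded_quot A I) (graded_quot B (f ` I))"
proof -
  interpret A: graded_alg K A by fact
  interpret B: graded_alg K B by fact
  let ?I' = "f ` I"
  have i: "ideal I A" and i': "ideal ?I' B" using I I' by (auto simp: graded_ideal_def)
  interpret I: ideal I A by fact
  interpret I': ideal ?I' B by fact
  have Q: "assoc_algebra K (graded_quot B ?I')" by (rule B.assoc_algebra_graded_quot[OF i'])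
  have h: "(\<lambda>x. ?I' +>\<^bsub>B\<^esub> f x) \<in> alg_hom K A (graded_quot B ?I')"
    by (rule alg_hom_comp[OF f(1) B.coset_alg_hom[OF i']])
  note fc = alg_homD(1)[OF f(1)]
  obtain g where g: "g \<in> alg_hom K (graded_quot A I) (graded_quot B ?I')"
    "\<And>x. x \<in> carrier A \<Longrightarrow> g (I +>\<^bsub>A\<^esub> x) = ?I' +>\<^bsub>B\<^esub> f x"
  proof (rule A.graded_quot_factor[OF i Q h])
    fix x assume "x \<in> I"
    then show "?I' +>\<^bsub>B\<^esub> f x = \<zero>\<^bsub>graded_quot B ?I'\<^esub>"
      using B.coset_eq_zero_iff[OF i', of "f x"] fc I.Icarr B.graded_quot_simps(5)[OF i'] by simp
  qed blast
  show ?thesis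
  proof (rule graded_alg_isoI[OF g(1)])
    show "graded_map (graded_quot A I) (graded_quot B ?I') g"
      using graded_mapD[OF f(2)] g(2) A.homog_closed
      by (auto simp: graded_map_def A.graded_quot_simps[OF i] B.graded_quot_simps[OF i'])
    show "bij_betw g (carrier (graded_quot A I)) (carrier (graded_quot B ?I'))"
      unfolding bij_betw_def
    proof
      show "inj_on g (carrier (graded_quot A I))"
      proof (rule inj_onI)
        fix X Y assume XY: "X \<in> carrier (graded_quot A I)" "Y \<in> carrier (graded_quot A I)" "g X = g Y"
        obtain x y where x: "x \<in> carrier A" "X = I +>\<^bsub>A\<^esub> x" and y: "y \<in> carrier A" "Y = I +>\<^bsub>A\<^esub> y"
          using XY by (auto simp: A.graded_quot_simps[OF i])
        have "f x \<ominus>\<^bsub>B\<^esub> f y \<in> ?I'"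
          using XY(3) x y g(2) fc B.coset_eq_iff[OF i', of "f x" "f y"] by simp
        then obtain z where z: "z \<in> I" "f (x \<ominus>\<^bsub>A\<^esub> y) = f z"
          using alg_hom_zero_minus(3)[OF f(1) A.assoc_algebra_axioms B.assoc_algebra_axioms] x y by auto
        then have "x \<ominus>\<^bsub>A\<^esub> y = z"
          using bij x y I.Icarr by (auto simp: bij_betw_def inj_on_def)
        then show "X = Y" using z x y A.coset_eq_iff[OF i] by simp
      qed
      show "g ` carrier (graded_quot A I) = carrier (graded_quot B ?I')"
      proof -
        have "g ` carrier (graded_quot A I) = (\<lambda>x. ?I' +>\<^bsub>B\<^esub> f x) ` carrier A"
          unfolding A.graded_quot_simps(1)[OF i] image_image using g(2) by (rule image_cong[OF refl])
        also have "\<dots> = (\<lambda>y. ?I' +>\<^bsub>B\<^esub> y) ` (f ` carrier A)" by (simp only: image_image)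
        also have "\<dots> = carrier (graded_quot B ?I')"
          using bij by (simp only: bij_betw_def B.graded_quot_simps(1)[OF i'])
        finally show ?thesis .
      qed
    qed
  qed
qed

section \<open>The canonical ideal\<close>

lemma ideal_sum_eqI:
  assumes A: "ring A" and N: "N \<in> \<J>" "ideal N A" and max: "\<And>J. J \<in> \<J> \<Longrightarrow> J \<subseteq> N"
  shows "ideal_sum A \<J> = N"
proof
  interpret ring A by fact
  interpret N: ideal N A by fact
  show "ideal_sum A \<J> \<subseteq> N"
  proof
    fix x assume "x \<in> ideal_sum A \<J>"
    then obtain F f where F: "finite F" "F \<subseteq> \<J>" "\<forall>J\<in>F. f J \<in> J" and x: "x = (\<Oplus>\<^bsub>A\<^esub>J\<in>F. f J)"
      by (auto simp: ideal_sum_def)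
    have "(\<Oplus>\<^bsub>A\<^esub>J\<in>F. f J) \<in> N"
      using F
    proof (induction F)
      case (insert J F)
      have fN: "f J' \<in> N" if "J' \<in> insert J F" for J'
        using insert.prems max that by (meson subsetD)
      then have "f \<in> F \<rightarrow> carrier A" using N.Icarr by (auto simp: Pi_def)
      then show ?case using insert fN[of J] N.Icarr by simp
    qed auto
    then show "x \<in> N" using x by simp
  qed
  show "N \<subseteq> ideal_sum A \<J>"
  proof
    fix x assume x: "x \<in> N"
    have "x = (\<Oplus>\<^bsub>A\<^esub>J\<in>{N}. (\<lambda>_. x) J)" using N.Icarr[OF x] by simp
    then show "x \<in> ideal_sum A \<J>"
      unfolding ideal_sum_def
      by (intro CollectI exI[of _ "{N}"] exI[of _ "\<lambda>_. x"]) (use x N(1) in simp)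
  qed
qed

context graded_alg
begin

text \<open>A graded ideal meets degree zero trivially iff no component of its elements can be moved to a
  nonzero element of degree zero by multiplying with homogeneous elements on both sides. All elements
  with this property form the largest such ideal. This description refers to single products only,
  which makes it easy to transport along isomorphisms and twists.\<close>

lemma canonical_ideal_eq:
  "canonical_ideal A = {x \<in> carrier A. \<forall>\<beta> \<alpha> \<gamma>. \<forall>a\<in>homog A \<alpha>. \<forall>c\<in>homog A \<gamma>. \<alpha> + \<beta> + \<gamma> = 0 \<longrightarrow>
      a \<otimes> component A x \<beta> \<otimes> c = \<zero>}" (is "_ = ?N")
  and graded_ideal_canonical: "graded_ideal A (canonical_ideal A)"
proof -
  define P where "P \<beta> x \<longleftrightarrow> (\<forall>\<alpha> \<gamma>. \<forall>a\<in>homog A \<alpha>. \<forall>c\<in>homog A \<gamma>. \<alpha> + \<beta> + \<gamma> = 0 \<longrightarrow>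
      a \<otimes> x \<otimes> c = \<zero>)" for \<beta> x
  have N: "?N = {x \<in> carrier A. \<forall>\<alpha>. P \<alpha> (component A x \<alpha>)}" by (auto simp: P_def)
  have graded: "graded_ideal A ?N"
    unfolding N
  proof (rule graded_idealI_components)
    show "P \<alpha> \<zero>" for \<alpha> by (auto simp: P_def homog_closed)
  next
    fix x y \<alpha> assume "x \<in> homog A \<alpha>" "y \<in> homog A \<alpha>" "P \<alpha> x" "P \<alpha> y"
    then show "P \<alpha> (x \<oplus> y)"
      by (simp add: P_def homog_closed A.l_distr A.r_distr)
  next
    fix b x \<alpha> \<beta> assume b: "b \<in> homog A \<beta>" and x: "x \<in> homog A \<alpha>" and P: "P \<alpha> x"
    show "P (\<beta> + \<alpha>) (b \<otimes> x)"
      unfolding P_def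
    proof (intro allI ballI impI)
      fix \<delta> \<gamma> a c assume a: "a \<in> homog A \<delta>" and c: "c \<in> homog A \<gamma>" and "\<delta> + (\<beta> + \<alpha>) + \<gamma> = 0"
      then have "a \<otimes> b \<otimes> x \<otimes> c = \<zero>"
        using P homog_mult[OF a b] unfolding P_def by (metis add.assoc)
      then show "a \<otimes> (b \<otimes> x) \<otimes> c = \<zero>"
        using homog_closed[OF a] homog_closed[OF b] homog_closed[OF c] homog_closed[OF x]
        by (simp add: A.m_assoc)
    qed
    show "P (\<alpha> + \<beta>) (x \<otimes> b)"
      unfolding P_def
    proof (intro allI ballI impI)
      fix \<delta> \<gamma> a c assume a: "a \<in> homog A \<delta>" and c: "c \<in> homog A \<gamma>" and "\<delta> + (\<alpha> + \<beta>) + \<gamma> = 0"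
      then have "a \<otimes> x \<otimes> (b \<otimes> c) = \<zero>"
        using P homog_mult[OF b c] unfolding P_def by (metis add.assoc)
      then show "a \<otimes> (x \<otimes> b) \<otimes> c = \<zero>"
        using homog_closed[OF a] homog_closed[OF b] homog_closed[OF c] homog_closed[OF x]
        by (simp add: A.m_assoc)
    qed
  qed
  have "?N \<inter> homog A 0 = {\<zero>}"
  proof
    show "?N \<inter> homog A 0 \<subseteq> {\<zero>}"
    proof
      fix x assume x: "x \<in> ?N \<inter> homog A 0"
      then have "\<one> \<otimes> component A x 0 \<otimes> \<one> = \<zero>"
        using homog_one by fastforce
      then show "x \<in> {\<zero>}" using x component_of_homog[of x 0 0] by simp
    qed
    show "{\<zero>} \<subseteq> ?N \<inter> homog A 0" by (auto simp: homog_zero component_zero homog_closed)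
  qed
  moreover have "J \<subseteq> ?N" if J: "graded_ideal A J" "J \<inter> homog A 0 = {\<zero>}" for J
  proof
    fix x assume x: "x \<in> J"
    interpret J: ideal J A using J(1) by (simp add: graded_ideal_def)
    have "a \<otimes> component A x \<beta> \<otimes> c = \<zero>"
      if a: "a \<in> homog A \<alpha>" and c: "c \<in> homog A \<gamma>" and s: "\<alpha> + \<beta> + \<gamma> = 0" for \<alpha> \<beta> \<gamma> a c
    proof -
      have "component A x \<beta> \<in> J" using J(1) x by (simp add: graded_ideal_def)
      then have "a \<otimes> component A x \<beta> \<otimes> c \<in> J"
        using a c homog_closed by (simp add: J.I_l_closed J.I_r_closed)
      moreover have "a \<otimes> component A x \<beta> \<otimes> c \<in> homog A 0"
        using homog_mult[OF homog_mult[OF a component_homog] c, of x \<beta>] s J.Icarr[OF x] by simp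
      ultimately show ?thesis using J(2) by blast
    qed
    then show "x \<in> ?N" using J.Icarr[OF x] by blast
  qed
  ultimately show eq: "canonical_ideal A = ?N"
    unfolding canonical_ideal_def using graded
    by (intro ideal_sum_eqI[OF A.ring_axioms]) (auto simp: graded_ideal_def)
  show "graded_ideal A (canonical_ideal A)" unfolding eq by (rule graded)
qed

end

lemma canonical_ideal_iso:
  assumes A: "graded_alg K A" and B: "graded_alg K B" and f: "f \<in> alg_hom K A B" "graded_map A B f"
    and bij: "bij_betw f (carrier A) (carrier B)"
  shows "f ` canonical_ideal A = canonical_ideal B"
proof -
  interpret A: graded_alg K A by fact
  interpret B: graded_alg K B by fact
  note f' = alg_homD[OF f(1)]
  note f0 = alg_hom_zero_minus(1)[OF f(1) A.assoc_algebra_axioms B.assoc_algebra_axioms]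
  have H: "homog B \<alpha> = f ` homog A \<alpha>" for \<alpha> using graded_bij_homog[OF A B f bij] by simp
  have zero_iff: "f x = \<zero>\<^bsub>B\<^esub> \<longleftrightarrow> x = \<zero>\<^bsub>A\<^esub>" if "x \<in> carrier A" for x
    using that bij f0 by (metis A.M.zero_closed bij_betw_def inj_on_def)
  have prod: "f a \<otimes>\<^bsub>B\<^esub> component B (f x) \<beta> \<otimes>\<^bsub>B\<^esub> f c = \<zero>\<^bsub>B\<^esub> \<longleftrightarrow> a \<otimes>\<^bsub>A\<^esub> component A x \<beta> \<otimes>\<^bsub>A\<^esub> c = \<zero>\<^bsub>A\<^esub>"
    if "x \<in> carrier A" "a \<in> homog A \<alpha>" "c \<in> homog A \<gamma>" for x a c \<alpha> \<beta> \<gamma>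
  proof -
    have "a \<in> carrier A" "c \<in> carrier A" using that A.homog_closed by blast+
    then show ?thesis
      using that A.component_closed f'
      by (simp add: graded_hom_component[OF A B f] zero_iff f'(2)[symmetric])
  qed
  have mem: "f x \<in> canonical_ideal B \<longleftrightarrow> x \<in> canonical_ideal A" if x: "x \<in> carrier A" for x
    unfolding A.canonical_ideal_eq B.canonical_ideal_eq H
    using x f'(1)[OF x] prod[OF x] by auto
  have sub: "canonical_ideal A \<subseteq> carrier A" "canonical_ideal B \<subseteq> f ` carrier A"
    using bij by (auto simp: A.canonical_ideal_eq B.canonical_ideal_eq bij_betw_def)
  then show ?thesis using mem by blast
qed

lemma graded_alg_iso_quot_canonical:
  assumes A: "graded_alg K A" and B: "graded_alg K B" and iso: "graded_alg_iso K A B"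
  shows "graded_alg_iso K (graded_quot A (canonical_ideal A)) (graded_quot B (canonical_ideal B))"
proof -
  obtain f where f: "f \<in> alg_hom K A B" "bij_betw f (carrier A) (carrier B)" "graded_map A B f"
    using iso by (auto simp: graded_alg_iso_def)
  have eq: "f ` canonical_ideal A = canonical_ideal B"
    by (rule canonical_ideal_iso[OF A B f(1,3,2)])
  show ?thesis
    using graded_alg_iso_quot[OF A B f(1,3,2) graded_alg.graded_ideal_canonical[OF A]]
      graded_alg.graded_ideal_canonical[OF B] by (simp add: eq)
qed

section \<open>Graded twists\<close>

text \<open>The subgroup \<open>G\<close> carries the whole grading, so only the maps \<open>\<chi> \<alpha>\<close> with \<open>\<alpha> \<in> G\<close> matter for the
  twist. For a construction of rank \<open>m\<close> it is \<open>\<int>\<^sup>m\<close> inside the group of all degrees.\<close>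

locale graded_action = graded_alg K A
  for K :: "('k, 'z) ring_scheme"
    and A :: "('k, 'g::ab_group_add, 'a, 'x) graded_algebra_scheme" (structure) +
  fixes G :: "'g set" and \<chi> :: "'g \<Rightarrow> 'a \<Rightarrow> 'a"
  assumes G_zero: "0 \<in> G"
    and G_add: "\<lbrakk>\<alpha> \<in> G; \<beta> \<in> G\<rbrakk> \<Longrightarrow> \<alpha> + \<beta> \<in> G"
    and G_uminus: "\<alpha> \<in> G \<Longrightarrow> - \<alpha> \<in> G"
    and homog_outside: "\<lbrakk>\<alpha> \<notin> G; x \<in> homog A \<alpha>\<rbrakk> \<Longrightarrow> x = \<zero>"
    and act_hom: "\<alpha> \<in> G \<Longrightarrow> \<chi> \<alpha> \<in> alg_hom K A A"
    and act_graded: "\<alpha> \<in> G \<Longrightarrow> graded_map A A (\<chi> \<alpha>)"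
    and act_add: "\<lbrakk>\<alpha> \<in> G; \<beta> \<in> G; x \<in> carrier A\<rbrakk> \<Longrightarrow> \<chi> (\<alpha> + \<beta>) x = \<chi> \<alpha> (\<chi> \<beta> x)"
    and act_zero: "x \<in> carrier A \<Longrightarrow> \<chi> 0 x = x"
begin

lemmas act_simps = alg_homD[OF act_hom]
  alg_hom_zero_minus[OF act_hom assoc_algebra_axioms assoc_algebra_axioms]

lemma act_homog: "\<lbrakk>\<alpha> \<in> G; x \<in> homog A \<beta>\<rbrakk> \<Longrightarrow> \<chi> \<alpha> x \<in> homog A \<beta>"
  using graded_mapD[OF act_graded] by blast

lemma act_component:
  "\<lbrakk>\<alpha> \<in> G; x \<in> carrier A\<rbrakk> \<Longrightarrow> component A (\<chi> \<alpha> x) \<beta> = \<chi> \<alpha> (component A x \<beta>)"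
  by (rule graded_hom_component[OF graded_alg_axioms graded_alg_axioms act_hom act_graded])

lemma act_inverse:
  assumes "\<alpha> \<in> G" "x \<in> carrier A"
  shows "\<chi> (- \<alpha>) (\<chi> \<alpha> x) = x" "\<chi> \<alpha> (\<chi> (- \<alpha>) x) = x"
  using act_add[OF G_uminus[OF assms(1)] assms] act_add[OF assms(1) G_uminus[OF assms(1)] assms(2)]
    act_zero[OF assms(2)] by simp_all

lemma homog_induct_G [consumes 1, case_names homog add]:
  assumes x: "x \<in> carrier A"
    and homog: "\<And>\<alpha> y. \<lbrakk>\<alpha> \<in> G; y \<in> homog A \<alpha>\<rbrakk> \<Longrightarrow> P y"
    and add: "\<And>y z. \<lbrakk>y \<in> carrier A; z \<in> carrier A; P y; P z\<rbrakk> \<Longrightarrow> P (y \<oplus> z)"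
  shows "P x"
  using x
proof (induction rule: homog_induct)
  case (homog \<alpha> y)
  show ?case
  proof (cases "\<alpha> \<in> G")
    case False
    then have "y = \<zero>" using homog_outside[OF False homog] by simp
    then show ?thesis using assms(2)[OF G_zero homog_zero] by simp
  qed (rule assms(2)[OF _ homog])
qed (rule add)

lemma twist_simps [simp]:
  "carrier (graded_twist \<chi> A) = carrier A"
  "add (graded_twist \<chi> A) = add A"
  "\<zero>\<^bsub>graded_twist \<chi> A\<^esub> = \<zero>"
  "\<one>\<^bsub>graded_twist \<chi> A\<^esub> = \<one>"
  "smult (graded_twist \<chi> A) = smult A"
  "homog (graded_twist \<chi> A) = homog A"
  by (simp_all add: graded_twist_def)

lemma component_twist [simp]: "component (graded_twist \<chi> A) = component A"
  by (simp add: component_def graded_twist_def finsum_def fun_eq_iff)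

lemma twist_mult_superset:
  assumes a: "a \<in> carrier A" and b: "b \<in> carrier A"
    and S: "finite S" "S \<subseteq> G" "{\<beta>. component A b \<beta> \<noteq> \<zero>} \<subseteq> S"
  shows "a \<otimes>\<^bsub>graded_twist \<chi> A\<^esub> b = (\<Oplus>\<beta>\<in>S. \<chi> \<beta> a \<otimes> component A b \<beta>)"
  unfolding graded_twist_def
  using S a component_closed[OF b]
  by (simp, intro M.add.finprod_mono_neutral_cong_left) (auto simp: act_simps)

lemma component_support: "b \<in> carrier A \<Longrightarrow> {\<beta>. component A b \<beta> \<noteq> \<zero>} \<subseteq> G"
  using homog_outside component_homog by blast

lemma twist_mult_homog:
  assumes a: "a \<in> carrier A" and \<beta>: "\<beta> \<in> G" and b: "b \<in> homog A \<beta>"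
  shows "a \<otimes>\<^bsub>graded_twist \<chi> A\<^esub> b = \<chi> \<beta> a \<otimes> b"
proof -
  have "a \<otimes>\<^bsub>graded_twist \<chi> A\<^esub> b = (\<Oplus>\<gamma>\<in>{\<beta>}. \<chi> \<gamma> a \<otimes> component A b \<gamma>)"
    using a \<beta> b homog_closed[OF b] by (intro twist_mult_superset) (auto simp: component_of_homog split: if_splits)
  also have "\<dots> = \<chi> \<beta> a \<otimes> b"
    using a \<beta> homog_closed[OF b] component_of_homog[OF b, of \<beta>] act_simps(1)[OF \<beta> a] by simp
  finally show ?thesis .
qed

lemma twist_mult_closed:
  assumes a: "a \<in> carrier A" and b: "b \<in> carrier A"
  shows "a \<otimes>\<^bsub>graded_twist \<chi> A\<^esub> b \<in> carrier A"
  unfolding twist_mult_superset[OF a b component_finite[OF b] component_support[OF b] order.refl]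
  using component_support[OF b] component_closed[OF b] a
  by (intro M.finsum_closed) (auto simp: act_simps)

lemma twist_add_right:
  assumes a: "a \<in> carrier A" and b: "b \<in> carrier A" and c: "c \<in> carrier A"
  shows "a \<otimes>\<^bsub>graded_twist \<chi> A\<^esub> (b \<oplus> c) = a \<otimes>\<^bsub>graded_twist \<chi> A\<^esub> b \<oplus> a \<otimes>\<^bsub>graded_twist \<chi> A\<^esub> c"
proof -
  define S where "S = {\<beta>. component A b \<beta> \<noteq> \<zero>} \<union> {\<beta>. component A c \<beta> \<noteq> \<zero>}"
  have S: "finite S" "S \<subseteq> G"
    using component_finite component_support b c by (auto simp: S_def)
  have bc: "{\<beta>. component A (b \<oplus> c) \<beta> \<noteq> \<zero>} \<subseteq> S"
    using b c by (auto simp: component_add S_def)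
  have closed: "\<chi> \<beta> a \<otimes> component A x \<beta> \<in> carrier A" if "\<beta> \<in> S" "x \<in> carrier A" for \<beta> x
    using that S a component_closed by (auto simp: act_simps)
  have "a \<otimes>\<^bsub>graded_twist \<chi> A\<^esub> (b \<oplus> c) = (\<Oplus>\<beta>\<in>S. \<chi> \<beta> a \<otimes> component A (b \<oplus> c) \<beta>)"
    using twist_mult_superset[OF a _ S bc] b c by simp
  also have "\<dots> = (\<Oplus>\<beta>\<in>S. \<chi> \<beta> a \<otimes> component A b \<beta> \<oplus> \<chi> \<beta> a \<otimes> component A c \<beta>)"
    using S a b c component_closed
    by (intro M.finsum_cong') (auto simp: component_add act_simps A.r_distr subset_iff)
  also have "\<dots> = (\<Oplus>\<beta>\<in>S. \<chi> \<beta> a \<otimes> component A b \<beta>) \<oplus> (\<Oplus>\<beta>\<in>S. \<chi> \<beta> a \<otimes> component A c \<beta>)"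
    using closed b c by (intro M.finsum_addf) auto
  also have "\<dots> = a \<otimes>\<^bsub>graded_twist \<chi> A\<^esub> b \<oplus> a \<otimes>\<^bsub>graded_twist \<chi> A\<^esub> c"
    using twist_mult_superset[OF a b S] twist_mult_superset[OF a c S] by (simp add: S_def)
  finally show ?thesis .
qed

text \<open>For homogeneous \<open>b\<close> and \<open>c\<close> of degrees \<open>\<beta>\<close> and \<open>\<gamma>\<close> both triple products equal
  \<open>\<chi>\<^sub>\<beta>\<^sub>+\<^sub>\<gamma>(a) \<chi>\<^sub>\<gamma>(b) c\<close>, because \<open>\<chi>\<close> is a homomorphism and \<open>\<chi>\<^sub>\<gamma>\<close> preserves degrees; everything is additive
  in \<open>b\<close> and \<open>c\<close>.\<close>

lemma graded_alg_twist: "graded_alg K (graded_twist \<chi> A)"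
proof -
  let ?T = "graded_twist \<chi> A"
  have add_left: "(a \<oplus> b) \<otimes>\<^bsub>?T\<^esub> c = a \<otimes>\<^bsub>?T\<^esub> c \<oplus> b \<otimes>\<^bsub>?T\<^esub> c"
    if a: "a \<in> carrier A" and b: "b \<in> carrier A" and c: "c \<in> carrier A" for a b c
    using c
  proof (induction rule: homog_induct_G)
    case (homog \<alpha> y)
    then show ?case
      using a b homog_closed by (simp add: twist_mult_homog act_simps A.l_distr)
  next
    case (add y z)
    then show ?case
      using a b by (simp add: twist_add_right twist_mult_closed M.a_ac)
  qed
  have smult_left: "(c \<odot> a) \<otimes>\<^bsub>?T\<^esub> b = c \<odot> (a \<otimes>\<^bsub>?T\<^esub> b)"
    if c: "c \<in> carrier K" and a: "a \<in> carrier A" and b: "b \<in> carrier A" for a b c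
    using b
  proof (induction rule: homog_induct_G)
    case (homog \<alpha> y)
    then show ?case
      using a c homog_closed by (simp add: twist_mult_homog act_simps smult_mult_left)
  next
    case (add y z)
    then show ?case
      using a c by (simp add: twist_add_right twist_mult_closed smult_r_distr)
  qed
  have smult_right: "a \<otimes>\<^bsub>?T\<^esub> (c \<odot> b) = c \<odot> (a \<otimes>\<^bsub>?T\<^esub> b)"
    if c: "c \<in> carrier K" and a: "a \<in> carrier A" and b: "b \<in> carrier A" for a b c
    using b
  proof (induction rule: homog_induct_G)
    case (homog \<alpha> y)
    then show ?case
      using a c homog_closed[OF homog(2)] twist_mult_homog[OF a homog(1) homog_smult[OF c homog(2)]]
      by (simp add: twist_mult_homog act_simps smult_mult_right)
  next
    case (add y z)
    then show ?case
      using a c by (simp add: twist_add_right twist_mult_closed smult_r_distr)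
  qed
  have assoc_homog: "(a \<otimes>\<^bsub>?T\<^esub> b) \<otimes>\<^bsub>?T\<^esub> c = a \<otimes>\<^bsub>?T\<^esub> (b \<otimes>\<^bsub>?T\<^esub> c)"
    if a: "a \<in> carrier A" and b: "b \<in> carrier A" and \<gamma>: "\<gamma> \<in> G" and c: "c \<in> homog A \<gamma>" for a b c \<gamma>
    using b
  proof (induction rule: homog_induct_G)
    case (homog \<beta> y)
    note y = homog_closed[OF homog(2)] and c' = homog_closed[OF c]
    have "y \<otimes>\<^bsub>?T\<^esub> c = \<chi> \<gamma> y \<otimes> c" by (rule twist_mult_homog[OF y \<gamma> c])
    moreover have yc: "\<chi> \<gamma> y \<otimes> c \<in> homog A (\<gamma> + \<beta>)"
      using homog_mult[OF act_homog[OF \<gamma> homog(2)] c] by (simp add: add.commute)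
    ultimately have "a \<otimes>\<^bsub>?T\<^esub> (y \<otimes>\<^bsub>?T\<^esub> c) = \<chi> \<gamma> (\<chi> \<beta> a) \<otimes> (\<chi> \<gamma> y \<otimes> c)"
      using twist_mult_homog[OF a G_add[OF \<gamma> homog(1)] yc] act_add[OF \<gamma> homog(1) a] by simp
    also have "\<dots> = \<chi> \<gamma> (\<chi> \<beta> a \<otimes> y) \<otimes> c"
      using a y c' \<gamma> homog(1) by (simp add: act_simps A.m_assoc)
    also have "\<dots> = (a \<otimes>\<^bsub>?T\<^esub> y) \<otimes>\<^bsub>?T\<^esub> c"
      using a y \<gamma> homog c by (simp add: twist_mult_homog act_simps)
    finally show ?case by simp
  next
    case (add y z)
    then show ?case
      using a homog_closed[OF c] by (simp add: twist_add_right add_left twist_mult_closed)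
  qed
  have assoc: "(a \<otimes>\<^bsub>?T\<^esub> b) \<otimes>\<^bsub>?T\<^esub> c = a \<otimes>\<^bsub>?T\<^esub> (b \<otimes>\<^bsub>?T\<^esub> c)"
    if a: "a \<in> carrier A" and b: "b \<in> carrier A" and c: "c \<in> carrier A" for a b c
    using c
  proof (induction rule: homog_induct_G)
    case (homog \<alpha> y)
    then show ?case by (rule assoc_homog[OF a b])
  next
    case (add y z)
    then show ?case
      using a b by (simp add: twist_add_right twist_mult_closed)
  qed
  have one_left: "\<one> \<otimes>\<^bsub>?T\<^esub> a = a" if "a \<in> carrier A" for a
    using that
  proof (induction rule: homog_induct_G)
    case (homog \<alpha> y)
    then show ?case using homog_closed by (simp add: twist_mult_homog act_simps)
  qed (simp add: twist_add_right)
  have one_right: "a \<otimes>\<^bsub>?T\<^esub> \<one> = a" if "a \<in> carrier A" for a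
    using that by (simp add: twist_mult_homog[OF _ G_zero homog_one] act_zero)
  have ag: "abelian_group ?T"
    by (rule abelian_groupI) (auto simp: M.a_ac intro: M.l_neg bexI[of _ "\<ominus> _"])
  have alg: "assoc_algebra K ?T"
    by (rule assoc_algebraI[OF R.cring_axioms ag])
      (simp_all add: smult_l_distr smult_r_distr smult_assoc1 twist_mult_closed assoc one_left one_right
        add_left twist_add_right smult_left smult_right)
  have sum: "x = (\<Oplus>\<^bsub>?T\<^esub>\<alpha>\<in>{\<alpha>. component A x \<alpha> \<noteq> \<zero>}. component A x \<alpha>)" if "x \<in> carrier A" for x
    using component_sum[OF that] by (simp add: finsum_def graded_twist_def)
  have "graded_alg K ?T \<and> (\<forall>x\<in>carrier ?T. component ?T x = component A x)"
  proof (rule graded_algI[OF alg])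
    fix \<alpha> \<beta> x y assume x: "x \<in> homog ?T \<alpha>" and y: "y \<in> homog ?T \<beta>"
    show "x \<otimes>\<^bsub>?T\<^esub> y \<in> homog ?T (\<alpha> + \<beta>)"
    proof (cases "\<beta> \<in> G")
      case True
      then show ?thesis
        using x y homog_closed[of x] by (simp add: twist_mult_homog homog_mult act_homog)
    next
      case False
      then have "y = \<zero>" using homog_outside y by simp
      then have "x \<otimes>\<^bsub>?T\<^esub> y = \<zero>"
        using x homog_closed[of x] by (simp add: twist_mult_homog[OF _ G_zero homog_zero] act_simps G_zero)
      then show ?thesis using homog_zero by simp
    qed
  qed (use homog_closed homog_zero homog_add homog_smult homog_one component_homog component_finite sum
      component_add component_of_homog in \<open>auto\<close>)
  then show ?thesis by simp
qed

text \<open>Here it matters that the group of degrees is abelian: \<open>\<chi> \<alpha>\<close> commutes with the \<open>\<chi> \<beta>\<close> in the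
  definition of the product.\<close>

lemma act_hom_twist:
  assumes \<alpha>: "\<alpha> \<in> G"
  shows "\<chi> \<alpha> \<in> alg_hom K (graded_twist \<chi> A) (graded_twist \<chi> A)"
proof (rule alg_homI)
  fix x y assume x: "x \<in> carrier (graded_twist \<chi> A)" and y: "y \<in> carrier (graded_twist \<chi> A)"
  have "y \<in> carrier A" using y by simp
  then show "\<chi> \<alpha> (x \<otimes>\<^bsub>graded_twist \<chi> A\<^esub> y) = \<chi> \<alpha> x \<otimes>\<^bsub>graded_twist \<chi> A\<^esub> \<chi> \<alpha> y"
  proof (induction rule: homog_induct_G)
    case (homog \<beta> y)
    have "\<chi> \<alpha> (\<chi> \<beta> x) = \<chi> \<beta> (\<chi> \<alpha> x)"
      using act_add[OF \<alpha> homog(1), of x] act_add[OF homog(1) \<alpha>, of x] x by (simp add: add.commute)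
    then show ?case
      using x \<alpha> homog homog_closed[OF homog(2)] act_homog[OF \<alpha> homog(2)]
      by (simp add: twist_mult_homog act_simps)
  next
    case (add y z)
    then show ?case using x \<alpha> by (simp add: twist_add_right twist_mult_closed act_simps)
  qed
qed (use \<alpha> act_simps in auto)

text \<open>For homogeneous elements \<open>a\<close>, \<open>x\<close>, \<open>c\<close> with \<open>x\<close> of degree \<open>\<beta>\<close> and \<open>c\<close> of degree \<open>\<gamma>\<close>, the product \<open>a x c\<close> in the
  twist is the image under \<open>\<chi> \<gamma>\<close> of the product \<open>a' x c'\<close> in the original algebra, where
  \<open>a' = \<chi> \<beta> a\<close> and \<open>c' = \<chi> (- \<gamma>) c\<close> run through the same homogeneous parts as \<open>a\<close> and \<open>c\<close>. So both algebras
  have the same canonical ideal.\<close>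

lemma canonical_ideal_twist: "canonical_ideal (graded_twist \<chi> A) = canonical_ideal A"
proof -
  let ?T = "graded_twist \<chi> A"
  interpret T: graded_alg K ?T by (rule graded_alg_twist)
  have triple: "a \<otimes>\<^bsub>?T\<^esub> y \<otimes>\<^bsub>?T\<^esub> c = \<zero> \<longleftrightarrow> \<chi> \<beta> a \<otimes> y \<otimes> \<chi> (- \<gamma>) c = \<zero>"
    if a: "a \<in> carrier A" and \<beta>: "\<beta> \<in> G" and y: "y \<in> homog A \<beta>" and \<gamma>: "\<gamma> \<in> G" and c: "c \<in> homog A \<gamma>"
    for a y c \<beta> \<gamma>
  proof -
    note closed = homog_closed[OF y] homog_closed[OF c]
    have "a \<otimes>\<^bsub>?T\<^esub> y \<otimes>\<^bsub>?T\<^esub> c = \<chi> \<gamma> (\<chi> \<beta> a \<otimes> y) \<otimes> c"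
      using that closed by (simp add: twist_mult_homog act_simps)
    also have "\<dots> = \<chi> \<gamma> (\<chi> \<beta> a \<otimes> y \<otimes> \<chi> (- \<gamma>) c)"
      using that closed by (simp add: act_simps act_inverse G_uminus)
    finally have eq: "a \<otimes>\<^bsub>?T\<^esub> y \<otimes>\<^bsub>?T\<^esub> c = \<chi> \<gamma> (\<chi> \<beta> a \<otimes> y \<otimes> \<chi> (- \<gamma>) c)" .
    have "\<chi> \<gamma> z = \<zero> \<longleftrightarrow> z = \<zero>" if "z \<in> carrier A" for z
      using act_inverse(1)[OF \<gamma> that] act_simps(6)[OF \<gamma>] act_simps(6)[OF G_uminus[OF \<gamma>]] by metis
    moreover have "\<chi> \<beta> a \<otimes> y \<otimes> \<chi> (- \<gamma>) c \<in> carrier A"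
      using that closed by (simp add: act_simps(1) G_uminus)
    ultimately show ?thesis unfolding eq by blast
  qed
  have iff: "(\<forall>a\<in>homog A \<alpha>. \<forall>c\<in>homog A \<gamma>. \<alpha> + \<beta> + \<gamma> = 0 \<longrightarrow> a \<otimes>\<^bsub>?T\<^esub> component A x \<beta> \<otimes>\<^bsub>?T\<^esub> c = \<zero>) \<longleftrightarrow>
    (\<forall>a\<in>homog A \<alpha>. \<forall>c\<in>homog A \<gamma>. \<alpha> + \<beta> + \<gamma> = 0 \<longrightarrow> a \<otimes> component A x \<beta> \<otimes> c = \<zero>)"
    (is "?l \<longleftrightarrow> ?r") if x: "x \<in> carrier A" for x \<alpha> \<beta> \<gamma>
  proof (cases "\<beta> \<in> G \<and> \<gamma> \<in> G")
    case True
    then have \<beta>: "\<beta> \<in> G" and \<gamma>: "\<gamma> \<in> G" by auto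
    note y = component_homog[OF x, of \<beta>]
    show ?thesis
    proof
      assume l: ?l
      show ?r
      proof (intro ballI impI)
        fix a c assume a: "a \<in> homog A \<alpha>" and c: "c \<in> homog A \<gamma>" and s: "\<alpha> + \<beta> + \<gamma> = 0"
        have a': "\<chi> (- \<beta>) a \<in> homog A \<alpha>" and c': "\<chi> \<gamma> c \<in> homog A \<gamma>"
          using act_homog a c G_uminus \<beta> \<gamma> by auto
        show "a \<otimes> component A x \<beta> \<otimes> c = \<zero>"
          using l a' c' s triple[OF homog_closed[OF a'] \<beta> y \<gamma> c'] homog_closed[OF a] homog_closed[OF c] \<beta> \<gamma>
          by (simp add: act_inverse)
      qed
    next
      assume r: ?r
      show ?l
      proof (intro ballI impI)
        fix a c assume a: "a \<in> homog A \<alpha>" and c: "c \<in> homog A \<gamma>" and s: "\<alpha> + \<beta> + \<gamma> = 0"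
        have "\<chi> \<beta> a \<in> homog A \<alpha>" "\<chi> (- \<gamma>) c \<in> homog A \<gamma>"
          using act_homog a c G_uminus \<beta> \<gamma> by auto
        then show "a \<otimes>\<^bsub>?T\<^esub> component A x \<beta> \<otimes>\<^bsub>?T\<^esub> c = \<zero>"
          using r s triple[OF homog_closed[OF a] \<beta> y \<gamma> c] by blast
      qed
    qed
  next
    case False
    have z: "component A x \<beta> = \<zero>" if "\<beta> \<notin> G"
      using homog_outside[OF that component_homog[OF x]] .
    have z': "c = \<zero>" if "\<gamma> \<notin> G" "c \<in> homog A \<gamma>" for c
      using homog_outside that by blast
    have "a \<otimes>\<^bsub>?T\<^esub> component A x \<beta> \<otimes>\<^bsub>?T\<^esub> c = \<zero>" "a \<otimes> component A x \<beta> \<otimes> c = \<zero>"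
      if "a \<in> homog A \<alpha>" "c \<in> homog A \<gamma>" for a c
      using False z z'[OF _ that(2)] homog_closed[OF that(1)] homog_closed[OF that(2)] component_closed[OF x, of \<beta>]
        T.A.l_null T.A.r_null T.A.m_closed by auto
    then show ?thesis by blast
  qed
  show ?thesis
    unfolding canonical_ideal_eq T.canonical_ideal_eq twist_simps component_twist
    by (intro Collect_cong conj_cong refl iff_allI iff)
qed

lemma canonical_ideal_stable:
  assumes \<delta>: "\<delta> \<in> G" and x: "x \<in> canonical_ideal A"
  shows "\<chi> \<delta> x \<in> canonical_ideal A"
proof -
  have xc: "x \<in> carrier A" using x by (simp add: canonical_ideal_eq)
  have "a \<otimes> component A (\<chi> \<delta> x) \<beta> \<otimes> c = \<zero>"
    if a: "a \<in> homog A \<alpha>" and c: "c \<in> homog A \<gamma>" and s: "\<alpha> + \<beta> + \<gamma> = 0" for a c \<alpha> \<beta> \<gamma>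
  proof -
    note closed = homog_closed[OF a] homog_closed[OF c] component_closed[OF xc, of \<beta>]
    have "\<chi> (- \<delta>) a \<otimes> component A x \<beta> \<otimes> \<chi> (- \<delta>) c = \<zero>"
      using x act_homog[OF G_uminus[OF \<delta>]] a c s by (simp add: canonical_ideal_eq)
    then have "\<chi> \<delta> (\<chi> (- \<delta>) a \<otimes> component A x \<beta> \<otimes> \<chi> (- \<delta>) c) = \<zero>"
      using act_simps(6)[OF \<delta>] by simp
    then show ?thesis
      using closed \<delta> xc by (simp add: act_simps G_uminus act_inverse act_component)
  qed
  then show ?thesis using act_simps(1)[OF \<delta> xc] by (simp add: canonical_ideal_eq)
qed

lemma induced_action_coset:
  assumes I: "graded_ideal A I" and stable: "\<And>\<alpha> x. \<lbrakk>\<alpha> \<in> G; x \<in> I\<rbrakk> \<Longrightarrow> \<chi> \<alpha> x \<in> I"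
    and \<alpha>: "\<alpha> \<in> G" and x: "x \<in> carrier A"
  shows "induced_action A I \<chi> \<alpha> (I +> x) = I +> \<chi> \<alpha> x"
proof -
  have id: "ideal I A" using I by (simp add: graded_ideal_def)
  interpret I: ideal I A by fact
  have "I +> \<chi> \<alpha> y = I +> \<chi> \<alpha> x" if y: "y \<in> I +> x" for y
  proof -
    obtain h where h: "h \<in> I" "y = h \<oplus> x" using y by (auto simp: a_r_coset_def')
    note hc = I.Icarr[OF h(1)]
    have "\<chi> \<alpha> y \<ominus> \<chi> \<alpha> x = \<chi> \<alpha> h"
      using h(2) hc x \<alpha> by (simp add: act_simps a_minus_def M.a_assoc M.r_neg)
    then show ?thesis
      using stable[OF \<alpha> h(1)] hc h(2) x \<alpha> by (subst coset_eq_iff[OF id]) (simp_all add: act_simps)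
  qed
  then have "(\<Union>y\<in>I +> x. I +> \<chi> \<alpha> y) = I +> \<chi> \<alpha> x"
    using I.a_rcos_self[OF x] by (intro SUP_eq_const) blast+
  then show ?thesis
    using x by (simp add: induced_action_def graded_quot_simps(1)[OF id])
qed

lemma graded_action_quot:
  assumes I: "graded_ideal A I" and stable: "\<And>\<alpha> x. \<lbrakk>\<alpha> \<in> G; x \<in> I\<rbrakk> \<Longrightarrow> \<chi> \<alpha> x \<in> I"
  shows "graded_action K (graded_quot A I) G (induced_action A I \<chi>)"
proof -
  have id: "ideal I A" using I by (simp add: graded_ideal_def)
  note simps = graded_quot_simps[OF id]
  note ind = induced_action_coset[OF I stable]
  interpret Q: graded_alg K "graded_quot A I" by (rule graded_alg_graded_quot(1)[OF I])
  show ?thesis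
  proof
    fix \<alpha> X assume "\<alpha> \<notin> G" "X \<in> homog (graded_quot A I) \<alpha>"
    then show "X = \<zero>\<^bsub>graded_quot A I\<^esub>" using homog_outside by (auto simp: simps)
  next
    fix \<alpha> assume \<alpha>: "\<alpha> \<in> G"
    show "induced_action A I \<chi> \<alpha> \<in> alg_hom K (graded_quot A I) (graded_quot A I)"
      by (rule alg_homI) (auto simp: simps ind \<alpha> act_simps)
    show "graded_map (graded_quot A I) (graded_quot A I) (induced_action A I \<chi> \<alpha>)"
      using act_homog[OF \<alpha>] homog_closed by (fastforce simp: graded_map_def simps ind \<alpha>)
  qed (auto simp: G_zero G_add G_uminus simps ind act_simps act_add act_zero)
qed

text \<open>The two algebras have the same cosets as elements, and the identity is an isomorphism: for
  homogeneous \<open>y\<close> of degree \<open>\<beta>\<close> both products of the cosets of \<open>x\<close> and \<open>y\<close> are the coset of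
  \<open>\<chi> \<beta> x \<otimes> y\<close>.\<close>

lemma graded_twist_quot_iso:
  assumes I: "graded_ideal A I" and stable: "\<And>\<alpha> x. \<lbrakk>\<alpha> \<in> G; x \<in> I\<rbrakk> \<Longrightarrow> \<chi> \<alpha> x \<in> I"
    and IT: "graded_ideal (graded_twist \<chi> A) I"
  shows "graded_alg_iso K (graded_twist (induced_action A I \<chi>) (graded_quot A I))
    (graded_quot (graded_twist \<chi> A) I)"
proof -
  let ?T = "graded_twist \<chi> A" and ?Q = "graded_quot A I" and ?\<chi> = "induced_action A I \<chi>"
  have id: "ideal I A" "ideal I ?T" using I IT by (auto simp: graded_ideal_def)
  note ind = induced_action_coset[OF I stable]
  interpret T: graded_alg K ?T by (rule graded_alg_twist)
  interpret Q: graded_action K ?Q G ?\<chi> by (rule graded_action_quot[OF I stable])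
  have coset: "I +>\<^bsub>?T\<^esub> x = I +> x" for x by (simp add: a_r_coset_def')
  note simps = graded_quot_simps[OF id(1)] 
  note simpsT = T.graded_quot_simps[OF id(2), unfolded coset twist_simps]
  have mult: "X \<otimes>\<^bsub>graded_twist ?\<chi> ?Q\<^esub> Y = X \<otimes>\<^bsub>graded_quot ?T I\<^esub> Y"
    if X: "X \<in> carrier ?Q" and Y: "Y \<in> carrier ?Q" for X Y
  proof -
    obtain x y where x: "x \<in> carrier A" "X = I +> x" and y: "y \<in> carrier A" "Y = I +> y"
      using X Y by (auto simp: simps)
    have "(I +> x) \<otimes>\<^bsub>graded_twist ?\<chi> ?Q\<^esub> (I +> y) = I +> (x \<otimes>\<^bsub>?T\<^esub> y)"
      using y(1)
    proof (induction rule: homog_induct_G)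
      case (homog \<beta> y)
      note yc = homog_closed[OF homog(2)]
      have "I +> y \<in> homog ?Q \<beta>" using homog(2) by (simp add: simps)
      then have "(I +> x) \<otimes>\<^bsub>graded_twist ?\<chi> ?Q\<^esub> (I +> y) = (I +> \<chi> \<beta> x) \<otimes>\<^bsub>?Q\<^esub> (I +> y)"
        using Q.twist_mult_homog[of "I +> x" \<beta> "I +> y"] x(1) homog(1) by (simp add: simps(1) ind)
      then show ?case
        using x(1) homog yc by (simp add: simps(2) twist_mult_homog act_simps)
    next
      case (add y z)
      have c: "I +> y \<in> carrier ?Q" "I +> z \<in> carrier ?Q" "I +> x \<in> carrier ?Q"
        using add x by (auto simp: simps(1))
      have "(I +> x) \<otimes>\<^bsub>graded_twist ?\<chi> ?Q\<^esub> (I +> (y \<oplus> z)) =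
        (I +> x) \<otimes>\<^bsub>graded_twist ?\<chi> ?Q\<^esub> ((I +> y) \<oplus>\<^bsub>?Q\<^esub> (I +> z))"
        using add by (simp add: simps(3))
      also have "\<dots> = (I +> (x \<otimes>\<^bsub>?T\<^esub> y)) \<oplus>\<^bsub>?Q\<^esub> (I +> (x \<otimes>\<^bsub>?T\<^esub> z))"
        using Q.twist_add_right[OF c(3,1,2)] add by simp
      also have "\<dots> = I +> (x \<otimes>\<^bsub>?T\<^esub> (y \<oplus> z))"
        using add x by (simp add: simps(3) twist_mult_closed twist_add_right)
      finally show ?case .
    qed
    then show ?thesis using x y simpsT(2)[of x y] by simp
  qed
  show ?thesis
  proof (rule graded_alg_isoI[of "\<lambda>X. X"])
    show "(\<lambda>X. X) \<in> alg_hom K (graded_twist ?\<chi> ?Q) (graded_quot ?T I)"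
    proof (rule alg_homI)
      fix X Y assume "X \<in> carrier (graded_twist ?\<chi> ?Q)" "Y \<in> carrier (graded_twist ?\<chi> ?Q)"
      then show "X \<otimes>\<^bsub>graded_twist ?\<chi> ?Q\<^esub> Y = X \<otimes>\<^bsub>graded_quot ?T I\<^esub> Y"
        by (intro mult) simp_all
    qed (auto simp: simps simpsT)
    show "bij_betw (\<lambda>X. X) (carrier (graded_twist ?\<chi> ?Q)) (carrier (graded_quot ?T I))"
      by (simp add: simps(1) simpsT(1) bij_betw_def)
    show "graded_map (graded_twist ?\<chi> ?Q) (graded_quot ?T I) (\<lambda>X. X)"
      by (simp add: graded_map_def simps(7) simpsT(7))
  qed
qed

end

section \<open>Free algebras\<close>

definition monomial :: "('k, 'z) ring_scheme \<Rightarrow> 'k \<Rightarrow> 'l list \<Rightarrow> 'l list \<Rightarrow> 'k"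
  where "monomial K c w = (\<lambda>v. if v = w then c else \<zero>\<^bsub>K\<^esub>)"

context cring
begin

lemma free_algebra_simps:
  "carrier (free_algebra R L d) = {f. (\<forall>w. f w \<in> carrier R) \<and> finite {w. f w \<noteq> \<zero>} \<and>
      (\<forall>w. f w \<noteq> \<zero> \<longrightarrow> set w \<subseteq> L)}"
  "f \<otimes>\<^bsub>free_algebra R L d\<^esub> g = (\<lambda>w. \<Oplus>n\<in>{0..length w}. f (take n w) \<otimes> g (drop n w))"
  "\<one>\<^bsub>free_algebra R L d\<^esub> = monomial R \<one> []"
  "\<zero>\<^bsub>free_algebra R L d\<^esub> = (\<lambda>w. \<zero>)"
  "f \<oplus>\<^bsub>free_algebra R L d\<^esub> g = (\<lambda>w. f w \<oplus> g w)"
  "c \<odot>\<^bsub>free_algebra R L d\<^esub> f = (\<lambda>w. c \<otimes> f w)"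
  "homog (free_algebra R L d) \<alpha> =
    {f \<in> carrier (free_algebra R L d). \<forall>w. f w \<noteq> \<zero> \<longrightarrow> sum_list (map d w) = \<alpha>}"
  by (simp_all add: free_algebra_def Let_def monomial_def)

lemma free_gen_eq_monomial: "free_gen R l = monomial R \<one> [l]"
  by (simp add: free_gen_def monomial_def)

lemma monomial_closed:
  "\<lbrakk>c \<in> carrier R; set w \<subseteq> L\<rbrakk> \<Longrightarrow> monomial R c w \<in> carrier (free_algebra R L d)"
  by (auto simp: free_algebra_simps monomial_def intro: finite_subset[of _ "{w}"])

lemma free_algebra_closed:
  assumes f: "f \<in> carrier (free_algebra R L d)"
  shows "f w \<in> carrier R"
  using f by (simp add: free_algebra_simps)

lemma free_algebra_add_closed:
  assumes "f \<in> carrier (free_algebra R L d)" "g \<in> carrier (free_algebra R L d)"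
  shows "f \<oplus>\<^bsub>free_algebra R L d\<^esub> g \<in> carrier (free_algebra R L d)"
proof -
  have "{w. f w \<oplus> g w \<noteq> \<zero>} \<subseteq> {w. f w \<noteq> \<zero>} \<union> {w. g w \<noteq> \<zero>}" by auto
  then have "finite {w. f w \<oplus> g w \<noteq> \<zero>}"
    using assms by (auto simp: free_algebra_simps elim: finite_subset)
  moreover have "set w \<subseteq> L" if "f w \<oplus> g w \<noteq> \<zero>" for w
    using that assms by (cases "f w = \<zero>") (auto simp: free_algebra_simps)
  ultimately show ?thesis using assms by (auto simp: free_algebra_simps)
qed

lemma free_algebra_smult_closed:
  assumes "c \<in> carrier R" "f \<in> carrier (free_algebra R L d)"
  shows "c \<odot>\<^bsub>free_algebra R L d\<^esub> f \<in> carrier (free_algebra R L d)"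
proof -
  have "{w. c \<otimes> f w \<noteq> \<zero>} \<subseteq> {w. f w \<noteq> \<zero>}" using assms by auto
  then have "finite {w. c \<otimes> f w \<noteq> \<zero>}"
    using assms by (auto simp: free_algebra_simps elim: finite_subset)
  moreover have "set w \<subseteq> L" if "c \<otimes> f w \<noteq> \<zero>" for w
    using that assms by (cases "f w = \<zero>") (auto simp: free_algebra_simps)
  ultimately show ?thesis using assms by (auto simp: free_algebra_simps)
qed

text \<open>Products are bilinear and finite sums of monomials exhaust the algebra, so all laws of the
  multiplication reduce to the concatenation of words.\<close>

lemma monomial_induct [consumes 1, case_names zero monomial add]:
  assumes f: "f \<in> carrier (free_algebra R L d)"
    and zero: "P \<zero>\<^bsub>free_algebra R L d\<^esub>"
    and monomial: "\<And>c w. \<lbrakk>c \<in> carrier R; set w \<subseteq> L\<rbrakk> \<Longrightarrow> P (monomial R c w)"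
    and add: "\<And>f g. \<lbrakk>f \<in> carrier (free_algebra R L d); g \<in> carrier (free_algebra R L d); P f; P g\<rbrakk>
      \<Longrightarrow> P (f \<oplus>\<^bsub>free_algebra R L d\<^esub> g)"
  shows "P f"
proof -
  have "P f" if "finite S" "{w. f w \<noteq> \<zero>} = S" "f \<in> carrier (free_algebra R L d)" for S f
    using that
  proof (induction S arbitrary: f)
    case empty
    then have "f = \<zero>\<^bsub>free_algebra R L d\<^esub>" by (auto simp: free_algebra_simps)
    then show ?case using zero by simp
  next
    case (insert w S)
    let ?g = "f(w := \<zero>)"
    have S: "{v. ?g v \<noteq> \<zero>} = S" using insert by auto
    have g: "?g \<in> carrier (free_algebra R L d)"
      using insert(1,5) S by (auto simp: free_algebra_simps)
    have fw: "f w \<in> carrier R" "set w \<subseteq> L"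
      using insert(4,5) by (auto simp: free_algebra_simps)
    have eq: "f = monomial R (f w) w \<oplus>\<^bsub>free_algebra R L d\<^esub> ?g"
      using free_algebra_closed[OF insert(5)] by (auto simp: free_algebra_simps monomial_def)
    show ?case
      by (subst eq) (rule add[OF monomial_closed[OF fw] g monomial[OF fw] insert(3)[OF S g]])
  qed
  then show ?thesis using f by (auto simp: free_algebra_simps)
qed

lemma free_algebra_mult_add:
  assumes "f \<in> carrier (free_algebra R L d)" "g \<in> carrier (free_algebra R L d)"
    "h \<in> carrier (free_algebra R L d)"
  shows "(f \<oplus>\<^bsub>free_algebra R L d\<^esub> g) \<otimes>\<^bsub>free_algebra R L d\<^esub> h =
      f \<otimes>\<^bsub>free_algebra R L d\<^esub> h \<oplus>\<^bsub>free_algebra R L d\<^esub> g \<otimes>\<^bsub>free_algebra R L d\<^esub> h"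
    "h \<otimes>\<^bsub>free_algebra R L d\<^esub> (f \<oplus>\<^bsub>free_algebra R L d\<^esub> g) =
      h \<otimes>\<^bsub>free_algebra R L d\<^esub> f \<oplus>\<^bsub>free_algebra R L d\<^esub> h \<otimes>\<^bsub>free_algebra R L d\<^esub> g"
  using assms[THEN free_algebra_closed]
  by (simp_all add: free_algebra_simps l_distr r_distr finsum_addf Pi_def)

lemma free_algebra_smult_mult:
  assumes "c \<in> carrier R" "f \<in> carrier (free_algebra R L d)" "g \<in> carrier (free_algebra R L d)"
  shows "(c \<odot>\<^bsub>free_algebra R L d\<^esub> f) \<otimes>\<^bsub>free_algebra R L d\<^esub> g =
      c \<odot>\<^bsub>free_algebra R L d\<^esub> (f \<otimes>\<^bsub>free_algebra R L d\<^esub> g)"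
    "f \<otimes>\<^bsub>free_algebra R L d\<^esub> (c \<odot>\<^bsub>free_algebra R L d\<^esub> g) =
      c \<odot>\<^bsub>free_algebra R L d\<^esub> (f \<otimes>\<^bsub>free_algebra R L d\<^esub> g)"
  using assms(1) assms(2,3)[THEN free_algebra_closed]
  by (simp_all add: free_algebra_simps finsum_rdistr Pi_def m_assoc m_lcomm)

lemma monomial_mult:
  assumes "c \<in> carrier R" "e \<in> carrier R"
  shows "monomial R c u \<otimes>\<^bsub>free_algebra R L d\<^esub> monomial R e v = monomial R (c \<otimes> e) (u @ v)"
proof
  fix w
  have "(monomial R c u \<otimes>\<^bsub>free_algebra R L d\<^esub> monomial R e v) w =
    (\<Oplus>n\<in>{0..length w}. monomial R c u (take n w) \<otimes> monomial R e v (drop n w))"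
    by (simp add: free_algebra_simps)
  also have "\<dots> = monomial R (c \<otimes> e) (u @ v) w"
  proof (cases "w = u @ v")
    case True
    have "(\<Oplus>n\<in>{0..length w}. monomial R c u (take n w) \<otimes> monomial R e v (drop n w)) =
      (\<Oplus>n\<in>{0..length w}. if length u = n then c \<otimes> e else \<zero>)"
    proof (rule finsum_cong')
      fix n assume "n \<in> {0..length w}"
      then have "length (take n w) = n" by simp
      then have "take n w = u \<Longrightarrow> n = length u" by auto
      then show "monomial R c u (take n w) \<otimes> monomial R e v (drop n w) = (if length u = n then c \<otimes> e else \<zero>)"
        using True assms by (auto simp: monomial_def)
    qed (use assms in auto)
    also have "\<dots> = c \<otimes> e"
      using True assms by (intro finsum_singleton) auto
    finally show ?thesis using True by (simp add: monomial_def)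
  next
    case False
    have "monomial R c u (take n w) \<otimes> monomial R e v (drop n w) = \<zero>" for n
      using False assms append_take_drop_id[of n w] by (auto simp: monomial_def)
    then show ?thesis using False by (simp add: monomial_def)
  qed
  finally show "(monomial R c u \<otimes>\<^bsub>free_algebra R L d\<^esub> monomial R e v) w = monomial R (c \<otimes> e) (u @ v) w" .
qed

lemma free_algebra_mult_zero:
  assumes "f \<in> carrier (free_algebra R L d)"
  shows "f \<otimes>\<^bsub>free_algebra R L d\<^esub> \<zero>\<^bsub>free_algebra R L d\<^esub> = \<zero>\<^bsub>free_algebra R L d\<^esub>"
    "\<zero>\<^bsub>free_algebra R L d\<^esub> \<otimes>\<^bsub>free_algebra R L d\<^esub> f = \<zero>\<^bsub>free_algebra R L d\<^esub>"
  using free_algebra_closed[OF assms] by (simp_all add: free_algebra_simps)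

lemma free_algebra_zero_closed: "\<zero>\<^bsub>free_algebra R L d\<^esub> \<in> carrier (free_algebra R L d)"
  by (simp add: free_algebra_simps)

lemma free_algebra_mult_closed:
  assumes f: "f \<in> carrier (free_algebra R L d)" and g: "g \<in> carrier (free_algebra R L d)"
  shows "f \<otimes>\<^bsub>free_algebra R L d\<^esub> g \<in> carrier (free_algebra R L d)"
  using f
proof (induction rule: monomial_induct)
  case zero
  then show ?case using g by (simp add: free_algebra_mult_zero free_algebra_zero_closed)
next
  case (monomial c u)
  show ?case
    using g
  proof (induction rule: monomial_induct)
    case zero
    then show ?case
      using monomial by (simp add: free_algebra_mult_zero monomial_closed free_algebra_zero_closed)
  next
    case (monomial e v)
    then show ?case
      using \<open>c \<in> carrier R\<close> \<open>set u \<subseteq> L\<close> by (simp add: monomial_mult monomial_closed)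
  next
    case (add f g)
    then show ?case
      by (simp add: free_algebra_add_closed free_algebra_mult_add(2)[OF _ _ monomial_closed[OF monomial]])
  qed
next
  case (add f h)
  then show ?case using g by (simp add: free_algebra_add_closed free_algebra_mult_add(1)[OF _ _ g])
qed

lemma free_algebra_assoc:
  assumes f: "f \<in> carrier (free_algebra R L d)" and g: "g \<in> carrier (free_algebra R L d)"
    and h: "h \<in> carrier (free_algebra R L d)"
  shows "(f \<otimes>\<^bsub>free_algebra R L d\<^esub> g) \<otimes>\<^bsub>free_algebra R L d\<^esub> h =
    f \<otimes>\<^bsub>free_algebra R L d\<^esub> (g \<otimes>\<^bsub>free_algebra R L d\<^esub> h)"
  using f
proof (induction rule: monomial_induct)
  case zero
  then show ?case using g h by (simp add: free_algebra_mult_zero free_algebra_mult_closed)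
next
  case (add f f')
  then show ?case
    using g h by (simp add: free_algebra_mult_add free_algebra_mult_closed)
next
  case (monomial a u)
  note x = monomial_closed[OF monomial, of d]
  show ?case
    using g
  proof (induction rule: monomial_induct)
    case zero
    then show ?case using x h by (simp add: free_algebra_mult_zero)
  next
    case (add g g')
    then show ?case
      using x h by (simp add: free_algebra_mult_add free_algebra_mult_closed)
  next
    case (monomial b v)
    note y = monomial_closed[OF monomial, of d]
    show ?case
      using h
    proof (induction rule: monomial_induct)
      case zero
      then show ?case using x y by (simp add: free_algebra_mult_zero free_algebra_mult_closed)
    next
      case (add g g')
      then show ?case
        using x y by (simp add: free_algebra_mult_add free_algebra_mult_closed)
    next
      case (monomial c w)
      then show ?case
        using \<open>a \<in> carrier R\<close> \<open>b \<in> carrier R\<close> by (simp add: monomial_mult m_assoc)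
    qed
  qed
qed

lemma free_algebra_one:
  assumes f: "f \<in> carrier (free_algebra R L d)"
  shows "\<one>\<^bsub>free_algebra R L d\<^esub> \<otimes>\<^bsub>free_algebra R L d\<^esub> f = f"
    "f \<otimes>\<^bsub>free_algebra R L d\<^esub> \<one>\<^bsub>free_algebra R L d\<^esub> = f"
proof -
  have one: "\<one>\<^bsub>free_algebra R L d\<^esub> \<in> carrier (free_algebra R L d)"
    by (simp add: free_algebra_simps(3) monomial_closed)
  show "\<one>\<^bsub>free_algebra R L d\<^esub> \<otimes>\<^bsub>free_algebra R L d\<^esub> f = f"
    using f
  proof (induction rule: monomial_induct)
    case zero
    show ?case by (rule free_algebra_mult_zero(1)[OF one])
  next
    case (monomial c w)
    then show ?case unfolding free_algebra_simps(3) by (simp add: monomial_mult)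
  next
    case (add f g)
    then show ?case by (simp add: free_algebra_mult_add(2)[OF _ _ one])
  qed
  show "f \<otimes>\<^bsub>free_algebra R L d\<^esub> \<one>\<^bsub>free_algebra R L d\<^esub> = f"
    using f
  proof (induction rule: monomial_induct)
    case zero
    show ?case by (rule free_algebra_mult_zero(2)[OF one])
  next
    case (monomial c w)
    then show ?case unfolding free_algebra_simps(3) by (simp add: monomial_mult)
  next
    case (add f g)
    then show ?case by (simp add: free_algebra_mult_add(1)[OF _ _ one])
  qed
qed

lemma assoc_algebra_free_algebra: "assoc_algebra R (free_algebra R L d)"
proof -
  let ?F = "free_algebra R L d"
  note val = free_algebra_closed[where L = L and d = d]
  have ag: "abelian_group ?F"
  proof (rule abelian_groupI)
    fix f assume f: "f \<in> carrier ?F"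
    have "f w \<oplus> \<ominus> \<one> \<otimes> f w = \<zero>" for w
      using val[OF f, of w] by (simp add: l_minus r_neg)
    then show "\<exists>g\<in>carrier ?F. g \<oplus>\<^bsub>?F\<^esub> f = \<zero>\<^bsub>?F\<^esub>"
      using free_algebra_smult_closed[of "\<ominus> \<one>", OF _ f] val[OF f]
      by (intro bexI[of _ "(\<ominus> \<one>) \<odot>\<^bsub>?F\<^esub> f"]) (simp_all add: free_algebra_simps(4-6) a_comm)
  qed (use free_algebra_add_closed[where L = L and d = d] free_algebra_zero_closed[where L = L and d = d] val in
      \<open>auto simp: free_algebra_simps(4,5) a_assoc intro!: a_comm\<close>)
  show ?thesis
  proof (rule assoc_algebraI[OF cring_axioms ag])
    show "\<one>\<^bsub>?F\<^esub> \<in> carrier ?F" by (simp add: free_algebra_simps(3) monomial_closed)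
  next
    fix c e f assume "c \<in> carrier R" "e \<in> carrier R" "f \<in> carrier ?F"
    then show "(c \<oplus> e) \<odot>\<^bsub>?F\<^esub> f = c \<odot>\<^bsub>?F\<^esub> f \<oplus>\<^bsub>?F\<^esub> e \<odot>\<^bsub>?F\<^esub> f"
      "(c \<otimes> e) \<odot>\<^bsub>?F\<^esub> f = c \<odot>\<^bsub>?F\<^esub> (e \<odot>\<^bsub>?F\<^esub> f)"
      using val by (simp_all add: free_algebra_simps(5,6) l_distr m_assoc)
  next
    fix c f g assume "c \<in> carrier R" "f \<in> carrier ?F" "g \<in> carrier ?F"
    then show "c \<odot>\<^bsub>?F\<^esub> (f \<oplus>\<^bsub>?F\<^esub> g) = c \<odot>\<^bsub>?F\<^esub> f \<oplus>\<^bsub>?F\<^esub> c \<odot>\<^bsub>?F\<^esub> g"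
      using val by (simp add: free_algebra_simps(5,6) r_distr)
  next
    fix f assume "f \<in> carrier ?F"
    then show "\<one> \<odot>\<^bsub>?F\<^esub> f = f" using val by (simp add: free_algebra_simps(6))
  qed (simp_all add: free_algebra_smult_closed free_algebra_mult_closed free_algebra_assoc free_algebra_one
      free_algebra_mult_add free_algebra_smult_mult)
qed

lemma finsum_free_algebra:
  assumes "finite S" "\<And>x. x \<in> S \<Longrightarrow> g x \<in> carrier (free_algebra R L d)"
  shows "(\<Oplus>\<^bsub>free_algebra R L d\<^esub>x\<in>S. g x) w = (\<Oplus>x\<in>S. g x w)"
proof -
  interpret F: assoc_algebra R "free_algebra R L d" by (rule assoc_algebra_free_algebra)
  show ?thesis
    using assms
  proof (induction S)
    case empty
    then show ?case by (simp add: free_algebra_simps)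
  next
    case (insert x S)
    then have "(\<Oplus>\<^bsub>free_algebra R L d\<^esub>x\<in>insert x S. g x) =
        g x \<oplus>\<^bsub>free_algebra R L d\<^esub> (\<Oplus>\<^bsub>free_algebra R L d\<^esub>x\<in>S. g x)"
      by (intro F.M.finsum_insert) auto
    then have "(\<Oplus>\<^bsub>free_algebra R L d\<^esub>x\<in>insert x S. g x) w = g x w \<oplus> (\<Oplus>x\<in>S. g x w)"
      using insert by (simp add: free_algebra_simps(5))
    also have "\<dots> = (\<Oplus>x\<in>insert x S. g x w)"
      using insert free_algebra_closed[where L = L and d = d] by (intro finsum_insert[symmetric]) auto
    finally show ?case .
  qed
qed

lemma graded_alg_free_algebra:
  fixes d :: "'l \<Rightarrow> 'g::ab_group_add"
  shows "graded_alg R (free_algebra R L d)"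
proof -
  let ?F = "free_algebra R L d" and ?deg = "\<lambda>w. sum_list (map d w)"
  define p where "p f \<alpha> = (\<lambda>w. if ?deg w = \<alpha> then f w else \<zero>)" for f :: "'l list \<Rightarrow> 'a" and \<alpha>
  interpret F: assoc_algebra R ?F by (rule assoc_algebra_free_algebra)
  have p: "p f \<alpha> \<in> carrier ?F" if "f \<in> carrier ?F" for f \<alpha>
    using that by (auto simp: free_algebra_simps p_def elim: rev_finite_subset)
  have fin: "finite {\<alpha>. p f \<alpha> \<noteq> \<zero>\<^bsub>?F\<^esub>}" if "f \<in> carrier ?F" for f
  proof (rule finite_subset)
    show "{\<alpha>. p f \<alpha> \<noteq> \<zero>\<^bsub>?F\<^esub>} \<subseteq> ?deg ` {w. f w \<noteq> \<zero>}"
      by (auto simp: p_def free_algebra_simps fun_eq_iff split: if_splits)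
    show "finite (?deg ` {w. f w \<noteq> \<zero>})" using that by (simp add: free_algebra_simps)
  qed
  have "graded_alg R ?F \<and> (\<forall>f\<in>carrier ?F. component ?F f = p f)"
  proof (rule graded_algI[OF assoc_algebra_free_algebra])
    fix f assume f: "f \<in> carrier ?F"
    let ?S = "{\<alpha>. p f \<alpha> \<noteq> \<zero>\<^bsub>?F\<^esub>}"
    show "f = (\<Oplus>\<^bsub>?F\<^esub>\<alpha>\<in>?S. p f \<alpha>)"
    proof
      fix w
      have "(\<Oplus>\<^bsub>?F\<^esub>\<alpha>\<in>?S. p f \<alpha>) w = (\<Oplus>\<alpha>\<in>?S. p f \<alpha> w)"
        by (rule finsum_free_algebra[OF fin[OF f]]) (rule p[OF f])
      also have "\<dots> = (\<Oplus>\<alpha>\<in>?S. if ?deg w = \<alpha> then f w else \<zero>)" by (simp add: p_def)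
      also have "\<dots> = f w"
      proof (cases "?deg w \<in> ?S")
        case True
        then show ?thesis
          using fin[OF f] free_algebra_closed[OF f] by (intro finsum_singleton) auto
      next
        case False
        then have "p f (?deg w) w = \<zero>" by (simp add: free_algebra_simps(4))
        then have "f w = \<zero>" by (simp add: p_def)
        then show ?thesis by (simp cong: if_cong)
      qed
      finally show "f w = (\<Oplus>\<^bsub>?F\<^esub>\<alpha>\<in>?S. p f \<alpha>) w" by simp
    qed
  next
    fix \<alpha> \<beta> f g assume f: "f \<in> homog ?F \<alpha>" and g: "g \<in> homog ?F \<beta>"
    have fg: "f \<in> carrier ?F" "g \<in> carrier ?F" using f g by (auto simp: free_algebra_simps(7))
    have "?deg w = \<alpha> + \<beta>" if w: "(f \<otimes>\<^bsub>?F\<^esub> g) w \<noteq> \<zero>" for w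
    proof -
      have "\<exists>n. f (take n w) \<otimes> g (drop n w) \<noteq> \<zero>"
      proof (rule ccontr)
        assume "\<nexists>n. f (take n w) \<otimes> g (drop n w) \<noteq> \<zero>"
        then show False using w by (simp add: free_algebra_simps(2))
      qed
      then obtain n where n: "f (take n w) \<otimes> g (drop n w) \<noteq> \<zero>" by blast
      have "f (take n w) \<noteq> \<zero>" "g (drop n w) \<noteq> \<zero>"
        using n free_algebra_closed[OF fg(1), of "take n w"] free_algebra_closed[OF fg(2), of "drop n w"]
        by auto
      then have "?deg (take n w) = \<alpha>" "?deg (drop n w) = \<beta>" using f g by (auto simp: free_algebra_simps(7))
      then show ?thesis by (metis append_take_drop_id map_append sum_list_append)
    qed
    then show "f \<otimes>\<^bsub>?F\<^esub> g \<in> homog ?F (\<alpha> + \<beta>)"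
      using fg by (auto simp: free_algebra_simps(7))
  next
    fix \<alpha> f g assume f: "f \<in> homog ?F \<alpha>" and g: "g \<in> homog ?F \<alpha>"
    have fg: "f \<in> carrier ?F" "g \<in> carrier ?F" using f g by (auto simp: free_algebra_simps(7))
    have "?deg w = \<alpha>" if "f w \<oplus> g w \<noteq> \<zero>" for w
      using that f g free_algebra_closed[OF fg(2), of w]
      by (cases "f w = \<zero>") (auto simp: free_algebra_simps(7))
    then show "f \<oplus>\<^bsub>?F\<^esub> g \<in> homog ?F \<alpha>"
      using free_algebra_add_closed[OF fg] by (simp add: free_algebra_simps(5,7))
  next
    fix \<alpha> c f assume c: "c \<in> carrier R" and f: "f \<in> homog ?F \<alpha>"
    have fc: "f \<in> carrier ?F" using f by (simp add: free_algebra_simps(7))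
    have "?deg w = \<alpha>" if "c \<otimes> f w \<noteq> \<zero>" for w
      using that f c by (cases "f w = \<zero>") (auto simp: free_algebra_simps(7))
    then show "c \<odot>\<^bsub>?F\<^esub> f \<in> homog ?F \<alpha>"
      using free_algebra_smult_closed[OF c fc] by (simp add: free_algebra_simps(6,7))
  next
    show "\<one>\<^bsub>?F\<^esub> \<in> homog ?F 0"
      using F.A.one_closed by (auto simp: free_algebra_simps(3,7) monomial_def split: if_splits)
  next
    fix f \<alpha> assume "f \<in> carrier ?F"
    from p[OF this] show "p f \<alpha> \<in> homog ?F \<alpha>"
      by (auto simp: free_algebra_simps(7) p_def split: if_splits)
  next
    fix f \<alpha> \<beta> assume "f \<in> homog ?F \<alpha>"
    then have "f w = \<zero>" if "?deg w \<noteq> \<alpha>" for w using that by (auto simp: free_algebra_simps(7))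
    then show "p f \<beta> = (if \<beta> = \<alpha> then f else \<zero>\<^bsub>?F\<^esub>)"
      by (force simp: p_def free_algebra_simps(4) fun_eq_iff)
  next
    show "\<zero>\<^bsub>?F\<^esub> \<in> homog ?F \<alpha>" for \<alpha>
      using F.M.zero_closed by (simp add: free_algebra_simps(4,7))
  qed (use fin in \<open>auto simp: free_algebra_simps(5,7) p_def fun_eq_iff\<close>)
  then show ?thesis ..
qed

lemma free_gen_homog:
  "l \<in> L \<Longrightarrow> free_gen R l \<in> homog (free_algebra R L d) (d l)"
  using monomial_closed[of \<one> "[l]" L d]
  by (auto simp: free_algebra_simps(7) free_gen_eq_monomial) (auto simp: monomial_def split: if_splits)

lemma free_algebra_induct [consumes 1, case_names one gen smult add]:
  assumes f: "f \<in> carrier (free_algebra R L d)"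
    and one: "P \<one>\<^bsub>free_algebra R L d\<^esub>"
    and gen: "\<And>l f. \<lbrakk>l \<in> L; f \<in> carrier (free_algebra R L d); P f\<rbrakk> \<Longrightarrow>
      P (free_gen R l \<otimes>\<^bsub>free_algebra R L d\<^esub> f)"
    and smult: "\<And>c f. \<lbrakk>c \<in> carrier R; f \<in> carrier (free_algebra R L d); P f\<rbrakk> \<Longrightarrow>
      P (c \<odot>\<^bsub>free_algebra R L d\<^esub> f)"
    and add: "\<And>f g. \<lbrakk>f \<in> carrier (free_algebra R L d); g \<in> carrier (free_algebra R L d); P f; P g\<rbrakk>
      \<Longrightarrow> P (f \<oplus>\<^bsub>free_algebra R L d\<^esub> g)"
  shows "P f"
proof -
  let ?F = "free_algebra R L d"
  have word: "P (monomial R \<one> w)" if "set w \<subseteq> L" for w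
    using that
  proof (induction w)
    case Nil
    then show ?case using one by (simp add: free_algebra_simps(3))
  next
    case (Cons l w)
    have "P (free_gen R l \<otimes>\<^bsub>?F\<^esub> monomial R \<one> w)"
      using Cons by (intro gen) (auto simp: monomial_closed)
    then show ?case by (simp add: free_gen_eq_monomial monomial_mult)
  qed
  have mono: "P (monomial R c w)" if "c \<in> carrier R" "set w \<subseteq> L" for c w
  proof -
    have "monomial R c w = c \<odot>\<^bsub>?F\<^esub> monomial R \<one> w"
      using that by (auto simp: monomial_def free_algebra_simps(6))
    then show ?thesis using smult[OF that(1) monomial_closed word] that by simp
  qed
  show ?thesis
    using f
  proof (induction rule: monomial_induct)
    case zero
    then show ?case using mono[of \<zero> "[]"] by (simp add: monomial_def free_algebra_simps(4))
  qed (use mono add in auto)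
qed

lemma free_algebra_hom:
  fixes B :: "('a, 'c, 'y) module_scheme"
  assumes B: "assoc_algebra R B" and \<phi>: "\<And>l. l \<in> L \<Longrightarrow> \<phi> l \<in> carrier B"
  obtains h where "h \<in> alg_hom R (free_algebra R L d) B" "\<And>l. l \<in> L \<Longrightarrow> h (free_gen R l) = \<phi> l"
proof -
  interpret B: assoc_algebra R B by fact
  let ?F = "free_algebra R L d"
  define prd where "prd w = foldr (\<lambda>l b. \<phi> l \<otimes>\<^bsub>B\<^esub> b) w \<one>\<^bsub>B\<^esub>" for w
  define h where "h f = (\<Oplus>\<^bsub>B\<^esub>w\<in>{w. f w \<noteq> \<zero>}. f w \<odot>\<^bsub>B\<^esub> prd w)" for f
  have prd_Cons: "prd (l # w) = \<phi> l \<otimes>\<^bsub>B\<^esub> prd w" for l w by (simp add: prd_def)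
  have prd: "prd w \<in> carrier B" if "set w \<subseteq> L" for w
    using that by (induction w) (auto simp: prd_def \<phi>)
  have prd_append: "prd (u @ v) = prd u \<otimes>\<^bsub>B\<^esub> prd v" if "set u \<subseteq> L" "set v \<subseteq> L" for u v
    using that
  proof (induction u)
    case Nil
    then show ?case using prd[of v] by (simp add: prd_def)
  next
    case (Cons l u)
    then show ?case using prd[of u] prd[of v] \<phi>[of l] by (simp add: prd_Cons B.A.m_assoc)
  qed
  have term_closed: "f w \<odot>\<^bsub>B\<^esub> prd w \<in> carrier B" if "f \<in> carrier ?F" "set w \<subseteq> L" for f w
    using that prd free_algebra_closed[where L = L and d = d] by blast
  have supp: "finite {w. f w \<noteq> \<zero>}" "set w \<subseteq> L" if "f \<in> carrier ?F" "f w \<noteq> \<zero>" for f w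
    using that by (auto simp: free_algebra_simps)
  have finsupp: "finite {w. f w \<noteq> \<zero>}" if "f \<in> carrier ?F" for f
    using that by (auto simp: free_algebra_simps)
  have superset: "h f = (\<Oplus>\<^bsub>B\<^esub>w\<in>S. f w \<odot>\<^bsub>B\<^esub> prd w)"
    if f: "f \<in> carrier ?F" and S: "finite S" "{w. f w \<noteq> \<zero>} \<subseteq> S" "\<And>w. w \<in> S \<Longrightarrow> set w \<subseteq> L" for f S
    unfolding h_def
    by (rule B.M.add.finprod_mono_neutral_cong_left) (use S term_closed[OF f] prd in \<open>auto simp: B.smult_l_null\<close>)
  have h_closed: "h f \<in> carrier B" if "f \<in> carrier ?F" for f
    unfolding h_def using that supp term_closed by (intro B.M.finsum_closed) auto
  have h_add: "h (f \<oplus>\<^bsub>?F\<^esub> g) = h f \<oplus>\<^bsub>B\<^esub> h g" if f: "f \<in> carrier ?F" and g: "g \<in> carrier ?F" for f g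
  proof -
    define S where "S = {w. f w \<noteq> \<zero>} \<union> {w. g w \<noteq> \<zero>}"
    have S: "finite S" "\<And>w. w \<in> S \<Longrightarrow> set w \<subseteq> L"
      using finsupp f g supp by (auto simp: S_def)
    have "h (f \<oplus>\<^bsub>?F\<^esub> g) = (\<Oplus>\<^bsub>B\<^esub>w\<in>S. (f \<oplus>\<^bsub>?F\<^esub> g) w \<odot>\<^bsub>B\<^esub> prd w)"
      using free_algebra_add_closed[OF f g] S
      by (intro superset) (auto simp: S_def free_algebra_simps(5))
    also have "\<dots> = (\<Oplus>\<^bsub>B\<^esub>w\<in>S. f w \<odot>\<^bsub>B\<^esub> prd w \<oplus>\<^bsub>B\<^esub> g w \<odot>\<^bsub>B\<^esub> prd w)"
      using S prd free_algebra_closed[OF f] free_algebra_closed[OF g]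
      by (intro B.M.finsum_cong') (auto simp: free_algebra_simps(5) B.smult_l_distr)
    also have "\<dots> = (\<Oplus>\<^bsub>B\<^esub>w\<in>S. f w \<odot>\<^bsub>B\<^esub> prd w) \<oplus>\<^bsub>B\<^esub> (\<Oplus>\<^bsub>B\<^esub>w\<in>S. g w \<odot>\<^bsub>B\<^esub> prd w)"
      using S term_closed f g by (intro B.M.finsum_addf) auto
    also have "\<dots> = h f \<oplus>\<^bsub>B\<^esub> h g"
      using superset[OF f S(1) _ S(2)] superset[OF g S(1) _ S(2)] by (simp add: S_def)
    finally show ?thesis .
  qed
  have h_mono: "h (monomial R c w) = c \<odot>\<^bsub>B\<^esub> prd w" if "c \<in> carrier R" "set w \<subseteq> L" for c w
  proof -
    have "h (monomial R c w) = (\<Oplus>\<^bsub>B\<^esub>v\<in>{w}. monomial R c w v \<odot>\<^bsub>B\<^esub> prd v)"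
      using that by (intro superset monomial_closed) (auto simp: monomial_def)
    also have "\<dots> = c \<odot>\<^bsub>B\<^esub> prd w" using that prd[of w] by (simp add: monomial_def)
    finally show ?thesis .
  qed
  have h_zero: "h \<zero>\<^bsub>?F\<^esub> = \<zero>\<^bsub>B\<^esub>" by (simp add: h_def free_algebra_simps(4))
  have h_smult: "h (c \<odot>\<^bsub>?F\<^esub> f) = c \<odot>\<^bsub>B\<^esub> h f" if c: "c \<in> carrier R" and f: "f \<in> carrier ?F" for c f
    using f
  proof (induction rule: monomial_induct)
    case zero
    have "c \<odot>\<^bsub>?F\<^esub> \<zero>\<^bsub>?F\<^esub> = \<zero>\<^bsub>?F\<^esub>" using c by (simp add: free_algebra_simps(4,6))
    then show ?case using c by (simp add: h_zero B.smult_r_null)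
  next
    case (monomial e w)
    have "c \<odot>\<^bsub>?F\<^esub> monomial R e w = monomial R (c \<otimes> e) w"
      using c by (auto simp: free_algebra_simps(6) monomial_def)
    then show ?case using c monomial prd[of w] by (simp add: h_mono B.smult_assoc1)
  next
    case (add f g)
    interpret F: assoc_algebra R ?F by (rule assoc_algebra_free_algebra)
    show ?case
      using c add h_closed by (simp add: F.smult_r_distr h_add B.smult_r_distr)
  qed
  have h_mult: "h (f \<otimes>\<^bsub>?F\<^esub> g) = h f \<otimes>\<^bsub>B\<^esub> h g" if f: "f \<in> carrier ?F" and g: "g \<in> carrier ?F" for f g
    using f
  proof (induction rule: monomial_induct)
    case zero
    then show ?case using free_algebra_mult_zero[OF g] h_closed[OF g] h_zero by simp
  next
    case (add f f')
    then show ?case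
      using g h_closed by (simp add: free_algebra_mult_add free_algebra_mult_closed h_add B.A.l_distr)
  next
    case (monomial c u)
    note x = monomial_closed[OF monomial, of d]
    show ?case
      using g
    proof (induction rule: monomial_induct)
      case zero
      then show ?case using free_algebra_mult_zero[OF x] h_closed[OF x] h_zero by simp
    next
      case (add g g')
      then show ?case
        using x h_closed by (simp add: free_algebra_mult_add free_algebra_mult_closed h_add B.A.r_distr)
    next
      case (monomial e v)
      then show ?case
        using \<open>c \<in> carrier R\<close> \<open>set u \<subseteq> L\<close> prd[of u] prd[of v]
        by (simp add: monomial_mult h_mono prd_append B.smult_mult_left B.smult_mult_right B.smult_assoc1 B.smult_lcomm)
    qed
  qed
  show thesis
  proof
    have "h \<one>\<^bsub>?F\<^esub> = \<one>\<^bsub>B\<^esub>" by (simp add: free_algebra_simps(3) h_mono) (simp add: prd_def)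
    then show "h \<in> alg_hom R ?F B"
      using h_closed h_mult h_add h_smult by (intro alg_homI)
    show "h (free_gen R l) = \<phi> l" if "l \<in> L" for l
      using that h_mono[of \<one> "[l]"] \<phi>[OF that] by (simp add: free_gen_eq_monomial prd_def)
  qed
qed

end

section \<open>Models of the defining relations\<close>

fun opposite :: "sign \<Rightarrow> sign"
  where "opposite Plus = Minus" | "opposite Minus = Plus"

locale tgw_datum =
  fixes K :: "('k, 'z) ring_scheme" and R :: "('k, 'r, 'y) module_scheme" and m :: nat
    and \<sigma> :: "nat \<Rightarrow> 'r \<Rightarrow> 'r" and t :: "nat \<Rightarrow> 'r" and \<mu> :: "nat \<Rightarrow> nat \<Rightarrow> 'k"
  assumes field: "field K"
    and datum: "tgwd K R m \<sigma> t"
    and \<mu>_units: "\<lbrakk>i \<in> {1..m}; j \<in> {1..m}; i \<noteq> j\<rbrakk> \<Longrightarrow> \<mu> i j \<in> Units K"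
begin

sublocale K: field K by (rule field)

sublocale R: assoc_algebra K R using datum by (simp add: tgwd_def)

definition letters :: "'r tgw_letter set"
  where "letters = Coeff ` carrier R \<union> {Gen s i | s i. i \<in> {1..m}}"

lemma letters_iff [simp]:
  "Coeff r \<in> letters \<longleftrightarrow> r \<in> carrier R" "Gen s i \<in> letters \<longleftrightarrow> i \<in> {1..m}"
  by (auto simp: letters_def)

lemma letters_cases:
  assumes "l \<in> letters"
  obtains r where "l = Coeff r" "r \<in> carrier R" | s i where "l = Gen s i" "i \<in> {1..m}"
  using assms by (auto simp: letters_def)

lemma sigma_aut: "i \<in> {1..m} \<Longrightarrow> \<sigma> i \<in> carrier (alg_Aut K R)"
  using datum by (simp add: tgwd_def)

lemma signed_aut_mem: "i \<in> {1..m} \<Longrightarrow> signed_aut K R \<sigma> s i \<in> carrier (alg_Aut K R)"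
  using sigma_aut group.inv_closed[OF group_alg_Aut[OF R.assoc_algebra_axioms]] by (cases s) auto

lemmas signed_aut_hom = alg_homD[OF alg_Aut_carrierD(1)[OF signed_aut_mem]]

lemma signed_aut_inverse:
  assumes "i \<in> {1..m}" "r \<in> carrier R"
  shows "signed_aut K R \<sigma> (opposite s) i (signed_aut K R \<sigma> s i r) = r"
  using alg_Aut_inv[OF R.assoc_algebra_axioms sigma_aut[OF assms(1)] assms(2)] by (cases s) auto

lemma t_closed: "i \<in> {1..m} \<Longrightarrow> t i \<in> carrier R"
  using datum by (simp add: tgwd_def ring_center_def)

lemma sigma_hom: "i \<in> {1..m} \<Longrightarrow> \<sigma> i \<in> alg_hom K R R"
  using alg_Aut_carrierD(1)[OF sigma_aut] .

lemma sigma_closed: "\<lbrakk>i \<in> {1..m}; r \<in> carrier R\<rbrakk> \<Longrightarrow> \<sigma> i r \<in> carrier R"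
  using alg_homD(1)[OF sigma_hom] .

end

text \<open>A model is an algebra with chosen images of the letters that satisfy the defining relations of
  \<open>\<C>\<^sub>\<mu>(R, \<sigma>, t)\<close>. The construction itself is the universal model.\<close>

locale tgw_model = tgw_datum K R m \<sigma> t \<mu> + B: assoc_algebra K B
  for K :: "('k, 'z) ring_scheme" and R :: "('k, 'r, 'y) module_scheme" and m :: nat
    and \<sigma> :: "nat \<Rightarrow> 'r \<Rightarrow> 'r" and t :: "nat \<Rightarrow> 'r" and \<mu> :: "nat \<Rightarrow> nat \<Rightarrow> 'k"
    and B :: "('k, 'b, 'w) module_scheme" (structure) +
  fixes \<phi> :: "'r tgw_letter \<Rightarrow> 'b"
  assumes letter_closed: "l \<in> letters \<Longrightarrow> \<phi> l \<in> carrier B"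
    and coeff_one: "\<phi> (Coeff \<one>\<^bsub>R\<^esub>) = \<one>"
    and coeff_add: "\<lbrakk>r \<in> carrier R; r' \<in> carrier R\<rbrakk> \<Longrightarrow>
      \<phi> (Coeff (r \<oplus>\<^bsub>R\<^esub> r')) = \<phi> (Coeff r) \<oplus> \<phi> (Coeff r')"
    and coeff_mult: "\<lbrakk>r \<in> carrier R; r' \<in> carrier R\<rbrakk> \<Longrightarrow>
      \<phi> (Coeff (r \<otimes>\<^bsub>R\<^esub> r')) = \<phi> (Coeff r) \<otimes> \<phi> (Coeff r')"
    and coeff_smult: "\<lbrakk>c \<in> carrier K; r \<in> carrier R\<rbrakk> \<Longrightarrow>
      \<phi> (Coeff (c \<odot>\<^bsub>R\<^esub> r)) = c \<odot> \<phi> (Coeff r)"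
    and gen_coeff: "\<lbrakk>i \<in> {1..m}; r \<in> carrier R\<rbrakk> \<Longrightarrow>
      \<phi> (Gen s i) \<otimes> \<phi> (Coeff r) = \<phi> (Coeff (signed_aut K R \<sigma> s i r)) \<otimes> \<phi> (Gen s i)"
    and minus_plus: "i \<in> {1..m} \<Longrightarrow> \<phi> (Gen Minus i) \<otimes> \<phi> (Gen Plus i) = \<phi> (Coeff (t i))"
    and plus_minus: "i \<in> {1..m} \<Longrightarrow> \<phi> (Gen Plus i) \<otimes> \<phi> (Gen Minus i) = \<phi> (Coeff (\<sigma> i (t i)))"
    and mixed: "\<lbrakk>i \<in> {1..m}; j \<in> {1..m}; i \<noteq> j\<rbrakk> \<Longrightarrow>
      \<phi> (Gen Plus i) \<otimes> \<phi> (Gen Minus j) = \<mu> i j \<odot> (\<phi> (Gen Minus j) \<otimes> \<phi> (Gen Plus i))"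
begin

lemma coeff_closed: "r \<in> carrier R \<Longrightarrow> \<phi> (Coeff r) \<in> carrier B"
  by (simp add: letter_closed)

lemma gen_closed: "i \<in> {1..m} \<Longrightarrow> \<phi> (Gen s i) \<in> carrier B"
  by (simp add: letter_closed)

lemma coeff_hom: "(\<lambda>r. \<phi> (Coeff r)) \<in> alg_hom K R B"
  by (rule alg_homI) (simp_all add: coeff_closed coeff_one coeff_add coeff_mult coeff_smult)

text \<open>The relations between generators of opposite signs depend only on whether the indices agree. In this
  form both orders of the signs can be treated alike.\<close>

lemma gen_exchange:
  assumes "i \<in> {1..m}" "j \<in> {1..m}" "i \<noteq> j" "s \<noteq> s'"
  obtains c where "c \<in> carrier K" 
    "\<phi> (Gen s i) \<otimes> \<phi> (Gen s' j) = c \<odot> (\<phi> (Gen s' j) \<otimes> \<phi> (Gen s i))"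
proof (cases s)
  case Plus
  then have "s' = Minus" using assms(4) by (cases s') auto
  then show thesis using that[of "\<mu> i j"] Plus mixed[OF assms(1-3)] \<mu>_units[OF assms(1-3)] by auto
next
  case Minus
  then have s': "s' = Plus" using assms(4) by (cases s') auto
  have u: "\<mu> j i \<in> Units K" using \<mu>_units assms by blast
  have "\<phi> (Gen Minus i) \<otimes> \<phi> (Gen Plus j) = inv\<^bsub>K\<^esub> \<mu> j i \<odot> (\<phi> (Gen Plus j) \<otimes> \<phi> (Gen Minus i))"
    using mixed[OF assms(2,1)] assms u gen_closed
    by (simp add: B.smult_assoc1[symmetric] K.Units_closed)
  then show thesis using that[of "inv\<^bsub>K\<^esub> \<mu> j i"] u Minus s' by auto
qed

lemma gen_cancel:
  assumes "i \<in> {1..m}" "s \<noteq> s'"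
  obtains r where "r \<in> carrier R" "\<phi> (Gen s i) \<otimes> \<phi> (Gen s' i) = \<phi> (Coeff r)"
proof (cases s)
  case Plus
  then have "s' = Minus" using assms(2) by (cases s') auto
  then show thesis using that[of "\<sigma> i (t i)"] Plus plus_minus[OF assms(1)] assms t_closed sigma_closed by auto
next
  case Minus
  then have "s' = Plus" using assms(2) by (cases s') auto
  then show thesis using that[of "t i"] Minus minus_plus[OF assms(1)] assms t_closed by auto
qed

definition word :: "sign \<Rightarrow> nat list \<Rightarrow> 'b"
  where "word s u = foldr (\<lambda>i b. \<phi> (Gen s i) \<otimes> b) u \<one>"

lemma word_simps: "word s [] = \<one>" "word s (i # u) = \<phi> (Gen s i) \<otimes> word s u"
  by (simp_all add: word_def)

lemma word_closed: "set u \<subseteq> {1..m} \<Longrightarrow> word s u \<in> carrier B"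
  by (induction u) (auto simp: word_simps gen_closed)

lemma word_append:
  "\<lbrakk>set u \<subseteq> {1..m}; set v \<subseteq> {1..m}\<rbrakk> \<Longrightarrow> word s (u @ v) = word s u \<otimes> word s v"
  by (induction u) (simp_all add: word_simps word_closed gen_closed B.A.m_assoc)

lemma word_coeff:
  assumes "set u \<subseteq> {1..m}" "r \<in> carrier R"
  obtains r' where "r' \<in> carrier R" "word s u \<otimes> \<phi> (Coeff r) = \<phi> (Coeff r') \<otimes> word s u"
proof -
  have "\<exists>r'\<in>carrier R. word s u \<otimes> \<phi> (Coeff r) = \<phi> (Coeff r') \<otimes> word s u"
    using assms(1)
  proof (induction u)
    case Nil
    then show ?case using assms(2) by (auto simp: word_simps coeff_closed)
  next
    case (Cons i u)
    then obtain r' where r': "r' \<in> carrier R" "word s u \<otimes> \<phi> (Coeff r) = \<phi> (Coeff r') \<otimes> word s u"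
      by auto
    have i: "i \<in> {1..m}" "set u \<subseteq> {1..m}" using Cons by auto
    note closed = gen_closed[OF i(1), of s] word_closed[OF i(2), of s] coeff_closed[OF assms(2)]
      coeff_closed[OF r'(1)] coeff_closed[OF signed_aut_hom(1)[OF i(1) r'(1), of s]]
    have "word s (i # u) \<otimes> \<phi> (Coeff r) = (\<phi> (Gen s i) \<otimes> \<phi> (Coeff r')) \<otimes> word s u"
      using closed r' by (simp add: word_simps B.A.m_assoc)
    also have "\<dots> = \<phi> (Coeff (signed_aut K R \<sigma> s i r')) \<otimes> word s (i # u)"
      using closed gen_coeff[OF i(1) r'(1)] by (simp add: word_simps B.A.m_assoc)
    finally show ?case using signed_aut_hom(1)[OF i(1) r'(1)] by blast
  qed
  then show thesis using that by blast
qed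

lemma gen_word:
  assumes "set u \<subseteq> {1..m}" "j \<in> {1..m}" "j \<notin> set u" "s \<noteq> s'"
  obtains c where "c \<in> carrier K" "\<phi> (Gen s j) \<otimes> word s' u = c \<odot> (word s' u \<otimes> \<phi> (Gen s j))"
proof -
  have "\<exists>c\<in>carrier K. \<phi> (Gen s j) \<otimes> word s' u = c \<odot> (word s' u \<otimes> \<phi> (Gen s j))"
    using assms(1,3)
  proof (induction u)
    case Nil
    then show ?case using assms(2) by (auto simp: word_simps gen_closed intro!: bexI[of _ "\<one>\<^bsub>K\<^esub>"])
  next
    case (Cons i u)
    then obtain c where c: "c \<in> carrier K"
      "\<phi> (Gen s j) \<otimes> word s' u = c \<odot> (word s' u \<otimes> \<phi> (Gen s j))" by auto
    have i: "i \<in> {1..m}" "set u \<subseteq> {1..m}" "j \<noteq> i" using Cons by auto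
    obtain e where e: "e \<in> carrier K"
      "\<phi> (Gen s j) \<otimes> \<phi> (Gen s' i) = e \<odot> (\<phi> (Gen s' i) \<otimes> \<phi> (Gen s j))"
      using gen_exchange[OF assms(2) i(1) i(3) assms(4)] .
    note closed = gen_closed[OF i(1), of s'] word_closed[OF i(2), of s'] gen_closed[OF assms(2), of s]
    have "\<phi> (Gen s j) \<otimes> word s' (i # u) = (\<phi> (Gen s j) \<otimes> \<phi> (Gen s' i)) \<otimes> word s' u"
      using closed by (simp add: word_simps B.A.m_assoc)
    also have "\<dots> = e \<odot> (\<phi> (Gen s' i) \<otimes> (\<phi> (Gen s j) \<otimes> word s' u))"
      using closed e by (simp add: B.smult_mult_left B.A.m_assoc)
    also have "\<dots> = (e \<otimes>\<^bsub>K\<^esub> c) \<odot> (word s' (i # u) \<otimes> \<phi> (Gen s j))"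
      using closed e(1) c by (simp add: word_simps B.smult_mult_right B.A.m_assoc B.smult_assoc1)
    finally show ?case using e(1) c(1) by blast
  qed
  then show thesis using that by blast
qed

lemma word_word:
  assumes "set u \<subseteq> {1..m}" "set v \<subseteq> {1..m}" "set u \<inter> set v = {}" "s \<noteq> s'"
  obtains c where "c \<in> carrier K" "word s u \<otimes> word s' v = c \<odot> (word s' v \<otimes> word s u)"
proof -
  have "\<exists>c\<in>carrier K. word s u \<otimes> word s' v = c \<odot> (word s' v \<otimes> word s u)"
    using assms(1,3)
  proof (induction u)
    case Nil
    then show ?case using word_closed[OF assms(2)] by (auto simp: word_simps intro!: bexI[of _ "\<one>\<^bsub>K\<^esub>"])
  next
    case (Cons i u)
    then obtain c where c: "c \<in> carrier K"
      "word s u \<otimes> word s' v = c \<odot> (word s' v \<otimes> word s u)" by auto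
    have i: "i \<in> {1..m}" "set u \<subseteq> {1..m}" "i \<notin> set v" using Cons by auto
    obtain e where e: "e \<in> carrier K"
      "\<phi> (Gen s i) \<otimes> word s' v = e \<odot> (word s' v \<otimes> \<phi> (Gen s i))"
      using gen_word[OF assms(2) i(1) i(3) assms(4)] .
    note closed = gen_closed[OF i(1), of s] word_closed[OF i(2), of s] word_closed[OF assms(2), of s']
    have "word s (i # u) \<otimes> word s' v = \<phi> (Gen s i) \<otimes> (word s u \<otimes> word s' v)"
      using closed by (simp add: word_simps B.A.m_assoc)
    also have "\<dots> = c \<odot> ((\<phi> (Gen s i) \<otimes> word s' v) \<otimes> word s u)"
      using closed c by (simp add: B.smult_mult_right B.A.m_assoc)
    also have "\<dots> = (c \<otimes>\<^bsub>K\<^esub> e) \<odot> (word s' v \<otimes> word s (i # u))"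
      using closed e c(1) by (simp add: word_simps B.smult_mult_left B.A.m_assoc B.smult_assoc1)
    finally show ?case using e(1) c(1) by blast
  qed
  then show thesis using that by blast
qed

text \<open>Every product of letters is a coefficient times a product of generators of one sign times a
  product of generators of the other sign such that no index occurs with both signs. Generators
  of opposite signs and different indices commute up to a scalar, so the two products may be
  interchanged, and a new generator on the left either joins the product of its own sign or
  meets its opposite and is absorbed into the coefficient.\<close>

definition normal_form :: "'b set"
  where "normal_form = {\<phi> (Coeff r) \<otimes> (word s u \<otimes> word s' v) | r s u s' v.
    r \<in> carrier R \<and> s \<noteq> s' \<and> set u \<subseteq> {1..m} \<and> set v \<subseteq> {1..m} \<and> set u \<inter> set v = {}}"

lemma normal_formI:
  "\<lbrakk>r \<in> carrier R; s \<noteq> s'; set u \<subseteq> {1..m}; set v \<subseteq> {1..m}; set u \<inter> set v = {}\<rbrakk> \<Longrightarrow>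
    \<phi> (Coeff r) \<otimes> (word s u \<otimes> word s' v) \<in> normal_form"
  unfolding normal_form_def by blast

lemma normal_form_one: "\<one> \<in> normal_form"
  using normal_formI[of "\<one>\<^bsub>R\<^esub>" Plus Minus "[]" "[]"] by (simp add: coeff_one word_simps)

lemma normal_form_coeff:
  assumes "y \<in> normal_form" "r \<in> carrier R"
  shows "\<phi> (Coeff r) \<otimes> y \<in> normal_form"
proof -
  obtain r' s u s' v where y: "y = \<phi> (Coeff r') \<otimes> (word s u \<otimes> word s' v)"
    and *: "r' \<in> carrier R" "s \<noteq> s'" "set u \<subseteq> {1..m}" "set v \<subseteq> {1..m}" "set u \<inter> set v = {}"
    using assms(1) by (auto simp: normal_form_def)
  have "\<phi> (Coeff r) \<otimes> y = \<phi> (Coeff (r \<otimes>\<^bsub>R\<^esub> r')) \<otimes> (word s u \<otimes> word s' v)"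
    using y * assms(2) by (simp add: coeff_mult coeff_closed word_closed B.A.m_assoc)
  then show ?thesis using normal_formI[OF _ *(2-5), of "r \<otimes>\<^bsub>R\<^esub> r'"] *(1) assms(2) by simp
qed

lemma normal_form_closed: "y \<in> normal_form \<Longrightarrow> y \<in> carrier B"
  by (auto simp: normal_form_def word_closed coeff_closed)

lemma normal_form_smult:
  assumes "y \<in> normal_form" "c \<in> carrier K"
  shows "c \<odot> y \<in> normal_form"
proof -
  have "c \<odot> y = \<phi> (Coeff (c \<odot>\<^bsub>R\<^esub> \<one>\<^bsub>R\<^esub>)) \<otimes> y"
    using assms normal_form_closed by (simp add: coeff_smult coeff_one B.smult_mult_left)
  then show ?thesis using normal_form_coeff[OF assms(1), of "c \<odot>\<^bsub>R\<^esub> \<one>\<^bsub>R\<^esub>"] assms(2) by simp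
qed

lemma normal_form_sign:
  assumes "y \<in> normal_form"
  obtains r s' u v where "y = \<phi> (Coeff r) \<otimes> (word s' u \<otimes> word s v)" "r \<in> carrier R" "s \<noteq> s'"
    "set u \<subseteq> {1..m}" "set v \<subseteq> {1..m}" "set u \<inter> set v = {}"
proof -
  obtain r a u b v where y: "y = \<phi> (Coeff r) \<otimes> (word a u \<otimes> word b v)"
    and *: "r \<in> carrier R" "a \<noteq> b" "set u \<subseteq> {1..m}" "set v \<subseteq> {1..m}" "set u \<inter> set v = {}"
    using assms(1) by (auto simp: normal_form_def)
  show thesis
  proof (cases "a = s")
    case True
    obtain c where c: "c \<in> carrier K" "word a u \<otimes> word b v = c \<odot> (word b v \<otimes> word a u)"
      using word_word[OF *(3,4,5,2)] .
    have "y = \<phi> (Coeff (c \<odot>\<^bsub>R\<^esub> r)) \<otimes> (word b v \<otimes> word a u)"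
      using y * c by (simp add: coeff_smult coeff_closed word_closed B.smult_mult_left B.smult_mult_right)
    then show thesis using that[of "c \<odot>\<^bsub>R\<^esub> r" b v u] True * c(1) by auto
  next
    case False
    then have "b = s" using *(2) by (cases a; cases b; cases s) auto
    then show thesis using that[of r a u v] * y by auto
  qed
qed

lemma normal_form_gen:
  assumes y: "y \<in> normal_form" and j: "j \<in> {1..m}"
  shows "\<phi> (Gen s j) \<otimes> y \<in> normal_form"
proof -
  obtain r s' u v where y: "y = \<phi> (Coeff r) \<otimes> (word s' u \<otimes> word s v)" and r: "r \<in> carrier R"
    and s: "s \<noteq> s'" and u: "set u \<subseteq> {1..m}" and v: "set v \<subseteq> {1..m}" and uv: "set u \<inter> set v = {}"
    using normal_form_sign[OF y, of s] .
  let ?r = "signed_aut K R \<sigma> s j r"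
  have r': "?r \<in> carrier R" by (rule signed_aut_hom(1)[OF j r])
  note closed = gen_closed[OF j, of s] coeff_closed[OF r] coeff_closed[OF r'] word_closed[OF u, of s']
    word_closed[OF v, of s]
  have "\<phi> (Gen s j) \<otimes> y = (\<phi> (Gen s j) \<otimes> \<phi> (Coeff r)) \<otimes> (word s' u \<otimes> word s v)"
    unfolding y using closed by (simp add: B.A.m_assoc)
  also have "\<dots> = \<phi> (Coeff ?r) \<otimes> ((\<phi> (Gen s j) \<otimes> word s' u) \<otimes> word s v)"
    using closed gen_coeff[OF j r] by (simp add: B.A.m_assoc)
  finally have eq: "\<phi> (Gen s j) \<otimes> y = \<phi> (Coeff ?r) \<otimes> ((\<phi> (Gen s j) \<otimes> word s' u) \<otimes> word s v)" .
  have "(\<phi> (Gen s j) \<otimes> word s' u) \<otimes> word s v \<in> normal_form"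
  proof (cases "j \<in> set u")
    case False
    obtain c where c: "c \<in> carrier K"
      "\<phi> (Gen s j) \<otimes> word s' u = c \<odot> (word s' u \<otimes> \<phi> (Gen s j))"
      using gen_word[OF u j False s] .
    have "(\<phi> (Gen s j) \<otimes> word s' u) \<otimes> word s v =
        \<phi> (Coeff (c \<odot>\<^bsub>R\<^esub> \<one>\<^bsub>R\<^esub>)) \<otimes> (word s' u \<otimes> word s (j # v))"
      using closed c by (simp add: coeff_smult coeff_one word_simps B.smult_mult_left B.A.m_assoc)
    also have "\<dots> \<in> normal_form"
      using c(1) s u v uv j False by (intro normal_formI) auto
    finally show ?thesis .
  next
    case True
    then obtain u1 u2 where u12: "u = u1 @ j # u2" "j \<notin> set u1" by (meson split_list_first)
    have u1: "set u1 \<subseteq> {1..m}" and u2: "set u2 \<subseteq> {1..m}" using u u12 by auto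
    obtain c where c: "c \<in> carrier K"
      "\<phi> (Gen s j) \<otimes> word s' u1 = c \<odot> (word s' u1 \<otimes> \<phi> (Gen s j))"
      using gen_word[OF u1 j u12(2) s] .
    obtain p where p: "p \<in> carrier R" "\<phi> (Gen s j) \<otimes> \<phi> (Gen s' j) = \<phi> (Coeff p)"
      using gen_cancel[OF j s] .
    obtain p' where p': "p' \<in> carrier R"
      "word s' u1 \<otimes> \<phi> (Coeff p) = \<phi> (Coeff p') \<otimes> word s' u1"
      using word_coeff[OF u1 p(1)] .
    note closed' = closed gen_closed[OF j, of s'] word_closed[OF u1, of s'] word_closed[OF u2, of s']
      coeff_closed[OF p(1)] coeff_closed[OF p'(1)]
    have w: "word s' u = word s' u1 \<otimes> (\<phi> (Gen s' j) \<otimes> word s' u2)"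
      using u1 u2 j by (simp add: u12(1) word_append word_simps)
    have "\<phi> (Gen s j) \<otimes> word s' u = (\<phi> (Gen s j) \<otimes> word s' u1) \<otimes> (\<phi> (Gen s' j) \<otimes> word s' u2)"
      unfolding w using closed' by (simp add: B.A.m_assoc)
    also have "\<dots> = c \<odot> (word s' u1 \<otimes> (\<phi> (Gen s j) \<otimes> \<phi> (Gen s' j)) \<otimes> word s' u2)"
      unfolding c(2) using closed' c(1) by (simp add: B.smult_mult_left B.A.m_assoc)
    also have "\<dots> = c \<odot> (\<phi> (Coeff p') \<otimes> word s' (u1 @ u2))"
      unfolding p(2) p'(2) using closed' u1 u2 by (simp add: word_append B.A.m_assoc)
    finally have "(\<phi> (Gen s j) \<otimes> word s' u) \<otimes> word s v =
        \<phi> (Coeff (c \<odot>\<^bsub>R\<^esub> p')) \<otimes> (word s' (u1 @ u2) \<otimes> word s v)"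
      using closed' c(1) u1 u2 p'(1) word_closed[of "u1 @ u2" s']
      by (simp add: coeff_smult B.smult_mult_left B.A.m_assoc)
    also have "\<dots> \<in> normal_form"
      using c(1) p'(1) s u v uv u12 by (intro normal_formI) auto
    finally show ?thesis .
  qed
  then show ?thesis unfolding eq by (rule normal_form_coeff[OF _ r'])
qed

end

section \<open>The construction as a universal graded model\<close>

context tgw_datum
begin

abbreviation Fr where "Fr \<equiv> tgw_free K R m"
abbreviation rels where "rels \<equiv> tgw_rel_ideal K R m \<sigma> t \<mu>"
abbreviation construction where "construction \<equiv> tgwc K R m \<sigma> t \<mu>"
abbreviation letter where "letter \<equiv> tgwc_letter K R m \<sigma> t \<mu>"

lemma tgw_free_eq: "Fr = free_algebra K letters letter_degree"
  by (simp add: tgw_free_def letters_def)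

sublocale Fr: graded_alg K Fr
  unfolding tgw_free_eq by (rule K.graded_alg_free_algebra)

lemma free_gen_closed: "l \<in> letters \<Longrightarrow> free_gen K l \<in> carrier Fr"
  using K.free_gen_homog[of l letters letter_degree] Fr.homog_closed by (simp add: tgw_free_eq)

lemma free_gen_degree: "\<lbrakk>l \<in> letters; letter_degree l = \<alpha>\<rbrakk> \<Longrightarrow> free_gen K l \<in> homog Fr \<alpha>"
  using K.free_gen_homog[of l letters letter_degree] by (simp add: tgw_free_eq)

lemma rels_homog:
  assumes "(u, v) \<in> tgw_rels K R m \<sigma> t \<mu>"
  shows "\<exists>\<alpha>. u \<in> homog Fr \<alpha> \<and> v \<in> homog Fr \<alpha>"
  using assms
proof cases
  case coeff_one
  then show ?thesis using free_gen_degree[of "Coeff \<one>\<^bsub>R\<^esub>" 0] Fr.homog_one by auto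
next
  case (coeff_add r s)
  then show ?thesis
    using free_gen_degree[of "Coeff _" 0] by (intro exI[of _ 0]) (auto intro!: Fr.homog_add)
next
  case (coeff_mult r s)
  then show ?thesis
    using free_gen_degree[of "Coeff _" 0] Fr.homog_mult[of _ 0 _ 0] by (intro exI[of _ 0]) auto
next
  case (coeff_smult c r)
  then show ?thesis
    using free_gen_degree[of "Coeff _" 0] by (intro exI[of _ 0]) (auto intro!: Fr.homog_smult)
next
  case (gen_coeff i r s)
  have l: "Coeff r \<in> letters" "Coeff (signed_aut K R \<sigma> s i r) \<in> letters" "Gen s i \<in> letters"
    using gen_coeff signed_aut_hom(1) by auto
  show ?thesis
    using Fr.homog_mult[OF free_gen_degree[OF l(3) refl] free_gen_degree[OF l(1) refl]]
      Fr.homog_mult[OF free_gen_degree[OF l(2) refl] free_gen_degree[OF l(3) refl]] gen_coeff(1,2)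
    by auto
next
  case (minus_plus i)
  have l: "Gen Minus i \<in> letters" "Gen Plus i \<in> letters" "Coeff (t i) \<in> letters"
    using minus_plus t_closed by auto
  show ?thesis
    using Fr.homog_mult[OF free_gen_degree[OF l(1) refl] free_gen_degree[OF l(2) refl]]
      free_gen_degree[OF l(3) refl] minus_plus by auto
next
  case (plus_minus i)
  have l: "Gen Minus i \<in> letters" "Gen Plus i \<in> letters" "Coeff (\<sigma> i (t i)) \<in> letters"
    using plus_minus t_closed sigma_closed by auto
  show ?thesis
    using Fr.homog_mult[OF free_gen_degree[OF l(2) refl] free_gen_degree[OF l(1) refl]]
      free_gen_degree[OF l(3) refl] plus_minus by auto
next
  case (mixed i j)
  have l: "Gen Plus i \<in> letters" "Gen Minus j \<in> letters" and \<mu>: "\<mu> i j \<in> carrier K"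
    using mixed \<mu>_units by auto
  show ?thesis
    using Fr.homog_mult[OF free_gen_degree[OF l(1) refl] free_gen_degree[OF l(2) refl]]
      Fr.homog_smult[OF \<mu> Fr.homog_mult[OF free_gen_degree[OF l(2) refl] free_gen_degree[OF l(1) refl]]]
      mixed(1,2) by auto
qed

lemma rel_closed: "(u, v) \<in> tgw_rels K R m \<sigma> t \<mu> \<Longrightarrow> u \<in> carrier Fr \<and> v \<in> carrier Fr"
  using rels_homog Fr.homog_closed by blast

lemma graded_ideal_rels: "graded_ideal Fr rels"
  unfolding tgw_rel_ideal_def
  by (rule Fr.graded_ideal_genideal) (use rels_homog Fr.homog_diff in blast)

lemma ideal_rels: "ideal rels Fr"
  using graded_ideal_rels by (simp add: graded_ideal_def)

sublocale C: graded_alg K construction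
  unfolding tgwc_def by (rule Fr.graded_alg_graded_quot[OF graded_ideal_rels])

lemma rel_cosets_eq:
  assumes "(u, v) \<in> tgw_rels K R m \<sigma> t \<mu>"
  shows "rels +>\<^bsub>Fr\<^esub> u = rels +>\<^bsub>Fr\<^esub> v"
proof -
  have "{u \<ominus>\<^bsub>Fr\<^esub> v | u v. (u, v) \<in> tgw_rels K R m \<sigma> t \<mu>} \<subseteq> rels"
    unfolding tgw_rel_ideal_def using rel_closed by (intro Fr.A.genideal_self) auto
  then have "u \<ominus>\<^bsub>Fr\<^esub> v \<in> rels" using assms by blast
  then show ?thesis using rel_closed[OF assms] Fr.coset_eq_iff[OF ideal_rels] by simp
qed

lemmas construction_simps = Fr.graded_quot_simps[OF ideal_rels, folded tgwc_def]

lemma letter_homog: "l \<in> letters \<Longrightarrow> letter l \<in> homog construction (letter_degree l)"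
  by (auto simp: construction_simps(7) tgwc_letter_def free_gen_degree)

lemma tgw_model_construction: "tgw_model K R m \<sigma> t \<mu> construction letter"
proof
  show "letter l \<in> carrier construction" if "l \<in> letters" for l
    using letter_homog[OF that] C.homog_closed by blast
  note closed = free_gen_closed signed_aut_hom(1) t_closed sigma_closed
  show "letter (Coeff \<one>\<^bsub>R\<^esub>) = \<one>\<^bsub>construction\<^esub>"
    using rel_cosets_eq[OF tgw_rels.coeff_one] by (simp add: tgwc_letter_def construction_simps)
  show "letter (Coeff (r \<oplus>\<^bsub>R\<^esub> r')) = letter (Coeff r) \<oplus>\<^bsub>construction\<^esub> letter (Coeff r')"
    if "r \<in> carrier R" "r' \<in> carrier R" for r r'
    using rel_cosets_eq[OF tgw_rels.coeff_add] that by (simp add: tgwc_letter_def construction_simps closed)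
  show "letter (Coeff (r \<otimes>\<^bsub>R\<^esub> r')) = letter (Coeff r) \<otimes>\<^bsub>construction\<^esub> letter (Coeff r')"
    if "r \<in> carrier R" "r' \<in> carrier R" for r r'
    using rel_cosets_eq[OF tgw_rels.coeff_mult] that by (simp add: tgwc_letter_def construction_simps closed)
  show "letter (Coeff (c \<odot>\<^bsub>R\<^esub> r)) = c \<odot>\<^bsub>construction\<^esub> letter (Coeff r)"
    if "c \<in> carrier K" "r \<in> carrier R" for c r
    using rel_cosets_eq[OF tgw_rels.coeff_smult] that by (simp add: tgwc_letter_def construction_simps closed)
  show "letter (Gen s i) \<otimes>\<^bsub>construction\<^esub> letter (Coeff r) =
      letter (Coeff (signed_aut K R \<sigma> s i r)) \<otimes>\<^bsub>construction\<^esub> letter (Gen s i)"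
    if "i \<in> {1..m}" "r \<in> carrier R" for s i r
    using rel_cosets_eq[OF tgw_rels.gen_coeff] that by (simp add: tgwc_letter_def construction_simps closed)
  show "letter (Gen Minus i) \<otimes>\<^bsub>construction\<^esub> letter (Gen Plus i) = letter (Coeff (t i))"
    if "i \<in> {1..m}" for i
    using rel_cosets_eq[OF tgw_rels.minus_plus] that by (simp add: tgwc_letter_def construction_simps closed)
  show "letter (Gen Plus i) \<otimes>\<^bsub>construction\<^esub> letter (Gen Minus i) = letter (Coeff (\<sigma> i (t i)))"
    if "i \<in> {1..m}" for i
    using rel_cosets_eq[OF tgw_rels.plus_minus] that by (simp add: tgwc_letter_def construction_simps closed)
  show "letter (Gen Plus i) \<otimes>\<^bsub>construction\<^esub> letter (Gen Minus j) =
      \<mu> i j \<odot>\<^bsub>construction\<^esub> (letter (Gen Minus j) \<otimes>\<^bsub>construction\<^esub> letter (Gen Plus i))"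
    if "i \<in> {1..m}" "j \<in> {1..m}" "i \<noteq> j" for i j
    using rel_cosets_eq[OF tgw_rels.mixed] that \<mu>_units[OF that] K.Units_closed
    by (simp add: tgwc_letter_def construction_simps closed)
qed

sublocale M: tgw_model K R m \<sigma> t \<mu> construction letter
  by (rule tgw_model_construction)

lemma construction_induct [consumes 1, case_names one letter smult add]:
  assumes X: "X \<in> carrier construction"
    and one: "P \<one>\<^bsub>construction\<^esub>"
    and letter: "\<And>l X. \<lbrakk>l \<in> letters; X \<in> carrier construction; P X\<rbrakk> \<Longrightarrow> P (letter l \<otimes>\<^bsub>construction\<^esub> X)"
    and smult: "\<And>c X. \<lbrakk>c \<in> carrier K; X \<in> carrier construction; P X\<rbrakk> \<Longrightarrow> P (c \<odot>\<^bsub>construction\<^esub> X)"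
    and add: "\<And>X Y. \<lbrakk>X \<in> carrier construction; Y \<in> carrier construction; P X; P Y\<rbrakk> \<Longrightarrow> P (X \<oplus>\<^bsub>construction\<^esub> Y)"
  shows "P X"
proof -
  obtain f where f: "f \<in> carrier Fr" "X = rels +>\<^bsub>Fr\<^esub> f" using X by (auto simp: construction_simps)
  have "P (rels +>\<^bsub>Fr\<^esub> f)"
    using f(1) unfolding tgw_free_eq
  proof (induction rule: K.free_algebra_induct)
    case one
    then show ?case using assms(2) by (simp add: construction_simps tgw_free_eq)
  next
    case (gen l f)
    then show ?case
      using letter[of l "rels +>\<^bsub>Fr\<^esub> f"] free_gen_closed[of l]
      by (simp add: construction_simps tgwc_letter_def flip: tgw_free_eq)
  next
    case (smult c f)
    then show ?case
      using assms(4)[of c "rels +>\<^bsub>Fr\<^esub> f"] by (simp add: construction_simps flip: tgw_free_eq)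
  next
    case (add f g)
    then show ?case
      using assms(5)[of "rels +>\<^bsub>Fr\<^esub> f" "rels +>\<^bsub>Fr\<^esub> g"] by (simp add: construction_simps flip: tgw_free_eq)
  qed
  then show ?thesis using f(2) by simp
qed

lemma construction_hom:
  fixes B :: "('k, 'b, 'w) module_scheme"
  assumes "tgw_model K R m \<sigma> t \<mu> B \<phi>"
  obtains h where "h \<in> alg_hom K construction B" "\<And>l. l \<in> letters \<Longrightarrow> h (letter l) = \<phi> l"
proof -
  interpret B: tgw_model K R m \<sigma> t \<mu> B \<phi> by fact
  have B: "assoc_algebra K B" by (rule B.B.assoc_algebra_axioms)
  obtain f where f: "f \<in> alg_hom K (free_algebra K letters letter_degree) B"
    "\<And>l. l \<in> letters \<Longrightarrow> f (free_gen K l) = \<phi> l"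
  proof (rule K.free_algebra_hom[OF B B.letter_closed, where d = letter_degree])
    fix h assume "h \<in> alg_hom K (free_algebra K letters letter_degree) B"
      and "\<And>l. l \<in> letters \<Longrightarrow> h (free_gen K l) = \<phi> l"
    then show thesis by (rule that)
  qed
  note f = f(1)[folded tgw_free_eq] f(2)
  note f' = alg_homD[OF f(1)] and fz = alg_hom_zero_minus[OF f(1) Fr.assoc_algebra_axioms B]
  let ?N = "{x \<in> carrier Fr. f x = \<zero>\<^bsub>B\<^esub>}"
  have N: "ideal ?N Fr"
  proof (rule idealI)
    show "subgroup ?N (add_monoid Fr)"
      by (rule Fr.M.add.subgroupI) (auto simp: f' fz(2) intro: fz(1))
  qed (auto simp: f' fz Fr.A.ring_axioms)
  have rel: "f u = f v" if "(u, v) \<in> tgw_rels K R m \<sigma> t \<mu>" for u v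
    using that
  proof cases
    case coeff_one
    then show ?thesis by (simp add: f f' B.coeff_one)
  next
    case (coeff_add r s)
    then show ?thesis by (simp add: f f' free_gen_closed B.coeff_add)
  next
    case (coeff_mult r s)
    then show ?thesis by (simp add: f f' free_gen_closed B.coeff_mult)
  next
    case (coeff_smult c r)
    then show ?thesis by (simp add: f f' free_gen_closed B.coeff_smult)
  next
    case (gen_coeff i r s)
    then show ?thesis
      using B.gen_coeff[of i r s] signed_aut_hom(1)[of i r s] by (simp add: f f' free_gen_closed)
  next
    case (minus_plus i)
    then show ?thesis using B.minus_plus[of i] t_closed by (simp add: f f' free_gen_closed)
  next
    case (plus_minus i)
    then show ?thesis using B.plus_minus[of i] t_closed sigma_closed by (simp add: f f' free_gen_closed)
  next
    case (mixed i j)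
    then show ?thesis
      using B.mixed[of i j] \<mu>_units[of i j] K.Units_closed by (simp add: f f' free_gen_closed)
  qed
  have "rels \<subseteq> ?N"
    unfolding tgw_rel_ideal_def
  proof (rule Fr.A.genideal_minimal[OF N])
    show "{u \<ominus>\<^bsub>Fr\<^esub> v | u v. (u, v) \<in> tgw_rels K R m \<sigma> t \<mu>} \<subseteq> ?N"
    proof
      fix x assume "x \<in> {u \<ominus>\<^bsub>Fr\<^esub> v | u v. (u, v) \<in> tgw_rels K R m \<sigma> t \<mu>}"
      then obtain u v where x: "x = u \<ominus>\<^bsub>Fr\<^esub> v" and uv: "(u, v) \<in> tgw_rels K R m \<sigma> t \<mu>" by auto
      have "f x = f v \<ominus>\<^bsub>B\<^esub> f v" using fz(3) rel_closed[OF uv] rel[OF uv] x by simp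
      then show "x \<in> ?N"
        using rel_closed[OF uv] x f'(1)[of v] by (simp add: a_minus_def B.B.M.r_neg)
    qed
  qed
  then obtain h where h: "h \<in> alg_hom K (graded_quot Fr rels) B"
    "\<And>x. x \<in> carrier Fr \<Longrightarrow> h (rels +>\<^bsub>Fr\<^esub> x) = f x"
    using Fr.graded_quot_factor[OF ideal_rels B f(1)] by blast
  show thesis
    by (rule that[of h]) (use h f(2) free_gen_closed in \<open>simp_all add: tgwc_def tgwc_letter_def\<close>)
qed

lemma construction_hom_unique:
  assumes "f \<in> alg_hom K construction B" "g \<in> alg_hom K construction B"
    and "\<And>l. l \<in> letters \<Longrightarrow> f (letter l) = g (letter l)" and "X \<in> carrier construction"
  shows "f X = g X"
  using assms(4)
  by (induction rule: construction_induct)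
    (use assms(3) M.letter_closed alg_homD[OF assms(1)] alg_homD[OF assms(2)] in simp_all)

lemma construction_hom_graded:
  fixes B :: "('k, nat \<Rightarrow>\<^sub>0 int, 'b, 'w) graded_algebra_scheme"
  assumes B: "graded_alg K B" and f: "f \<in> alg_hom K construction B"
    and l: "\<And>l. l \<in> letters \<Longrightarrow> f (letter l) \<in> homog B (letter_degree l)"
  shows "graded_map construction B f"
proof -
  interpret B: graded_alg K B by fact
  note f' = alg_homD[OF f] and f0 = alg_hom_zero_minus(1)[OF f C.assoc_algebra_axioms B.assoc_algebra_axioms]
  have eq: "f (component construction X \<alpha>) = component B (f X) \<alpha>" if "X \<in> carrier construction" for X \<alpha>
    using that
  proof (induction arbitrary: \<alpha> rule: construction_induct)
    case one
    then show ?case by (simp add: C.component_of_homog[OF C.homog_one] f' B.component_of_homog[OF B.homog_one] f0)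
  next
    case (letter l X)
    then show ?case
      using C.component_closed M.letter_closed
      by (simp add: C.component_mult_left[OF letter_homog] f' B.component_mult_left[OF l])
  qed (simp_all add: C.component_smult C.component_add B.component_smult B.component_add f' C.component_closed)
  show ?thesis
    unfolding graded_map_def
  proof safe
    fix \<alpha> X assume X: "X \<in> homog construction \<alpha>"
    then have "f X = component B (f X) \<alpha>"
      using eq[OF C.homog_closed[OF X], of \<alpha>] C.component_of_homog[OF X, of \<alpha>] by simp
    then show "f X \<in> homog B \<alpha>"
      using B.component_homog f'(1)[OF C.homog_closed[OF X]] by metis
  qed
qed

lemma letter_degree_mem: "l \<in> letters \<Longrightarrow> letter_degree l \<in> carrier (Z_pow m)"
proof (induction l rule: letter_degree.induct)
qed auto

lemma homog_outside_Z_pow: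
  assumes \<alpha>: "\<alpha> \<notin> carrier (Z_pow m)" and X: "X \<in> homog construction \<alpha>"
  shows "X = \<zero>\<^bsub>construction\<^esub>"
proof -
  have "\<forall>\<alpha>. \<alpha> \<notin> carrier (Z_pow m) \<longrightarrow> component construction X \<alpha> = \<zero>\<^bsub>construction\<^esub>"
    if "X \<in> carrier construction" for X
    using that
  proof (induction rule: construction_induct)
    case one
    show ?case by (auto simp: C.component_of_homog[OF C.homog_one])
  next
    case (letter l X)
    have "\<alpha> - letter_degree l \<notin> carrier (Z_pow m)" if "\<alpha> \<notin> carrier (Z_pow m)" for \<alpha>
      using that keys_add[of "\<alpha> - letter_degree l" "letter_degree l"] letter_degree_mem[OF letter(1)] by auto
    then show ?case
      using letter M.letter_closed by (auto simp: C.component_mult_left[OF letter_homog])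
  qed (auto simp: C.component_smult C.component_add C.smult_r_null)
  then show ?thesis using \<alpha> C.component_of_homog[OF X, of \<alpha>] C.homog_closed[OF X] by auto
qed

text \<open>The induction hypothesis holds for all predicates, so it can be applied to the predicate
  \<open>\<lambda>Y. P (letter l \<otimes> Y)\<close>.\<close>

lemma normal_form_span [consumes 1, case_names normal add]:
  assumes "X \<in> carrier construction"
    and "\<And>Y. Y \<in> M.normal_form \<Longrightarrow> P Y"
    and "\<And>Y Z. \<lbrakk>Y \<in> carrier construction; Z \<in> carrier construction; P Y; P Z\<rbrakk> \<Longrightarrow> P (Y \<oplus>\<^bsub>construction\<^esub> Z)"
  shows "P X"
  using assms
proof (induction arbitrary: P rule: construction_induct)
  case one
  then show ?case using M.normal_form_one by blast
next
  case (letter l X)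
  note lc = M.letter_closed[OF letter(1)]
  show ?case
  proof (rule letter.IH)
    fix Y assume "Y \<in> M.normal_form"
    then have "letter l \<otimes>\<^bsub>construction\<^esub> Y \<in> M.normal_form"
      using M.normal_form_coeff M.normal_form_gen by (rule_tac letters_cases[OF letter(1)]) auto
    then show "P (letter l \<otimes>\<^bsub>construction\<^esub> Y)" by (rule letter.prems(1))
  next
    fix Y Z assume "Y \<in> carrier construction" "Z \<in> carrier construction"
      "P (letter l \<otimes>\<^bsub>construction\<^esub> Y)" "P (letter l \<otimes>\<^bsub>construction\<^esub> Z)"
    then show "P (letter l \<otimes>\<^bsub>construction\<^esub> (Y \<oplus>\<^bsub>construction\<^esub> Z))"
      using letter.prems(2) lc by (simp add: C.A.r_distr)
  qed
next
  case (smult c X)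
  show ?case
  proof (rule smult.IH)
    fix Y assume "Y \<in> M.normal_form"
    then show "P (c \<odot>\<^bsub>construction\<^esub> Y)" using smult(1) M.normal_form_smult smult.prems(1) by blast
  next
    fix Y Z assume "Y \<in> carrier construction" "Z \<in> carrier construction"
      "P (c \<odot>\<^bsub>construction\<^esub> Y)" "P (c \<odot>\<^bsub>construction\<^esub> Z)"
    then show "P (c \<odot>\<^bsub>construction\<^esub> (Y \<oplus>\<^bsub>construction\<^esub> Z))"
      using smult.prems(2) smult(1) by (simp add: C.smult_r_distr)
  qed
next
  case (add X Y)
  then show ?case by blast
qed

fun sign_int :: "sign \<Rightarrow> int"
  where "sign_int Plus = 1" | "sign_int Minus = - 1"

definition word_degree :: "sign \<Rightarrow> nat list \<Rightarrow> (nat \<Rightarrow>\<^sub>0 int)"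
  where "word_degree s u = (\<Sum>i\<leftarrow>u. letter_degree (Gen s i :: 'r tgw_letter))"

lemma word_homog: "set u \<subseteq> {1..m} \<Longrightarrow> M.word s u \<in> homog construction (word_degree s u)"
proof (induction u)
  case Nil
  then show ?case by (simp add: M.word_simps C.homog_one word_degree_def)
next
  case (Cons i u)
  then show ?case
    using C.homog_mult[OF letter_homog[of "Gen s i"]] by (simp add: M.word_simps word_degree_def)
qed

lemma lookup_word_degree:
  "Poly_Mapping.lookup (word_degree s u) j = sign_int s * int (count_list u j)"
  by (induction u; cases s) (auto simp: word_degree_def lookup_add Poly_Mapping.lookup_minus lookup_single)

text \<open>The degree zero part is the image of \<open>R\<close>. Indeed, an index that occurs in a normal form does so with one sign
  only and hence shows in the degree, so a normal form of degree zero involves no generators.\<close>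

lemma homog_zero_eq_coeff:
  assumes X: "X \<in> homog construction 0"
  shows "X \<in> (\<lambda>r. letter (Coeff r)) ` carrier R"
proof -
  let ?Q = "\<lambda>X. component construction X 0 \<in> (\<lambda>r. letter (Coeff r)) ` carrier R"
  have zero: "\<zero>\<^bsub>construction\<^esub> \<in> (\<lambda>r. letter (Coeff r)) ` carrier R"
    using alg_hom_zero_minus(1)[OF M.coeff_hom R.assoc_algebra_axioms C.assoc_algebra_axioms]
    by (metis R.M.zero_closed image_eqI)
  have "?Q X"
    using C.homog_closed[OF X]
  proof (induction rule: normal_form_span)
    case (normal Y)
    then obtain r s u s' v where Y: "Y = letter (Coeff r) \<otimes>\<^bsub>construction\<^esub> (M.word s u \<otimes>\<^bsub>construction\<^esub> M.word s' v)"
      and *: "r \<in> carrier R" "s \<noteq> s'" "set u \<subseteq> {1..m}" "set v \<subseteq> {1..m}" "set u \<inter> set v = {}"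
      by (auto simp: M.normal_form_def)
    let ?d = "word_degree s u + word_degree s' v"
    have Yd: "Y \<in> homog construction ?d"
      using C.homog_mult[OF letter_homog[of "Coeff r"] C.homog_mult[OF word_homog[OF *(3)] word_homog[OF *(4)]]]
        * Y by simp
    show ?case
    proof (cases "u = [] \<and> v = []")
      case True
      then have "Y = letter (Coeff r)" using Y *(1) by (simp add: M.word_simps M.coeff_closed)
      then show ?thesis using Yd True *(1) by (simp add: C.component_of_homog word_degree_def)
    next
      case False
      then obtain i where i: "i \<in> set u \<or> i \<in> set v" by (cases u; cases v) auto
      have "Poly_Mapping.lookup ?d i \<noteq> 0"
      proof (cases "i \<in> set u")
        case True
        then have "count_list v i = 0" "count_list u i \<noteq> 0" using *(5) by (auto simp: count_list_0_iff)
        then show ?thesis by (cases s) (simp_all add: lookup_add lookup_word_degree)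
      next
        case False
        then have "count_list u i = 0" "count_list v i \<noteq> 0" using i by (auto simp: count_list_0_iff)
        then show ?thesis by (cases s') (simp_all add: lookup_add lookup_word_degree)
      qed
      then have "?d \<noteq> 0" by auto
      then show ?thesis using zero C.component_of_homog[OF Yd, of 0] by simp
    qed
  next
    case (add Y Z)
    then obtain r r' where "r \<in> carrier R" "r' \<in> carrier R" "component construction Y 0 = letter (Coeff r)"
      "component construction Z 0 = letter (Coeff r')" by auto
    then show ?case
      using add(1,2) M.coeff_add[of r r'] by (simp add: C.component_add) (metis R.M.a_closed image_eqI)
  qed
  then show ?thesis using C.component_of_homog[OF X, of 0] by simp
qed

end

section \<open>Twisting the datum\<close>

text \<open>The data of an action of \<open>\<int>\<^sup>m\<close> on a construction that rescales the generators: \<open>\<rho> \<alpha>\<close> is the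
  automorphism of the coefficients and \<open>\<kappa> \<alpha> s i\<close> the scalar by which the generator \<open>Gen s i\<close> is multiplied.
  The datum \<open>(\<sigma>', \<nu>)\<close> is the twist of \<open>(\<sigma>, \<mu>)\<close>. Up to replacing the action by its inverse, the two
  data play the same role.\<close>

locale tgw_twist_pair =
  S: tgw_datum K R m \<sigma> t \<mu> + T: tgw_datum K R m \<sigma>' t \<nu>
  for K :: "('k, 'z) ring_scheme" and R :: "('k, 'r, 'y) module_scheme" and m :: nat
    and t :: "nat \<Rightarrow> 'r" and \<sigma> :: "nat \<Rightarrow> 'r \<Rightarrow> 'r" and \<mu> :: "nat \<Rightarrow> nat \<Rightarrow> 'k"
    and \<sigma>' :: "nat \<Rightarrow> 'r \<Rightarrow> 'r" and \<nu> :: "nat \<Rightarrow> nat \<Rightarrow> 'k" +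
  fixes \<rho> :: "(nat \<Rightarrow>\<^sub>0 int) \<Rightarrow> 'r \<Rightarrow> 'r" and \<kappa> :: "(nat \<Rightarrow>\<^sub>0 int) \<Rightarrow> sign \<Rightarrow> nat \<Rightarrow> 'k"
  assumes \<rho>_hom: "\<alpha> \<in> carrier (Z_pow m) \<Longrightarrow> \<rho> \<alpha> \<in> alg_hom K R R"
    and \<rho>_add: "\<lbrakk>\<alpha> \<in> carrier (Z_pow m); \<beta> \<in> carrier (Z_pow m); r \<in> carrier R\<rbrakk> \<Longrightarrow>
      \<rho> (\<alpha> + \<beta>) r = \<rho> \<alpha> (\<rho> \<beta> r)"
    and \<rho>_zero: "r \<in> carrier R \<Longrightarrow> \<rho> 0 r = r"
    and \<kappa>_Units: "\<lbrakk>\<alpha> \<in> carrier (Z_pow m); i \<in> {1..m}\<rbrakk> \<Longrightarrow> \<kappa> \<alpha> s i \<in> Units K"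
    and \<kappa>_add: "\<lbrakk>\<alpha> \<in> carrier (Z_pow m); \<beta> \<in> carrier (Z_pow m); i \<in> {1..m}\<rbrakk> \<Longrightarrow>
      \<kappa> (\<alpha> + \<beta>) s i = \<kappa> \<alpha> s i \<otimes>\<^bsub>K\<^esub> \<kappa> \<beta> s i"
    and \<rho>_commute: "\<lbrakk>\<alpha> \<in> carrier (Z_pow m); i \<in> {1..m}; r \<in> carrier R\<rbrakk> \<Longrightarrow>
      \<rho> \<alpha> (signed_aut K R \<sigma> s i r) = signed_aut K R \<sigma> s i (\<rho> \<alpha> r)"
    and \<rho>_t: "\<lbrakk>\<alpha> \<in> carrier (Z_pow m); i \<in> {1..m}\<rbrakk> \<Longrightarrow>
      \<rho> \<alpha> (t i) = (\<kappa> \<alpha> Plus i \<otimes>\<^bsub>K\<^esub> \<kappa> \<alpha> Minus i) \<odot>\<^bsub>R\<^esub> t i"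
    and twisted_aut: "\<lbrakk>i \<in> {1..m}; r \<in> carrier R\<rbrakk> \<Longrightarrow>
      signed_aut K R \<sigma>' s i r = \<rho> (- letter_degree (Gen s i :: 'r tgw_letter)) (signed_aut K R \<sigma> s i r)"
    and twisted_scalar: "\<lbrakk>i \<in> {1..m}; j \<in> {1..m}; i \<noteq> j\<rbrakk> \<Longrightarrow>
      \<nu> i j = \<mu> i j \<otimes>\<^bsub>K\<^esub> \<kappa> (- frag_of j) Plus i \<otimes>\<^bsub>K\<^esub> \<kappa> (- frag_of i) Minus j"
begin

lemma Z_pow_mem:
  "0 \<in> carrier (Z_pow m)"
  "\<alpha> \<in> carrier (Z_pow m) \<Longrightarrow> - \<alpha> \<in> carrier (Z_pow m)"
  "\<lbrakk>\<alpha> \<in> carrier (Z_pow m); \<beta> \<in> carrier (Z_pow m)\<rbrakk> \<Longrightarrow> \<alpha> + \<beta> \<in> carrier (Z_pow m)"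
  "i \<in> {1..m} \<Longrightarrow> frag_of i \<in> carrier (Z_pow m)"
  using keys_add[of \<alpha> \<beta>] by auto

lemma degree_mem: "i \<in> {1..m} \<Longrightarrow> letter_degree (Gen s i :: 'r tgw_letter) \<in> carrier (Z_pow m)"
  by (cases s) (simp_all add: Z_pow_mem)

lemma \<kappa>_closed: "\<lbrakk>\<alpha> \<in> carrier (Z_pow m); i \<in> {1..m}\<rbrakk> \<Longrightarrow> \<kappa> \<alpha> s i \<in> carrier K"
  using \<kappa>_Units S.K.Units_closed by blast

lemma \<kappa>_inverse:
  assumes "\<alpha> \<in> carrier (Z_pow m)" "i \<in> {1..m}"
  shows "\<kappa> \<alpha> s i \<otimes>\<^bsub>K\<^esub> \<kappa> (- \<alpha>) s i = \<one>\<^bsub>K\<^esub>" "\<kappa> (- \<alpha>) s i \<otimes>\<^bsub>K\<^esub> \<kappa> \<alpha> s i = \<one>\<^bsub>K\<^esub>"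
proof -
  have u: "\<kappa> 0 s i \<in> Units K" and c: "\<kappa> 0 s i \<in> carrier K"
    using \<kappa>_Units[OF Z_pow_mem(1) assms(2)] by auto
  have "\<kappa> 0 s i \<otimes>\<^bsub>K\<^esub> \<kappa> 0 s i = \<kappa> 0 s i \<otimes>\<^bsub>K\<^esub> \<one>\<^bsub>K\<^esub>"
    using \<kappa>_add[OF Z_pow_mem(1) Z_pow_mem(1) assms(2), of s] c by simp
  then have zero: "\<kappa> 0 s i = \<one>\<^bsub>K\<^esub>" using S.K.Units_l_cancel[OF u c S.K.one_closed] by simp
  show "\<kappa> \<alpha> s i \<otimes>\<^bsub>K\<^esub> \<kappa> (- \<alpha>) s i = \<one>\<^bsub>K\<^esub>" "\<kappa> (- \<alpha>) s i \<otimes>\<^bsub>K\<^esub> \<kappa> \<alpha> s i = \<one>\<^bsub>K\<^esub>"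
    using \<kappa>_add[OF assms(1) Z_pow_mem(2)[OF assms(1)] assms(2), of s]
      \<kappa>_add[OF Z_pow_mem(2)[OF assms(1)] assms(1,2), of s] zero by simp_all
qed

lemma \<rho>_inverse:
  assumes "\<alpha> \<in> carrier (Z_pow m)" "r \<in> carrier R"
  shows "\<rho> \<alpha> (\<rho> (- \<alpha>) r) = r" "\<rho> (- \<alpha>) (\<rho> \<alpha> r) = r"
  using \<rho>_add[OF assms(1) Z_pow_mem(2)[OF assms(1)] assms(2)]
    \<rho>_add[OF Z_pow_mem(2)[OF assms(1)] assms] \<rho>_zero[OF assms(2)] by simp_all

lemma \<rho>_swap:
  assumes "\<alpha> \<in> carrier (Z_pow m)" "\<beta> \<in> carrier (Z_pow m)" "r \<in> carrier R"
  shows "\<rho> \<alpha> (\<rho> \<beta> r) = \<rho> \<beta> (\<rho> \<alpha> r)"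
  using \<rho>_add[OF assms] \<rho>_add[OF assms(2,1,3)] by (simp add: add.commute)

lemma \<rho>_closed: "\<lbrakk>\<alpha> \<in> carrier (Z_pow m); r \<in> carrier R\<rbrakk> \<Longrightarrow> \<rho> \<alpha> r \<in> carrier R"
  using alg_homD(1)[OF \<rho>_hom] .

text \<open>Thanks to this symmetry each statement about maps from one construction to the twist of the
  other one is needed in one direction only.\<close>

lemma swap: "tgw_twist_pair K R m t \<sigma>' \<nu> \<sigma> \<mu> (\<lambda>\<alpha>. \<rho> (- \<alpha>)) (\<lambda>\<alpha>. \<kappa> (- \<alpha>))"
proof -
  \<comment> \<open>Membership in \<open>\<int>\<^sup>m\<close> and in the index range is kept in the form in which the hypotheses state it.\<close>
  note [simp del] = carrier_free_Abelian_group_iff atLeastAtMost_iff One_nat_def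
  show ?thesis
  proof
    show "\<rho> (- \<alpha>) \<in> alg_hom K R R" if "\<alpha> \<in> carrier (Z_pow m)" for \<alpha>
      using that by (simp add: \<rho>_hom Z_pow_mem)
    show "\<rho> (- (\<alpha> + \<beta>)) r = \<rho> (- \<alpha>) (\<rho> (- \<beta>) r)"
      if "\<alpha> \<in> carrier (Z_pow m)" "\<beta> \<in> carrier (Z_pow m)" "r \<in> carrier R" for \<alpha> \<beta> r
      using that \<rho>_add[of "- \<alpha>" "- \<beta>" r] by (simp add: Z_pow_mem)
    show "\<rho> (- 0) r = r" if "r \<in> carrier R" for r using that by (simp add: \<rho>_zero)
    show "\<kappa> (- \<alpha>) s i \<in> Units K" if "\<alpha> \<in> carrier (Z_pow m)" "i \<in> {1..m}" for \<alpha> s i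
      using that by (simp only: \<kappa>_Units Z_pow_mem)
    show "\<kappa> (- (\<alpha> + \<beta>)) s i = \<kappa> (- \<alpha>) s i \<otimes>\<^bsub>K\<^esub> \<kappa> (- \<beta>) s i"
      if "\<alpha> \<in> carrier (Z_pow m)" "\<beta> \<in> carrier (Z_pow m)" "i \<in> {1..m}" for \<alpha> \<beta> s i
      using \<kappa>_add[OF Z_pow_mem(2)[OF that(1)] Z_pow_mem(2)[OF that(2)] that(3), of s] by simp
    show "\<rho> (- \<alpha>) (signed_aut K R \<sigma>' s i r) = signed_aut K R \<sigma>' s i (\<rho> (- \<alpha>) r)"
      if "\<alpha> \<in> carrier (Z_pow m)" "i \<in> {1..m}" "r \<in> carrier R" for \<alpha> s i r
      using that \<rho>_swap[of "- \<alpha>" "- letter_degree (Gen s i :: 'r tgw_letter)" "signed_aut K R \<sigma> s i r"]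
        Z_pow_mem(2)[OF degree_mem[OF that(2)], of s] S.signed_aut_hom(1)[OF that(2,3), of s]
      by (simp add: twisted_aut[OF that(2)] \<rho>_commute[OF _ that(2)] Z_pow_mem \<rho>_closed)
    show "\<rho> (- \<alpha>) (t i) = (\<kappa> (- \<alpha>) Plus i \<otimes>\<^bsub>K\<^esub> \<kappa> (- \<alpha>) Minus i) \<odot>\<^bsub>R\<^esub> t i"
      if "\<alpha> \<in> carrier (Z_pow m)" "i \<in> {1..m}" for \<alpha> i
      using \<rho>_t[OF Z_pow_mem(2)[OF that(1)] that(2)] .
    show "signed_aut K R \<sigma> s i r =
        \<rho> (- (- letter_degree (Gen s i :: 'r tgw_letter))) (signed_aut K R \<sigma>' s i r)"
      if "i \<in> {1..m}" "r \<in> carrier R" for s i r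
      using that \<rho>_inverse(1)[OF degree_mem[OF that(1)] S.signed_aut_hom(1)[OF that]]
      by (simp add: twisted_aut[OF that])
    show "\<mu> i j = \<nu> i j \<otimes>\<^bsub>K\<^esub> \<kappa> (- (- frag_of j)) Plus i \<otimes>\<^bsub>K\<^esub> \<kappa> (- (- frag_of i)) Minus j"
      if ij: "i \<in> {1..m}" "j \<in> {1..m}" "i \<noteq> j" for i j
    proof -
      let ?a = "\<kappa> (- frag_of j) Plus i" and ?b = "\<kappa> (- frag_of i) Minus j"
        and ?a' = "\<kappa> (frag_of j) Plus i" and ?b' = "\<kappa> (frag_of i) Minus j"
      have c: "?a \<in> carrier K" "?b \<in> carrier K" "?a' \<in> carrier K" "?b' \<in> carrier K" "\<mu> i j \<in> carrier K"
        using ij by (simp_all add: \<kappa>_closed Z_pow_mem S.\<mu>_units S.K.Units_closed)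
      have "\<nu> i j \<otimes>\<^bsub>K\<^esub> ?a' \<otimes>\<^bsub>K\<^esub> ?b' = \<mu> i j \<otimes>\<^bsub>K\<^esub> (?a \<otimes>\<^bsub>K\<^esub> ?a') \<otimes>\<^bsub>K\<^esub> (?b \<otimes>\<^bsub>K\<^esub> ?b')"
        unfolding twisted_scalar[OF ij] using c by (simp add: S.K.m_ac)
      also have "\<dots> = \<mu> i j"
        using \<kappa>_inverse(2)[OF Z_pow_mem(4)[OF ij(2)] ij(1)] \<kappa>_inverse(2)[OF Z_pow_mem(4)[OF ij(1)] ij(2)] c(5)
        by simp
      finally show ?thesis by simp
    qed
  qed
qed

definition rescaled_letter ::
    "(nat \<Rightarrow>\<^sub>0 int) \<Rightarrow> 'r tgw_letter \<Rightarrow> ('r tgw_letter list \<Rightarrow> 'k) set"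
  where "rescaled_letter \<alpha> l = (case l of Coeff r \<Rightarrow> S.letter (Coeff (\<rho> \<alpha> r))
    | Gen s i \<Rightarrow> \<kappa> \<alpha> s i \<odot>\<^bsub>S.construction\<^esub> S.letter (Gen s i))"

lemma rescaled_letter_simps [simp]:
  "rescaled_letter \<alpha> (Coeff r) = S.letter (Coeff (\<rho> \<alpha> r))"
  "rescaled_letter \<alpha> (Gen s i) = \<kappa> \<alpha> s i \<odot>\<^bsub>S.construction\<^esub> S.letter (Gen s i)"
  by (simp_all add: rescaled_letter_def)

text \<open>The rescaled letters satisfy the relations again because \<open>\<rho> \<alpha>\<close> commutes with the \<open>\<sigma>\<^sub>i\<close> and scales \<open>t\<^sub>i\<close> by
  the product of the scalars of the two generators. So the universal property provides an action with
  the given data.\<close>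

lemma rescaled_model:
  assumes \<alpha>: "\<alpha> \<in> carrier (Z_pow m)"
  shows "tgw_model K R m \<sigma> t \<mu> S.construction
    (rescaled_letter \<alpha>)"
proof -
  note [simp del] = carrier_free_Abelian_group_iff atLeastAtMost_iff One_nat_def
  note \<rho> = alg_homD[OF \<rho>_hom[OF \<alpha>]]
  note closed = S.M.coeff_closed S.M.gen_closed \<kappa>_closed[OF \<alpha>] \<rho>(1) S.t_closed S.sigma_closed
    S.signed_aut_hom(1)
  have comm: "\<rho> \<alpha> (\<sigma> i r) = \<sigma> i (\<rho> \<alpha> r)" if "i \<in> {1..m}" "r \<in> carrier R" for i r
    using \<rho>_commute[OF \<alpha> that, of Plus] by simp
  show ?thesis
  proof
    show "rescaled_letter \<alpha> l
      \<in> carrier S.construction" if "l \<in> S.letters" for l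
      using that by (rule S.letters_cases) (auto simp: closed)
  next
    fix i s r assume "i \<in> {1..m}" "r \<in> carrier R"
    then show "rescaled_letter \<alpha> (Gen s i)
      \<otimes>\<^bsub>S.construction\<^esub> rescaled_letter \<alpha> (Coeff r) =
      rescaled_letter \<alpha> (Coeff (signed_aut K R \<sigma> s i r))
      \<otimes>\<^bsub>S.construction\<^esub> rescaled_letter \<alpha> (Gen s i)"
      by (simp add: closed \<rho>_commute[OF \<alpha>] S.M.gen_coeff S.C.smult_mult_left S.C.smult_mult_right)
  next
    fix i assume i: "i \<in> {1..m}"
    show "rescaled_letter \<alpha> (Gen Minus i)
      \<otimes>\<^bsub>S.construction\<^esub> rescaled_letter \<alpha> (Gen Plus i) =
      rescaled_letter \<alpha> (Coeff (t i))"
      using i by (simp add: closed \<rho>_t[OF \<alpha> i] S.M.coeff_smult S.M.minus_plus S.C.smult_mult_left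
          S.C.smult_mult_right S.C.smult_assoc1 S.C.smult_lcomm)
    show "rescaled_letter \<alpha> (Gen Plus i)
      \<otimes>\<^bsub>S.construction\<^esub> rescaled_letter \<alpha> (Gen Minus i) =
      rescaled_letter \<alpha> (Coeff (\<sigma> i (t i)))"
      using i by (simp add: closed comm \<rho>_t[OF \<alpha> i] alg_homD(5)[OF S.sigma_hom] S.M.coeff_smult S.M.plus_minus
          S.C.smult_mult_left S.C.smult_mult_right S.C.smult_assoc1 S.C.smult_lcomm)
  next
    fix i j assume ij: "i \<in> {1..m}" "j \<in> {1..m}" "i \<noteq> j"
    have "\<mu> i j \<in> carrier K" using S.\<mu>_units[OF ij] S.K.Units_closed by blast
    then show "rescaled_letter \<alpha> (Gen Plus i)
      \<otimes>\<^bsub>S.construction\<^esub> rescaled_letter \<alpha> (Gen Minus j) =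
      \<mu> i j \<odot>\<^bsub>S.construction\<^esub> (rescaled_letter \<alpha> (Gen Minus j)
      \<otimes>\<^bsub>S.construction\<^esub> rescaled_letter \<alpha> (Gen Plus i))"
      using ij by (simp add: closed S.M.mixed S.C.smult_mult_left S.C.smult_mult_right S.C.smult_lcomm)
  qed (simp_all add: closed \<rho> S.M.coeff_one S.M.coeff_add S.M.coeff_mult S.M.coeff_smult)
qed

lemma compatible_action_exists:
  obtains \<chi> where "graded_action K S.construction (carrier (Z_pow m)) \<chi>"
    and "\<And>\<alpha> r. \<lbrakk>\<alpha> \<in> carrier (Z_pow m); r \<in> carrier R\<rbrakk> \<Longrightarrow>
      \<chi> \<alpha> (S.letter (Coeff r)) = S.letter (Coeff (\<rho> \<alpha> r))"
    and "\<And>\<alpha> s i. \<lbrakk>\<alpha> \<in> carrier (Z_pow m); i \<in> {1..m}\<rbrakk> \<Longrightarrow>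
      \<chi> \<alpha> (S.letter (Gen s i)) = \<kappa> \<alpha> s i \<odot>\<^bsub>S.construction\<^esub> S.letter (Gen s i)"
proof -
  note [simp del] = carrier_free_Abelian_group_iff atLeastAtMost_iff One_nat_def
  have "\<forall>\<alpha>\<in>carrier (Z_pow m). \<exists>h. h \<in> alg_hom K S.construction S.construction \<and>
    (\<forall>l\<in>S.letters. h (S.letter l) = rescaled_letter \<alpha> l)"
  proof
    fix \<alpha> assume "\<alpha> \<in> carrier (Z_pow m)"
    then obtain h
      where "h \<in> alg_hom K S.construction S.construction" "\<And>l. l \<in> S.letters \<Longrightarrow> h (S.letter l) = rescaled_letter \<alpha> l"
      by (rule S.construction_hom[OF rescaled_model]) (rule that)
    then show "\<exists>h. h \<in> alg_hom K S.construction S.construction \<and> (\<forall>l\<in>S.letters. h (S.letter l) = rescaled_letter \<alpha> l)"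
      by (intro exI conjI ballI)
  qed
  then have "\<exists>\<chi>. \<forall>\<alpha>\<in>carrier (Z_pow m). \<chi> \<alpha> \<in> alg_hom K S.construction S.construction \<and>
    (\<forall>l\<in>S.letters. \<chi> \<alpha> (S.letter l) = rescaled_letter \<alpha> l)" by (rule bchoice)
  then obtain \<chi> where "\<forall>\<alpha>\<in>carrier (Z_pow m). \<chi> \<alpha> \<in> alg_hom K S.construction S.construction \<and>
    (\<forall>l\<in>S.letters. \<chi> \<alpha> (S.letter l) = rescaled_letter \<alpha> l)" ..
  then have \<chi>: "\<And>\<alpha>. \<alpha> \<in> carrier (Z_pow m) \<Longrightarrow> \<chi> \<alpha> \<in> alg_hom K S.construction S.construction"
    and \<chi>_letter: "\<And>\<alpha> l. \<lbrakk>\<alpha> \<in> carrier (Z_pow m); l \<in> S.letters\<rbrakk> \<Longrightarrow> \<chi> \<alpha> (S.letter l) = rescaled_letter \<alpha> l"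
    by simp_all
  have coeff: "\<chi> \<alpha> (S.letter (Coeff r)) = S.letter (Coeff (\<rho> \<alpha> r))"
    if "\<alpha> \<in> carrier (Z_pow m)" "r \<in> carrier R" for \<alpha> r using \<chi>_letter[of \<alpha> "Coeff r"] that by simp
  have gen: "\<chi> \<alpha> (S.letter (Gen s i)) = \<kappa> \<alpha> s i \<odot>\<^bsub>S.construction\<^esub> S.letter (Gen s i)"
    if "\<alpha> \<in> carrier (Z_pow m)" "i \<in> {1..m}" for \<alpha> s i using \<chi>_letter[of \<alpha> "Gen s i"] that by simp
  have "graded_action K S.construction (carrier (Z_pow m)) \<chi>"
  proof
    show "x = \<zero>\<^bsub>S.construction\<^esub>" if "\<alpha> \<notin> carrier (Z_pow m)" "x \<in> homog S.construction \<alpha>" for \<alpha> x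
      by (rule S.homog_outside_Z_pow[OF that])
    show "graded_map S.construction S.construction (\<chi> \<alpha>)" if \<alpha>: "\<alpha> \<in> carrier (Z_pow m)" for \<alpha>
    proof (rule S.construction_hom_graded[OF S.C.graded_alg_axioms \<chi>[OF \<alpha>]])
      fix l assume l: "l \<in> S.letters"
      then show "\<chi> \<alpha> (S.letter l) \<in> homog S.construction (letter_degree l)"
        using \<alpha> S.letter_homog[of "Coeff (\<rho> \<alpha> _)"] S.letter_homog[OF l]
        by (cases rule: S.letters_cases) (auto simp: coeff gen \<rho>_closed \<kappa>_closed S.C.homog_smult)
    qed
    show "\<chi> (\<alpha> + \<beta>) x = \<chi> \<alpha> (\<chi> \<beta> x)"
      if \<alpha>: "\<alpha> \<in> carrier (Z_pow m)" and \<beta>: "\<beta> \<in> carrier (Z_pow m)" and x: "x \<in> carrier S.construction" for \<alpha> \<beta> x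
    proof (rule S.construction_hom_unique[OF \<chi>[OF Z_pow_mem(3)[OF \<alpha> \<beta>]] alg_hom_comp[OF \<chi>[OF \<beta>] \<chi>[OF \<alpha>]] _ x])
      fix l assume "l \<in> S.letters"
      then show "\<chi> (\<alpha> + \<beta>) (S.letter l) = \<chi> \<alpha> (\<chi> \<beta> (S.letter l))"
        using \<alpha> \<beta> by (cases rule: S.letters_cases)
          (simp_all add: coeff gen Z_pow_mem \<rho>_closed \<rho>_add \<kappa>_add \<kappa>_closed alg_homD(5)[OF \<chi>]
            S.M.gen_closed S.C.smult_assoc1 S.C.smult_lcomm)
    qed
    show "\<chi> 0 x = x" if "x \<in> carrier S.construction" for x
    proof (rule S.construction_hom_unique[OF \<chi>[OF Z_pow_mem(1)] alg_hom_id _ that])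
      fix l assume "l \<in> S.letters"
      moreover have "\<kappa> 0 s i = \<one>\<^bsub>K\<^esub>" if "i \<in> {1..m}" for s i
        using \<kappa>_inverse(1)[OF Z_pow_mem(1) that] \<kappa>_add[OF Z_pow_mem(1) Z_pow_mem(1) that] by simp
      ultimately show "\<chi> 0 (S.letter l) = S.letter l"
        by (cases rule: S.letters_cases) (simp_all add: coeff gen Z_pow_mem \<rho>_zero S.M.gen_closed)
    qed
  qed (use Z_pow_mem \<chi> in auto)
  from that[OF this coeff gen] show thesis .
qed

end

text \<open>Two mutually twisted constructions, the first with an action \<open>\<chi>\<close> that has the given data, the second
  with an action \<open>\<chi>'\<close> that has the inverse data.\<close>

locale tgw_twist_actions = tgw_twist_pair K R m t \<sigma> \<mu> \<sigma>' \<nu> \<rho> \<kappa>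
  for K :: "('k, 'z) ring_scheme" and R :: "('k, 'r, 'y) module_scheme" and m :: nat
    and t :: "nat \<Rightarrow> 'r" and \<sigma> :: "nat \<Rightarrow> 'r \<Rightarrow> 'r" and \<mu> :: "nat \<Rightarrow> nat \<Rightarrow> 'k"
    and \<sigma>' :: "nat \<Rightarrow> 'r \<Rightarrow> 'r" and \<nu> :: "nat \<Rightarrow> nat \<Rightarrow> 'k"
    and \<rho> :: "(nat \<Rightarrow>\<^sub>0 int) \<Rightarrow> 'r \<Rightarrow> 'r" and \<kappa> :: "(nat \<Rightarrow>\<^sub>0 int) \<Rightarrow> sign \<Rightarrow> nat \<Rightarrow> 'k" +
  fixes \<chi> \<chi>' :: "(nat \<Rightarrow>\<^sub>0 int) \<Rightarrow> ('r tgw_letter list \<Rightarrow> 'k) set \<Rightarrow> ('r tgw_letter list \<Rightarrow> 'k) set"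
  assumes action: "graded_action K S.construction (carrier (Z_pow m)) \<chi>"
    and action_coeff: "\<lbrakk>\<alpha> \<in> carrier (Z_pow m); r \<in> carrier R\<rbrakk> \<Longrightarrow>
      \<chi> \<alpha> (S.letter (Coeff r)) = S.letter (Coeff (\<rho> \<alpha> r))"
    and action_gen: "\<lbrakk>\<alpha> \<in> carrier (Z_pow m); i \<in> {1..m}\<rbrakk> \<Longrightarrow>
      \<chi> \<alpha> (S.letter (Gen s i)) = \<kappa> \<alpha> s i \<odot>\<^bsub>S.construction\<^esub> S.letter (Gen s i)"
    and action': "graded_action K T.construction (carrier (Z_pow m)) \<chi>'"
    and action'_coeff: "\<lbrakk>\<alpha> \<in> carrier (Z_pow m); r \<in> carrier R\<rbrakk> \<Longrightarrow>
      \<chi>' \<alpha> (T.letter (Coeff r)) = T.letter (Coeff (\<rho> (- \<alpha>) r))"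
    and action'_gen: "\<lbrakk>\<alpha> \<in> carrier (Z_pow m); i \<in> {1..m}\<rbrakk> \<Longrightarrow>
      \<chi>' \<alpha> (T.letter (Gen s i)) = \<kappa> (- \<alpha>) s i \<odot>\<^bsub>T.construction\<^esub> T.letter (Gen s i)"
begin

sublocale act: graded_action K S.construction "carrier (Z_pow m)" \<chi> by (rule action)

sublocale tw: graded_alg K "graded_twist \<chi> S.construction" by (rule act.graded_alg_twist)

lemma swap_actions:
  "tgw_twist_actions K R m t \<sigma>' \<nu> \<sigma> \<mu> (\<lambda>\<alpha>. \<rho> (- \<alpha>)) (\<lambda>\<alpha>. \<kappa> (- \<alpha>)) \<chi>' \<chi>"
proof -
  interpret sw: tgw_twist_pair K R m t \<sigma>' \<nu> \<sigma> \<mu> "\<lambda>\<alpha>. \<rho> (- \<alpha>)" "\<lambda>\<alpha>. \<kappa> (- \<alpha>)" by (rule swap)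
  show ?thesis
    by (intro tgw_twist_actions.intro sw.tgw_twist_pair_axioms tgw_twist_actions_axioms.intro,
        unfold minus_minus)
      (fact action' action'_coeff action'_gen action action_coeff action_gen)+
qed

text \<open>In the twist, the product of \<open>X\<^sup>-\<^sub>i\<close> and \<open>X\<^sup>+\<^sub>i\<close> is \<open>t\<^sub>i\<close> times the scalar by which \<open>\<chi>\<close> multiplies \<open>X\<^sup>-\<^sub>i\<close> in
  degree \<open>\<^bold>e\<^sub>i\<close>. Dividing \<open>X\<^sup>+\<^sub>i\<close> by this scalar restores the relation.\<close>

definition gen_scale :: "sign \<Rightarrow> nat \<Rightarrow> 'k"
  where "gen_scale s i = (case s of Plus \<Rightarrow> \<kappa> (- frag_of i) Minus i | Minus \<Rightarrow> \<one>\<^bsub>K\<^esub>)"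

definition twisted_letter :: "'r tgw_letter \<Rightarrow> ('r tgw_letter list \<Rightarrow> 'k) set"
  where "twisted_letter l = (case l of Coeff r \<Rightarrow> S.letter (Coeff r)
    | Gen s i \<Rightarrow> gen_scale s i \<odot>\<^bsub>S.construction\<^esub> S.letter (Gen s i))"

lemma gen_scale_closed: "i \<in> {1..m} \<Longrightarrow> gen_scale s i \<in> carrier K"
  unfolding gen_scale_def using \<kappa>_closed[OF Z_pow_mem(2)[OF Z_pow_mem(4)]] S.K.one_closed by (cases s) auto

lemma twisted_letter_simps:
  "twisted_letter (Coeff r) = S.letter (Coeff r)"
  "twisted_letter (Gen s i) = gen_scale s i \<odot>\<^bsub>S.construction\<^esub> S.letter (Gen s i)"
  by (simp_all add: twisted_letter_def)

lemma twisted_letter_homog: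
  assumes "l \<in> S.letters"
  shows "twisted_letter l \<in> homog S.construction (letter_degree l)"
  using assms S.letter_homog[OF assms]
  by (cases rule: S.letters_cases) (simp_all add: twisted_letter_simps gen_scale_closed S.C.homog_smult)

lemma twist_mult_letter:
  assumes x: "x \<in> carrier S.construction" and l: "l \<in> S.letters"
  shows "x \<otimes>\<^bsub>graded_twist \<chi> S.construction\<^esub> twisted_letter l = \<chi> (letter_degree l) x \<otimes>\<^bsub>S.construction\<^esub> twisted_letter l"
  by (rule act.twist_mult_homog[OF x S.letter_degree_mem[OF l] twisted_letter_homog[OF l]])

lemma twisted_model: "tgw_model K R m \<sigma>' t \<nu> (graded_twist \<chi> S.construction) twisted_letter"
proof -
  note [simp del] = carrier_free_Abelian_group_iff atLeastAtMost_iff One_nat_def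
  let ?C = S.construction and ?tw = "graded_twist \<chi> S.construction"
  note closed = S.M.coeff_closed S.M.gen_closed \<kappa>_closed \<rho>_closed S.t_closed S.sigma_closed
    S.signed_aut_hom(1) T.signed_aut_hom(1) gen_scale_closed Z_pow_mem
  have lc: "twisted_letter l \<in> carrier ?C" if "l \<in> S.letters" for l
    using S.C.homog_closed[OF twisted_letter_homog[OF that]] .
  show ?thesis
  proof
    fix l assume "l \<in> T.letters"
    then show "twisted_letter l \<in> carrier ?tw" using lc by simp
  next
    fix r r' assume r: "r \<in> carrier R" "r' \<in> carrier R"
    show "twisted_letter (Coeff (r \<otimes>\<^bsub>R\<^esub> r')) = twisted_letter (Coeff r) \<otimes>\<^bsub>?tw\<^esub> twisted_letter (Coeff r')"
      using r twist_mult_letter[of "twisted_letter (Coeff r)" "Coeff r'"]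
      by (simp add: lc act.act_zero) (simp add: twisted_letter_simps S.M.coeff_mult)
  next
    fix i s r assume i: "i \<in> {1..m}" and r: "r \<in> carrier R"
    let ?d = "letter_degree (Gen s i :: 'r tgw_letter)"
    note d = degree_mem[OF i, of s]
    have r': "signed_aut K R \<sigma>' s i r \<in> carrier R" using T.signed_aut_hom(1)[OF i r] .
    have "twisted_letter (Gen s i) \<otimes>\<^bsub>?tw\<^esub> twisted_letter (Coeff r) = twisted_letter (Gen s i) \<otimes>\<^bsub>?C\<^esub> S.letter (Coeff r)"
      using i r twist_mult_letter[of "twisted_letter (Gen s i)" "Coeff r"] lc[of "Gen s i"]
      by (simp add: act.act_zero) (simp add: twisted_letter_simps)
    also have "\<dots> = S.letter (Coeff (signed_aut K R \<sigma> s i r)) \<otimes>\<^bsub>?C\<^esub> twisted_letter (Gen s i)"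
      using i r by (simp add: twisted_letter_simps closed S.C.smult_mult_left S.C.smult_mult_right S.M.gen_coeff)
    also have "signed_aut K R \<sigma> s i r = \<rho> ?d (signed_aut K R \<sigma>' s i r)"
      unfolding twisted_aut[OF i r] using \<rho>_inverse(1)[OF d S.signed_aut_hom(1)[OF i r, of s]] by simp
    also have "S.letter (Coeff (\<rho> ?d (signed_aut K R \<sigma>' s i r))) \<otimes>\<^bsub>?C\<^esub> twisted_letter (Gen s i) =
        twisted_letter (Coeff (signed_aut K R \<sigma>' s i r)) \<otimes>\<^bsub>?tw\<^esub> twisted_letter (Gen s i)"
      using twist_mult_letter[OF lc, of "Coeff (signed_aut K R \<sigma>' s i r)" "Gen s i"] i r'
      by (simp add: action_coeff[OF d r'] twisted_letter_simps(1))
    finally show "twisted_letter (Gen s i) \<otimes>\<^bsub>?tw\<^esub> twisted_letter (Coeff r) =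
        twisted_letter (Coeff (signed_aut K R \<sigma>' s i r)) \<otimes>\<^bsub>?tw\<^esub> twisted_letter (Gen s i)" .
  next
    fix i assume i: "i \<in> {1..m}"
    note e = Z_pow_mem(4)[OF i] and e' = Z_pow_mem(2)[OF Z_pow_mem(4)[OF i]]
    let ?a = "\<kappa> (frag_of i) Minus i" and ?b = "\<kappa> (- frag_of i) Minus i" and ?c = "\<kappa> (- frag_of i) Plus i"
    have k: "?a \<in> carrier K" "?b \<in> carrier K" "?c \<in> carrier K" using \<kappa>_closed e e' i by auto
    have scale: "gen_scale Minus i = \<one>\<^bsub>K\<^esub>" "gen_scale Plus i = ?b" by (simp_all add: gen_scale_def)
    have "twisted_letter (Gen Minus i) \<otimes>\<^bsub>?tw\<^esub> twisted_letter (Gen Plus i) =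
        (?a \<odot>\<^bsub>?C\<^esub> S.letter (Gen Minus i)) \<otimes>\<^bsub>?C\<^esub> (?b \<odot>\<^bsub>?C\<^esub> S.letter (Gen Plus i))"
      using twist_mult_letter[OF lc, of "Gen Minus i" "Gen Plus i"] i
      by (simp add: twisted_letter_simps scale closed action_gen[OF e i])
    also have "\<dots> = (?a \<otimes>\<^bsub>K\<^esub> ?b) \<odot>\<^bsub>?C\<^esub> S.letter (Coeff (t i))"
      using i k by (simp add: closed S.C.smult_mult_left S.C.smult_mult_right S.C.smult_assoc1 S.C.smult_lcomm S.M.minus_plus)
    also have "\<dots> = twisted_letter (Coeff (t i))"
      using i \<kappa>_inverse(1)[OF e i] by (simp add: closed twisted_letter_simps)
    finally show "twisted_letter (Gen Minus i) \<otimes>\<^bsub>?tw\<^esub> twisted_letter (Gen Plus i) = twisted_letter (Coeff (t i))" .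
    have "twisted_letter (Gen Plus i) \<otimes>\<^bsub>?tw\<^esub> twisted_letter (Gen Minus i) =
        (?b \<odot>\<^bsub>?C\<^esub> (?c \<odot>\<^bsub>?C\<^esub> S.letter (Gen Plus i))) \<otimes>\<^bsub>?C\<^esub> S.letter (Gen Minus i)"
      using twist_mult_letter[OF lc, of "Gen Plus i" "Gen Minus i"] i k
      by (simp add: twisted_letter_simps scale closed action_gen[OF e' i] act.act_simps(5)[OF e'])
    also have "\<dots> = S.letter (Coeff ((?c \<otimes>\<^bsub>K\<^esub> ?b) \<odot>\<^bsub>R\<^esub> \<sigma> i (t i)))"
      using i k by (simp add: closed S.C.smult_mult_left S.C.smult_assoc1 S.C.smult_lcomm S.M.plus_minus S.M.coeff_smult)
    also have "(?c \<otimes>\<^bsub>K\<^esub> ?b) \<odot>\<^bsub>R\<^esub> \<sigma> i (t i) = \<sigma> i (\<rho> (- frag_of i) (t i))"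
      using i k by (simp add: \<rho>_t[OF e' i] closed alg_homD(5)[OF S.sigma_hom])
    also have "\<dots> = \<sigma>' i (t i)"
      using twisted_aut[OF i S.t_closed[OF i], of Plus] \<rho>_commute[OF e' i S.t_closed[OF i], of Plus] by simp
    finally show "twisted_letter (Gen Plus i) \<otimes>\<^bsub>?tw\<^esub> twisted_letter (Gen Minus i) = twisted_letter (Coeff (\<sigma>' i (t i)))"
      by (simp add: twisted_letter_simps)
  next
    fix i j assume ij: "i \<in> {1..m}" "j \<in> {1..m}" "i \<noteq> j"
    note e = Z_pow_mem(4)[OF ij(1)] and e' = Z_pow_mem(2)[OF Z_pow_mem(4)[OF ij(2)]]
    let ?a = "\<kappa> (frag_of i) Minus j" and ?b = "\<kappa> (- frag_of i) Minus j" and ?c = "\<kappa> (- frag_of j) Plus i"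
      and ?g = "gen_scale Plus i" and ?X = "S.letter (Gen Minus j) \<otimes>\<^bsub>?C\<^esub> S.letter (Gen Plus i)"
    have k: "?a \<in> carrier K" "?b \<in> carrier K" "?c \<in> carrier K" "?g \<in> carrier K" "\<mu> i j \<in> carrier K"
      using ij by (simp_all add: \<kappa>_closed Z_pow_mem gen_scale_closed S.\<mu>_units S.K.Units_closed)
    have scale: "gen_scale Minus j = \<one>\<^bsub>K\<^esub>" by (simp add: gen_scale_def)
    have X: "?X \<in> carrier ?C" using ij by (simp add: closed)
    have "twisted_letter (Gen Plus i) \<otimes>\<^bsub>?tw\<^esub> twisted_letter (Gen Minus j) =
        (?g \<odot>\<^bsub>?C\<^esub> (?c \<odot>\<^bsub>?C\<^esub> S.letter (Gen Plus i))) \<otimes>\<^bsub>?C\<^esub> S.letter (Gen Minus j)"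
      using twist_mult_letter[OF lc, of "Gen Plus i" "Gen Minus j"] ij k
      by (simp add: twisted_letter_simps scale closed action_gen[OF e' ij(1)] act.act_simps(5)[OF e'])
    also have "\<dots> = (?g \<otimes>\<^bsub>K\<^esub> ?c \<otimes>\<^bsub>K\<^esub> \<mu> i j) \<odot>\<^bsub>?C\<^esub> ?X"
      using ij k by (simp add: closed S.C.smult_mult_left S.C.smult_assoc1 S.M.mixed)
    finally have l: "twisted_letter (Gen Plus i) \<otimes>\<^bsub>?tw\<^esub> twisted_letter (Gen Minus j) =
        (?g \<otimes>\<^bsub>K\<^esub> ?c \<otimes>\<^bsub>K\<^esub> \<mu> i j) \<odot>\<^bsub>?C\<^esub> ?X" .
    have "twisted_letter (Gen Minus j) \<otimes>\<^bsub>?tw\<^esub> twisted_letter (Gen Plus i) =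
        (?a \<odot>\<^bsub>?C\<^esub> S.letter (Gen Minus j)) \<otimes>\<^bsub>?C\<^esub> (?g \<odot>\<^bsub>?C\<^esub> S.letter (Gen Plus i))"
      using twist_mult_letter[OF lc, of "Gen Minus j" "Gen Plus i"] ij
      by (simp add: twisted_letter_simps scale closed action_gen[OF e ij(2)])
    also have "\<dots> = (?a \<otimes>\<^bsub>K\<^esub> ?g) \<odot>\<^bsub>?C\<^esub> ?X"
      using ij k by (simp add: closed S.C.smult_mult_left S.C.smult_mult_right S.C.smult_assoc1 S.C.smult_lcomm)
    finally have r: "\<nu> i j \<odot>\<^bsub>?C\<^esub> (twisted_letter (Gen Minus j) \<otimes>\<^bsub>?tw\<^esub> twisted_letter (Gen Plus i)) =
        (\<nu> i j \<otimes>\<^bsub>K\<^esub> (?a \<otimes>\<^bsub>K\<^esub> ?g)) \<odot>\<^bsub>?C\<^esub> ?X"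
      using X k T.\<mu>_units[OF ij] S.K.Units_closed by (simp add: S.C.smult_assoc1)
    have "\<nu> i j \<otimes>\<^bsub>K\<^esub> (?a \<otimes>\<^bsub>K\<^esub> ?g) = (?a \<otimes>\<^bsub>K\<^esub> ?b) \<otimes>\<^bsub>K\<^esub> (?g \<otimes>\<^bsub>K\<^esub> ?c \<otimes>\<^bsub>K\<^esub> \<mu> i j)"
      unfolding twisted_scalar[OF ij] using k by (simp add: S.K.m_ac)
    also have "\<dots> = ?g \<otimes>\<^bsub>K\<^esub> ?c \<otimes>\<^bsub>K\<^esub> \<mu> i j"
      using \<kappa>_inverse(1)[OF e ij(2), of Minus] k by simp
    finally show "twisted_letter (Gen Plus i) \<otimes>\<^bsub>?tw\<^esub> twisted_letter (Gen Minus j) =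
        \<nu> i j \<odot>\<^bsub>?tw\<^esub> (twisted_letter (Gen Minus j) \<otimes>\<^bsub>?tw\<^esub> twisted_letter (Gen Plus i))"
      using l r by simp
  qed (simp_all add: twisted_letter_simps S.M.coeff_one S.M.coeff_add S.M.coeff_smult)
qed

text \<open>That \<open>\<Psi>\<close> carries \<open>\<chi>' \<alpha>\<close> to the inverse of \<open>\<chi> \<alpha>\<close> is needed for composing it with a map into the twist by
  \<open>\<chi>'\<close>.\<close>

lemma twist_hom:
  obtains \<Psi> where "\<Psi> \<in> alg_hom K T.construction (graded_twist \<chi> S.construction)"
    and "graded_map T.construction S.construction \<Psi>"
    and "\<And>l. l \<in> S.letters \<Longrightarrow> \<Psi> (T.letter l) = twisted_letter l"
    and "\<And>\<alpha> x. \<lbrakk>\<alpha> \<in> carrier (Z_pow m); x \<in> carrier T.construction\<rbrakk> \<Longrightarrow> \<Psi> (\<chi>' \<alpha> x) = \<chi> (- \<alpha>) (\<Psi> x)"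
proof -
  note [simp del] = carrier_free_Abelian_group_iff atLeastAtMost_iff One_nat_def
  interpret act': graded_action K T.construction "carrier (Z_pow m)" \<chi>' by (rule action')
  obtain \<Psi> where \<Psi>: "\<Psi> \<in> alg_hom K T.construction (graded_twist \<chi> S.construction)"
    and letter: "\<And>l. l \<in> S.letters \<Longrightarrow> \<Psi> (T.letter l) = twisted_letter l"
    by (rule T.construction_hom[OF twisted_model]) (rule that)
  have "graded_map T.construction (graded_twist \<chi> S.construction) \<Psi>"
    by (rule T.construction_hom_graded[OF tw.graded_alg_axioms \<Psi>]) (simp add: letter twisted_letter_homog)
  then have "graded_map T.construction S.construction \<Psi>" by (simp add: graded_map_def)
  moreover have "\<Psi> (\<chi>' \<alpha> x) = \<chi> (- \<alpha>) (\<Psi> x)"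
    if \<alpha>: "\<alpha> \<in> carrier (Z_pow m)" and x: "x \<in> carrier T.construction" for \<alpha> x
  proof (rule T.construction_hom_unique[OF alg_hom_comp[OF act'.act_hom[OF \<alpha>] \<Psi>]
        alg_hom_comp[OF \<Psi> act.act_hom_twist[OF Z_pow_mem(2)[OF \<alpha>]]] _ x])
    fix l assume l: "l \<in> T.letters"
    note \<alpha>' = Z_pow_mem(2)[OF \<alpha>]
    show "\<Psi> (\<chi>' \<alpha> (T.letter l)) = \<chi> (- \<alpha>) (\<Psi> (T.letter l))"
      using l
    proof (cases rule: T.letters_cases)
      case (1 r)
      then show ?thesis
        using \<alpha> \<alpha>' by (simp add: action'_coeff action_coeff letter \<rho>_closed twisted_letter_simps)
    next
      case (2 s i)
      then show ?thesis
        using \<alpha> \<alpha>' alg_homD(5)[OF \<Psi>, of "\<kappa> (- \<alpha>) s i" "T.letter (Gen s i)"]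
        by (simp add: action'_gen action_gen letter \<kappa>_closed T.M.gen_closed S.M.gen_closed twisted_letter_simps
            act.act_simps(5) gen_scale_closed S.C.smult_lcomm)
    qed
  qed
  ultimately show thesis using that[OF \<Psi> _ letter] by simp
qed

text \<open>A map into a twist is not multiplicative for the original product, but in the composite the two twists
  cancel: for \<open>y\<close> of degree \<open>\<beta>\<close>, the automorphism \<open>\<chi>' \<beta>\<close> introduced by \<open>\<Psi>'\<close> turns into \<open>\<chi> (- \<beta>)\<close> under
  \<open>\<Psi>\<close>. So the composite is an endomorphism of the construction, and it fixes the letters.\<close>

lemma twist_hom_comp:
  assumes \<Psi>: "\<Psi> \<in> alg_hom K T.construction (graded_twist \<chi> S.construction)"
      "\<And>l. l \<in> S.letters \<Longrightarrow> \<Psi> (T.letter l) = twisted_letter l"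
      "\<And>\<alpha> x. \<lbrakk>\<alpha> \<in> carrier (Z_pow m); x \<in> carrier T.construction\<rbrakk> \<Longrightarrow> \<Psi> (\<chi>' \<alpha> x) = \<chi> (- \<alpha>) (\<Psi> x)"
      "graded_map T.construction S.construction \<Psi>"
    and \<Psi>': "\<Psi>' \<in> alg_hom K S.construction (graded_twist \<chi>' T.construction)"
      "graded_map S.construction T.construction \<Psi>'"
      "\<And>r. r \<in> carrier R \<Longrightarrow> \<Psi>' (S.letter (Coeff r)) = T.letter (Coeff r)"
      "\<And>i. i \<in> {1..m} \<Longrightarrow> \<Psi>' (S.letter (Gen Minus i)) = T.letter (Gen Minus i)"
      "\<And>i. i \<in> {1..m} \<Longrightarrow>
        \<Psi>' (S.letter (Gen Plus i)) = \<kappa> (frag_of i) Minus i \<odot>\<^bsub>T.construction\<^esub> T.letter (Gen Plus i)"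
    and x: "x \<in> carrier S.construction"
  shows "\<Psi> (\<Psi>' x) = x"
proof (rule S.construction_hom_unique[OF _ alg_hom_id _ x])
  note [simp del] = carrier_free_Abelian_group_iff atLeastAtMost_iff One_nat_def
  interpret act': graded_action K T.construction "carrier (Z_pow m)" \<chi>' by (rule action')
  note \<Psi>h = alg_homD[OF \<Psi>(1), simplified] and \<Psi>'h = alg_homD[OF \<Psi>'(1), simplified]
  show "(\<lambda>x. \<Psi> (\<Psi>' x)) \<in> alg_hom K S.construction S.construction"
  proof (rule alg_homI)
    fix x y assume x: "x \<in> carrier S.construction" and "y \<in> carrier S.construction"
    from this(2) show "\<Psi> (\<Psi>' (x \<otimes>\<^bsub>S.construction\<^esub> y)) = \<Psi> (\<Psi>' x) \<otimes>\<^bsub>S.construction\<^esub> \<Psi> (\<Psi>' y)"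
    proof (induction rule: act.homog_induct_G)
      case (homog \<beta> y)
      note \<beta> = homog(1) and y = homog(2) and \<beta>' = Z_pow_mem(2)[OF homog(1)]
      have yc: "y \<in> carrier S.construction" using S.C.homog_closed[OF y] .
      have \<Psi>'y: "\<Psi>' y \<in> homog T.construction \<beta>" by (rule graded_mapD[OF \<Psi>'(2) y])
      have \<Psi>\<Psi>'y: "\<Psi> (\<Psi>' y) \<in> homog S.construction \<beta>" by (rule graded_mapD[OF \<Psi>(4) \<Psi>'y])
      let ?x = "\<Psi> (\<Psi>' x)"
      have xc: "\<Psi>' x \<in> carrier T.construction" "?x \<in> carrier S.construction"
        using x \<Psi>'h(1) \<Psi>h(1) by auto
      have x'c: "\<chi>' \<beta> (\<Psi>' x) \<in> carrier T.construction" using act'.act_simps(1)[OF \<beta> xc(1)] .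
      have "\<Psi>' (x \<otimes>\<^bsub>S.construction\<^esub> y) = \<chi>' \<beta> (\<Psi>' x) \<otimes>\<^bsub>T.construction\<^esub> \<Psi>' y"
        using \<Psi>'h(2)[OF x yc] act'.twist_mult_homog[OF xc(1) \<beta> \<Psi>'y] by simp
      then have "\<Psi> (\<Psi>' (x \<otimes>\<^bsub>S.construction\<^esub> y)) =
          \<Psi> (\<chi>' \<beta> (\<Psi>' x)) \<otimes>\<^bsub>graded_twist \<chi> S.construction\<^esub> \<Psi> (\<Psi>' y)"
        using \<Psi>h(2)[OF x'c T.C.homog_closed[OF \<Psi>'y]] by simp
      also have "\<dots> = \<chi> \<beta> (\<Psi> (\<chi>' \<beta> (\<Psi>' x))) \<otimes>\<^bsub>S.construction\<^esub> \<Psi> (\<Psi>' y)"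
        by (rule act.twist_mult_homog[OF \<Psi>h(1)[OF x'c] \<beta> \<Psi>\<Psi>'y])
      also have "\<chi> \<beta> (\<Psi> (\<chi>' \<beta> (\<Psi>' x))) = ?x"
        using \<Psi>(3)[OF \<beta> xc(1)] act.act_inverse(2)[OF \<beta> xc(2)] by simp
      finally show ?case .
    next
      case (add y z)
      then show ?case using x by (simp add: S.C.A.r_distr \<Psi>h(1,3) \<Psi>'h(1,3))
    qed
  qed (use \<Psi>h \<Psi>'h in simp_all)
  fix l assume l: "l \<in> S.letters"
  show "\<Psi> (\<Psi>' (S.letter l)) = S.letter l"
    using l
  proof (cases rule: S.letters_cases)
    case (1 r)
    then show ?thesis by (simp add: \<Psi>' \<Psi>(2) twisted_letter_simps)
  next
    case (2 s i)
    note e = Z_pow_mem(4)[OF 2(2)]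
    show ?thesis
    proof (cases s)
      case Plus
      then have "\<Psi> (\<Psi>' (S.letter l)) =
          (\<kappa> (frag_of i) Minus i \<otimes>\<^bsub>K\<^esub> \<kappa> (- frag_of i) Minus i) \<odot>\<^bsub>S.construction\<^esub> S.letter (Gen Plus i)"
        using 2 e by (simp add: \<Psi>' \<Psi>(2) \<Psi>h \<kappa>_closed Z_pow_mem T.M.gen_closed S.M.gen_closed twisted_letter_simps
            gen_scale_def S.C.smult_assoc1)
      then show ?thesis using 2 Plus \<kappa>_inverse(1)[OF e 2(2), of Minus] by (simp add: S.M.gen_closed)
    next
      case Minus
      then show ?thesis using 2 by (simp add: \<Psi>' \<Psi>(2) twisted_letter_simps gen_scale_def S.M.gen_closed)
    qed
  qed
qed

lemma twist_iso: "graded_alg_iso K (graded_twist \<chi> S.construction) T.construction"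
proof -
  interpret sw: tgw_twist_actions K R m t \<sigma>' \<nu> \<sigma> \<mu> "\<lambda>\<alpha>. \<rho> (- \<alpha>)" "\<lambda>\<alpha>. \<kappa> (- \<alpha>)" \<chi>' \<chi>
    by (rule swap_actions)
  obtain \<Psi> where \<Psi>: "\<Psi> \<in> alg_hom K T.construction (graded_twist \<chi> S.construction)"
      "graded_map T.construction S.construction \<Psi>"
      "\<And>l. l \<in> S.letters \<Longrightarrow> \<Psi> (T.letter l) = twisted_letter l"
      "\<And>\<alpha> x. \<lbrakk>\<alpha> \<in> carrier (Z_pow m); x \<in> carrier T.construction\<rbrakk> \<Longrightarrow> \<Psi> (\<chi>' \<alpha> x) = \<chi> (- \<alpha>) (\<Psi> x)"
    by (rule twist_hom) (rule that)
  obtain \<Psi>' where \<Psi>': "\<Psi>' \<in> alg_hom K S.construction (graded_twist \<chi>' T.construction)"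
      "graded_map S.construction T.construction \<Psi>'"
      "\<And>l. l \<in> S.letters \<Longrightarrow> \<Psi>' (S.letter l) = sw.twisted_letter l"
      "\<And>\<alpha> x. \<lbrakk>\<alpha> \<in> carrier (Z_pow m); x \<in> carrier S.construction\<rbrakk> \<Longrightarrow> \<Psi>' (\<chi> \<alpha> x) = \<chi>' (- \<alpha>) (\<Psi>' x)"
    by (rule sw.twist_hom) (rule that)
  have tl: "twisted_letter (Coeff r) = S.letter (Coeff r)"
      "i \<in> {1..m} \<Longrightarrow> twisted_letter (Gen Minus i) = S.letter (Gen Minus i)"
      "twisted_letter (Gen Plus i) = \<kappa> (- frag_of i) Minus i \<odot>\<^bsub>S.construction\<^esub> S.letter (Gen Plus i)" for r i
    by (simp_all add: twisted_letter_simps gen_scale_def S.M.gen_closed)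
  have tl': "sw.twisted_letter (Coeff r) = T.letter (Coeff r)"
      "i \<in> {1..m} \<Longrightarrow> sw.twisted_letter (Gen Minus i) = T.letter (Gen Minus i)"
      "sw.twisted_letter (Gen Plus i) = \<kappa> (frag_of i) Minus i \<odot>\<^bsub>T.construction\<^esub> T.letter (Gen Plus i)" for r i
    by (simp_all add: sw.twisted_letter_simps sw.gen_scale_def T.M.gen_closed)
  have 1: "\<Psi> (\<Psi>' x) = x" if "x \<in> carrier S.construction" for x
    by (rule twist_hom_comp[OF \<Psi>(1,3,4,2) \<Psi>'(1,2) _ _ _ that]) (simp_all add: \<Psi>'(3) tl')
  have 2: "\<Psi>' (\<Psi> x) = x" if "x \<in> carrier T.construction" for x
    by (rule sw.twist_hom_comp[OF \<Psi>'(1,3,4,2) \<Psi>(1,2) _ _ _ that]) (simp_all add: \<Psi>(3) tl)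
  have "graded_alg_iso K T.construction (graded_twist \<chi> S.construction)"
  proof (rule graded_alg_isoI[OF \<Psi>(1)])
    show "bij_betw \<Psi> (carrier T.construction) (carrier (graded_twist \<chi> S.construction))"
      by (rule bij_betw_byWitness[where f' = \<Psi>'])
        (use 1 2 alg_homD(1)[OF \<Psi>(1)] alg_homD(1)[OF \<Psi>'(1)] in auto)
    show "graded_map T.construction (graded_twist \<chi> S.construction) \<Psi>"
      using \<Psi>(2) by (simp add: graded_map_def)
  qed
  then show ?thesis by (rule graded_alg_iso_sym[OF T.C.graded_alg_axioms tw.graded_alg_axioms])
qed

end

context tgw_twist_pair
begin

lemma construction_twist_iso:
  assumes "graded_action K S.construction (carrier (Z_pow m)) \<chi>"
    and "\<And>\<alpha> r. \<lbrakk>\<alpha> \<in> carrier (Z_pow m); r \<in> carrier R\<rbrakk> \<Longrightarrow>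
      \<chi> \<alpha> (S.letter (Coeff r)) = S.letter (Coeff (\<rho> \<alpha> r))"
    and "\<And>\<alpha> s i. \<lbrakk>\<alpha> \<in> carrier (Z_pow m); i \<in> {1..m}\<rbrakk> \<Longrightarrow>
      \<chi> \<alpha> (S.letter (Gen s i)) = \<kappa> \<alpha> s i \<odot>\<^bsub>S.construction\<^esub> S.letter (Gen s i)"
  shows "graded_alg_iso K (graded_twist \<chi> S.construction) T.construction"
proof -
  interpret sw: tgw_twist_pair K R m t \<sigma>' \<nu> \<sigma> \<mu> "\<lambda>\<alpha>. \<rho> (- \<alpha>)" "\<lambda>\<alpha>. \<kappa> (- \<alpha>)" by (rule swap)
  obtain \<chi>' where \<chi>': "graded_action K T.construction (carrier (Z_pow m)) \<chi>'"
    "\<And>\<alpha> r. \<lbrakk>\<alpha> \<in> carrier (Z_pow m); r \<in> carrier R\<rbrakk> \<Longrightarrow>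
      \<chi>' \<alpha> (T.letter (Coeff r)) = T.letter (Coeff (\<rho> (- \<alpha>) r))"
    "\<And>\<alpha> s i. \<lbrakk>\<alpha> \<in> carrier (Z_pow m); i \<in> {1..m}\<rbrakk> \<Longrightarrow>
      \<chi>' \<alpha> (T.letter (Gen s i)) = \<kappa> (- \<alpha>) s i \<odot>\<^bsub>T.construction\<^esub> T.letter (Gen s i)"
    by (rule sw.compatible_action_exists) (rule that)
  interpret tgw_twist_actions K R m t \<sigma> \<mu> \<sigma>' \<nu> \<rho> \<kappa> \<chi> \<chi>'
    by (intro tgw_twist_actions.intro tgw_twist_pair_axioms tgw_twist_actions_axioms.intro)
      (fact assms \<chi>')+
  show ?thesis by (rule twist_iso)
qed

end

section \<open>Actions on a regular, consistent construction\<close>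

locale tgw_action = tgw_datum K R m \<sigma> t \<mu>
  for K :: "('k, 'z) ring_scheme" and R :: "('k, 'r, 'y) module_scheme" and m :: nat
    and \<sigma> :: "nat \<Rightarrow> 'r \<Rightarrow> 'r" and t :: "nat \<Rightarrow> 'r" and \<mu> :: "nat \<Rightarrow> nat \<Rightarrow> 'k" +
  fixes \<chi> :: "(nat \<Rightarrow>\<^sub>0 int) \<Rightarrow> ('r tgw_letter list \<Rightarrow> 'k) set \<Rightarrow> ('r tgw_letter list \<Rightarrow> 'k) set"
    and q :: "sign \<Rightarrow> sign \<Rightarrow> nat \<Rightarrow> nat \<Rightarrow> 'k"
  assumes regular: "tgwd_regular R m t"
    and coeff_inj: "inj_on (\<lambda>r. letter (Coeff r)) (carrier R)"
    and \<chi>_hom: "\<chi> \<in> hom (Z_pow m) (alg_Aut K construction)"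
    and \<chi>_graded: "\<alpha> \<in> carrier (Z_pow m) \<Longrightarrow> graded_map construction construction (\<chi> \<alpha>)"
    and q_Units: "\<lbrakk>i \<in> {1..m}; j \<in> {1..m}\<rbrakk> \<Longrightarrow> q s s' i j \<in> Units K"
    and \<chi>_plus: "\<lbrakk>i \<in> {1..m}; j \<in> {1..m}\<rbrakk> \<Longrightarrow>
      \<chi> (frag_of i) (letter (Gen s j)) = q Plus s i j \<odot>\<^bsub>construction\<^esub> letter (Gen s j)"
    and \<chi>_minus: "\<lbrakk>i \<in> {1..m}; j \<in> {1..m}\<rbrakk> \<Longrightarrow>
      \<chi> (- frag_of i) (letter (Gen s j)) = q Minus s i j \<odot>\<^bsub>construction\<^esub> letter (Gen s j)"
begin

lemma \<chi>_Aut: "\<alpha> \<in> carrier (Z_pow m) \<Longrightarrow> \<chi> \<alpha> \<in> carrier (alg_Aut K construction)"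
  using \<chi>_hom by (auto simp: hom_def)

lemma graded_action_\<chi>: "graded_action K construction (carrier (Z_pow m)) \<chi>"
proof (intro graded_action.intro C.graded_alg_axioms graded_action_axioms.intro)
  show "0 \<in> carrier (Z_pow m)" by simp
  show "\<alpha> + \<beta> \<in> carrier (Z_pow m)" if "\<alpha> \<in> carrier (Z_pow m)" "\<beta> \<in> carrier (Z_pow m)" for \<alpha> \<beta>
    using that keys_add[of \<alpha> \<beta>] by auto
  show "- \<alpha> \<in> carrier (Z_pow m)" if "\<alpha> \<in> carrier (Z_pow m)" for \<alpha> using that by simp
  show "x = \<zero>\<^bsub>construction\<^esub>" if "\<alpha> \<notin> carrier (Z_pow m)" "x \<in> homog construction \<alpha>" for \<alpha> x
    by (rule homog_outside_Z_pow[OF that])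
  show "\<chi> \<alpha> \<in> alg_hom K construction construction" if "\<alpha> \<in> carrier (Z_pow m)" for \<alpha>
    by (rule alg_Aut_carrierD(1)[OF \<chi>_Aut[OF that]])
  show "graded_map construction construction (\<chi> \<alpha>)" if "\<alpha> \<in> carrier (Z_pow m)" for \<alpha> by (rule \<chi>_graded[OF that])
  show "\<chi> (\<alpha> + \<beta>) x = \<chi> \<alpha> (\<chi> \<beta> x)"
    if "\<alpha> \<in> carrier (Z_pow m)" "\<beta> \<in> carrier (Z_pow m)" "x \<in> carrier construction" for \<alpha> \<beta> x
    using hom_mult[OF \<chi>_hom that(1,2)] alg_Aut_mult[OF \<chi>_Aut[OF that(1)] \<chi>_Aut[OF that(2)]] that(3)
    by (simp add: compose_eq)
  show "\<chi> 0 x = x" if "x \<in> carrier construction" for x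
    using hom_one[OF \<chi>_hom group_free_Abelian_group group_alg_Aut[OF C.assoc_algebra_axioms]] that
    by (simp add: alg_Aut_one)
qed

sublocale act: graded_action K construction "carrier (Z_pow m)" \<chi> by (rule graded_action_\<chi>)

(* Membership in Z_pow m and in the index range is kept in the form of the hypotheses. *)
declare carrier_free_Abelian_group_iff [simp del] atLeastAtMost_iff [simp del] One_nat_def [simp del]

lemma basis_mem: "i \<in> {1..m} \<Longrightarrow> frag_of i \<in> carrier (Z_pow m)"
  by simp

definition \<rho> :: "(nat \<Rightarrow>\<^sub>0 int) \<Rightarrow> 'r \<Rightarrow> 'r"
  where "\<rho> \<alpha> = restrict_to_coeff K R m \<sigma> t \<mu> (\<chi> \<alpha>)"

lemma coeff_eq_iff: "\<lbrakk>r \<in> carrier R; r' \<in> carrier R\<rbrakk> \<Longrightarrow> letter (Coeff r) = letter (Coeff r') \<longleftrightarrow> r = r'"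
  using coeff_inj by (auto simp: inj_on_def)

lemma \<rho>_props:
  assumes "\<alpha> \<in> carrier (Z_pow m)" "r \<in> carrier R"
  shows "\<rho> \<alpha> r \<in> carrier R" "letter (Coeff (\<rho> \<alpha> r)) = \<chi> \<alpha> (letter (Coeff r))"
proof -
  have "letter (Coeff r) \<in> homog construction 0" using letter_homog[of "Coeff r"] assms(2) by simp
  then have "\<chi> \<alpha> (letter (Coeff r)) \<in> (\<lambda>r. letter (Coeff r)) ` carrier R"
    by (intro homog_zero_eq_coeff act.act_homog[OF assms(1)])
  moreover have "\<rho> \<alpha> r = inv_into (carrier R) (\<lambda>r. letter (Coeff r)) (\<chi> \<alpha> (letter (Coeff r)))"
    using assms(2) by (simp add: \<rho>_def restrict_to_coeff_def)
  ultimately show "\<rho> \<alpha> r \<in> carrier R" "letter (Coeff (\<rho> \<alpha> r)) = \<chi> \<alpha> (letter (Coeff r))"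
    using inv_into_into f_inv_into_f[of _ "\<lambda>r. letter (Coeff r)" "carrier R"] by metis+
qed

lemma \<rho>_eqI:
  assumes "\<alpha> \<in> carrier (Z_pow m)" "r \<in> carrier R" "r' \<in> carrier R" "\<chi> \<alpha> (letter (Coeff r)) = letter (Coeff r')"
  shows "\<rho> \<alpha> r = r'"
  using assms \<rho>_props[OF assms(1,2)] coeff_eq_iff by simp

lemma \<rho>_add:
  assumes "\<alpha> \<in> carrier (Z_pow m)" "\<beta> \<in> carrier (Z_pow m)" "r \<in> carrier R"
  shows "\<rho> (\<alpha> + \<beta>) r = \<rho> \<alpha> (\<rho> \<beta> r)"
  by (rule \<rho>_eqI) (use assms in \<open>simp_all add: \<rho>_props act.G_add act.act_add M.coeff_closed\<close>)

lemma \<rho>_zero: "r \<in> carrier R \<Longrightarrow> \<rho> 0 r = r"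
  by (rule \<rho>_eqI) (simp_all add: act.G_zero act.act_zero M.coeff_closed)

lemma \<rho>_hom:
  assumes \<alpha>: "\<alpha> \<in> carrier (Z_pow m)"
  shows "\<rho> \<alpha> \<in> alg_hom K R R"
proof (rule alg_homI)
  note act_simps = act.act_simps[OF \<alpha>] and props = \<rho>_props[OF \<alpha>]
  show "\<rho> \<alpha> \<one>\<^bsub>R\<^esub> = \<one>\<^bsub>R\<^esub>" by (rule \<rho>_eqI[OF \<alpha>]) (simp_all add: M.coeff_one act_simps)
  fix r r' assume r: "r \<in> carrier R" and r': "r' \<in> carrier R"
  show "\<rho> \<alpha> r \<in> carrier R" by (rule props(1)[OF r])
  show "\<rho> \<alpha> (r \<otimes>\<^bsub>R\<^esub> r') = \<rho> \<alpha> r \<otimes>\<^bsub>R\<^esub> \<rho> \<alpha> r'"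
    by (rule \<rho>_eqI[OF \<alpha>]) (use r r' in \<open>simp_all add: props act_simps M.coeff_mult M.coeff_closed\<close>)
  show "\<rho> \<alpha> (r \<oplus>\<^bsub>R\<^esub> r') = \<rho> \<alpha> r \<oplus>\<^bsub>R\<^esub> \<rho> \<alpha> r'"
    by (rule \<rho>_eqI[OF \<alpha>]) (use r r' in \<open>simp_all add: props act_simps M.coeff_add M.coeff_closed\<close>)
  fix c assume "c \<in> carrier K"
  then show "\<rho> \<alpha> (c \<odot>\<^bsub>R\<^esub> r) = c \<odot>\<^bsub>R\<^esub> \<rho> \<alpha> r"
    by (intro \<rho>_eqI[OF \<alpha>]) (use r in \<open>simp_all add: props act_simps M.coeff_smult M.coeff_closed\<close>)
qed

lemma \<rho>_inverse:
  assumes "\<alpha> \<in> carrier (Z_pow m)" "r \<in> carrier R"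
  shows "\<rho> \<alpha> (\<rho> (- \<alpha>) r) = r" "\<rho> (- \<alpha>) (\<rho> \<alpha> r) = r"
  using \<rho>_add[OF assms(1) act.G_uminus[OF assms(1)] assms(2)]
    \<rho>_add[OF act.G_uminus[OF assms(1)] assms] \<rho>_zero[OF assms(2)] by simp_all

lemma \<rho>_Aut:
  assumes \<alpha>: "\<alpha> \<in> carrier (Z_pow m)"
  shows "\<rho> \<alpha> \<in> carrier (alg_Aut K R)"
proof (rule alg_Aut_carrierI[OF \<rho>_hom[OF \<alpha>]])
  show "bij_betw (\<rho> \<alpha>) (carrier R) (carrier R)"
    by (rule bij_betw_byWitness[where f' = "\<rho> (- \<alpha>)"])
      (use \<rho>_inverse[OF \<alpha>] \<rho>_props(1)[OF \<alpha>] \<rho>_props(1)[OF act.G_uminus[OF \<alpha>]] in auto)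
  show "\<rho> \<alpha> \<in> extensional (carrier R)" by (simp add: \<rho>_def restrict_to_coeff_def)
qed

text \<open>The degrees \<open>\<alpha>\<close> for which \<open>\<chi> \<alpha>\<close> multiplies the generator by an invertible scalar form a subgroup, and
  this subgroup contains the standard basis.\<close>

lemma eigenvalue_exists:
  assumes \<alpha>: "\<alpha> \<in> carrier (Z_pow m)" and j: "j \<in> {1..m}"
  shows "\<exists>c\<in>Units K. \<chi> \<alpha> (letter (Gen s j)) = c \<odot>\<^bsub>construction\<^esub> letter (Gen s j)"
proof -
  have keys: "Poly_Mapping.keys \<alpha> \<subseteq> {1..m}" using \<alpha> by (simp add: carrier_free_Abelian_group_iff)
  let ?P = "\<lambda>\<alpha>. \<exists>c\<in>Units K. \<chi> \<alpha> (letter (Gen s j)) = c \<odot>\<^bsub>construction\<^esub> letter (Gen s j)"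
  show ?thesis
  proof (rule free_Abelian_group_induct[OF keys, where P = ?P])
    show "?P 0" by (intro bexI[of _ "\<one>\<^bsub>K\<^esub>"]) (simp_all add: act.act_zero M.gen_closed j)
  next
    fix \<alpha> \<beta> assume 2: "Poly_Mapping.keys \<alpha> \<subseteq> {1..m}" "Poly_Mapping.keys \<beta> \<subseteq> {1..m}" "?P \<alpha>" "?P \<beta>"
    then have mem: "\<alpha> \<in> carrier (Z_pow m)" "\<beta> \<in> carrier (Z_pow m)" by (simp_all add: carrier_free_Abelian_group_iff)
    note mem' = act.G_uminus[OF mem(2)]
    obtain c where c: "c \<in> Units K" "\<chi> \<alpha> (letter (Gen s j)) = c \<odot>\<^bsub>construction\<^esub> letter (Gen s j)"
      using 2 by auto
    obtain e where e: "e \<in> Units K" "\<chi> \<beta> (letter (Gen s j)) = e \<odot>\<^bsub>construction\<^esub> letter (Gen s j)"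
      using 2 by auto
    have X: "letter (Gen s j) \<in> carrier construction" by (rule M.gen_closed[OF j])
    have "e \<odot>\<^bsub>construction\<^esub> \<chi> (- \<beta>) (letter (Gen s j)) = letter (Gen s j)"
      using act.act_inverse(1)[OF mem(2) X] e X K.Units_closed act.act_simps(5)[OF mem'] by simp
    then have "inv\<^bsub>K\<^esub> e \<odot>\<^bsub>construction\<^esub> (e \<odot>\<^bsub>construction\<^esub> \<chi> (- \<beta>) (letter (Gen s j))) =
        inv\<^bsub>K\<^esub> e \<odot>\<^bsub>construction\<^esub> letter (Gen s j)" by simp
    then have i: "\<chi> (- \<beta>) (letter (Gen s j)) = inv\<^bsub>K\<^esub> e \<odot>\<^bsub>construction\<^esub> letter (Gen s j)"
      using e(1) X act.act_simps(1)[OF mem' X] K.Units_closed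
      by (simp add: C.smult_assoc1[symmetric])
    have "\<chi> (\<alpha> - \<beta>) (letter (Gen s j)) = (inv\<^bsub>K\<^esub> e \<otimes>\<^bsub>K\<^esub> c) \<odot>\<^bsub>construction\<^esub> letter (Gen s j)"
      using act.act_add[OF mem(1) mem' X] act.act_simps(5)[OF mem(1)] i c e(1) X K.Units_closed
      by (simp add: C.smult_assoc1)
    then show "?P (\<alpha> - \<beta>)" using c(1) e(1) by blast
  next
    fix i assume "i \<in> {1..m}"
    then show "?P (frag_of i)" using \<chi>_plus[OF _ j] q_Units[OF _ j] by blast
  qed
qed

text \<open>Applying \<open>\<chi> \<alpha>\<close> to \<open>X\<^sup>+\<^sub>i r = \<sigma>\<^sub>i(r) X\<^sup>+\<^sub>i\<close> shows that the difference of the two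
  sides of the claim annihilates \<open>X\<^sup>+\<^sub>i\<close>, hence also \<open>X\<^sup>+\<^sub>i X\<^sup>-\<^sub>i = \<sigma>\<^sub>i(t\<^sub>i)\<close>, which is a regular element. This is where regularity of the datum and injectivity of
  \<open>R \<rightarrow> C\<close> come in.\<close>

lemma \<rho>_commute:
  assumes \<alpha>: "\<alpha> \<in> carrier (Z_pow m)" and i: "i \<in> {1..m}" and r: "r \<in> carrier R"
  shows "\<rho> \<alpha> (\<sigma> i r) = \<sigma> i (\<rho> \<alpha> r)"
proof -
  let ?C = construction and ?X = "letter (Gen Plus i)" and ?Y = "letter (Gen Minus i)"
  let ?a = "\<rho> \<alpha> (\<sigma> i r)" and ?b = "\<sigma> i (\<rho> \<alpha> r)" and ?s = "\<sigma> i (t i)"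
  obtain c where c: "c \<in> Units K" "\<chi> \<alpha> ?X = c \<odot>\<^bsub>?C\<^esub> ?X" using eigenvalue_exists[OF \<alpha> i] by blast
  note cc = K.Units_closed[OF c(1)]
  have closed: "?X \<in> carrier ?C" "?Y \<in> carrier ?C" "?a \<in> carrier R" "?b \<in> carrier R" "?s \<in> carrier R"
    using \<alpha> i r by (simp_all add: M.gen_closed \<rho>_props sigma_closed t_closed)
  have "\<chi> \<alpha> (?X \<otimes>\<^bsub>?C\<^esub> letter (Coeff r)) = \<chi> \<alpha> (letter (Coeff (\<sigma> i r)) \<otimes>\<^bsub>?C\<^esub> ?X)"
    using M.gen_coeff[OF i r, of Plus] by simp
  then have "(c \<odot>\<^bsub>?C\<^esub> ?X) \<otimes>\<^bsub>?C\<^esub> letter (Coeff (\<rho> \<alpha> r)) = letter (Coeff ?a) \<otimes>\<^bsub>?C\<^esub> (c \<odot>\<^bsub>?C\<^esub> ?X)"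
    using \<alpha> i r closed c(2) by (simp add: act.act_simps(2) M.coeff_closed sigma_closed \<rho>_props(2))
  then have "c \<odot>\<^bsub>?C\<^esub> (letter (Coeff ?b) \<otimes>\<^bsub>?C\<^esub> ?X) = c \<odot>\<^bsub>?C\<^esub> (letter (Coeff ?a) \<otimes>\<^bsub>?C\<^esub> ?X)"
    using M.gen_coeff[OF i \<rho>_props(1)[OF \<alpha> r], of Plus] closed cc \<alpha> r
    by (simp add: C.smult_mult_left C.smult_mult_right M.coeff_closed \<rho>_props(1))
  then have eq: "letter (Coeff ?b) \<otimes>\<^bsub>?C\<^esub> ?X = letter (Coeff ?a) \<otimes>\<^bsub>?C\<^esub> ?X"
    using C.Units_smult_cancel[OF c(1)] closed by (simp add: M.coeff_closed)
  \<comment> \<open>Multiplying by \<open>X\<^sup>-\<^sub>i\<close> on the right turns this into an equation between coefficients.\<close>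
  have prod: "letter (Coeff (x \<otimes>\<^bsub>R\<^esub> ?s)) = (letter (Coeff x) \<otimes>\<^bsub>?C\<^esub> ?X) \<otimes>\<^bsub>?C\<^esub> ?Y" if "x \<in> carrier R" for x
    using that closed M.plus_minus[OF i] by (simp add: M.coeff_mult C.A.m_assoc M.coeff_closed)
  have "?a \<otimes>\<^bsub>R\<^esub> ?s = ?b \<otimes>\<^bsub>R\<^esub> ?s"
    using prod[OF closed(3)] prod[OF closed(4)] eq closed coeff_eq_iff[of "?a \<otimes>\<^bsub>R\<^esub> ?s" "?b \<otimes>\<^bsub>R\<^esub> ?s"] by simp
  then have z: "(?a \<ominus>\<^bsub>R\<^esub> ?b) \<otimes>\<^bsub>R\<^esub> ?s = \<zero>\<^bsub>R\<^esub>"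
    using closed by (simp add: a_minus_def R.A.l_distr R.A.l_minus R.M.r_neg)
  let ?\<tau> = "signed_aut K R \<sigma> Minus i" and ?d = "?a \<ominus>\<^bsub>R\<^esub> ?b"
  have d: "?d \<in> carrier R" using closed by simp
  have "?\<tau> ?d \<otimes>\<^bsub>R\<^esub> t i = ?\<tau> (?d \<otimes>\<^bsub>R\<^esub> ?s)"
    using signed_aut_hom(2)[OF i d closed(5), of Minus] signed_aut_inverse[OF i t_closed[OF i], of Plus] by simp
  also have "\<dots> = \<zero>\<^bsub>R\<^esub>"
    using z alg_hom_zero_minus(1)[OF alg_Aut_carrierD(1)[OF signed_aut_mem[OF i, of Minus]]
        R.assoc_algebra_axioms R.assoc_algebra_axioms] by simp
  finally have "?\<tau> ?d = \<zero>\<^bsub>R\<^esub>"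
    using regular i signed_aut_hom(1)[OF i d, of Minus] unfolding tgwd_regular_def regular_element_def by blast
  then have "?d = \<zero>\<^bsub>R\<^esub>"
    using signed_aut_inverse[OF i d, of Minus]
      alg_hom_zero_minus(1)[OF sigma_hom[OF i] R.assoc_algebra_axioms R.assoc_algebra_axioms] by simp
  then show ?thesis using R.M.diff_eq_zeroD[OF closed(3,4)] by blast
qed

lemma \<rho>_commute_signed:
  assumes \<alpha>: "\<alpha> \<in> carrier (Z_pow m)" and i: "i \<in> {1..m}" and r: "r \<in> carrier R"
  shows "\<rho> \<alpha> (signed_aut K R \<sigma> s i r) = signed_aut K R \<sigma> s i (\<rho> \<alpha> r)"
proof (cases s)
  case Plus
  then show ?thesis using \<rho>_commute[OF assms] by simp
next
  case Minus
  let ?\<tau> = "signed_aut K R \<sigma> Minus i"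
  have r': "?\<tau> r \<in> carrier R" by (rule signed_aut_hom(1)[OF i r])
  have "?\<tau> (\<rho> \<alpha> r) = ?\<tau> (\<rho> \<alpha> (\<sigma> i (?\<tau> r)))" using signed_aut_inverse[OF i r, of Minus] by simp
  also have "\<dots> = ?\<tau> (\<sigma> i (\<rho> \<alpha> (?\<tau> r)))" using \<rho>_commute[OF \<alpha> i r'] by simp
  also have "\<dots> = \<rho> \<alpha> (?\<tau> r)" using signed_aut_inverse[OF i \<rho>_props(1)[OF \<alpha> r'], of Plus] by simp
  finally show ?thesis using Minus by simp
qed

abbreviation \<sigma>' :: "nat \<Rightarrow> 'r \<Rightarrow> 'r"
  where "\<sigma>' \<equiv> twisted_sigma K R m \<sigma> t \<mu> \<chi>"

lemma twisted_sigma_Aut: "i \<in> {1..m} \<Longrightarrow> \<sigma>' i \<in> carrier (alg_Aut K R)"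
proof -
  interpret G: group "alg_Aut K R" by (rule group_alg_Aut[OF R.assoc_algebra_axioms])
  show "i \<in> {1..m} \<Longrightarrow> \<sigma>' i \<in> carrier (alg_Aut K R)"
    unfolding twisted_sigma_def \<rho>_def[symmetric] by (intro G.m_closed G.inv_closed \<rho>_Aut basis_mem sigma_aut)
qed

lemma twisted_sigma_apply:
  assumes i: "i \<in> {1..m}" and r: "r \<in> carrier R"
  shows "\<sigma>' i r = \<rho> (- frag_of i) (\<sigma> i r)"
proof -
  interpret G: group "alg_Aut K R" by (rule group_alg_Aut[OF R.assoc_algebra_axioms])
  note \<rho>i = \<rho>_Aut[OF basis_mem[OF i]]
  have s: "\<sigma> i r \<in> carrier R" by (rule sigma_closed[OF i r])
  have "\<sigma>' i r = (inv\<^bsub>alg_Aut K R\<^esub> \<rho> (frag_of i)) (\<sigma> i r)"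
    unfolding twisted_sigma_def \<rho>_def[symmetric] alg_Aut_mult[OF G.inv_closed[OF \<rho>i] sigma_aut[OF i]]
    using r by (simp add: compose_eq)
  also have "\<dots> = (inv\<^bsub>alg_Aut K R\<^esub> \<rho> (frag_of i)) (\<rho> (frag_of i) (\<rho> (- frag_of i) (\<sigma> i r)))"
    using \<rho>_inverse(1)[OF basis_mem[OF i] s] by simp
  also have "\<dots> = \<rho> (- frag_of i) (\<sigma> i r)"
    by (rule alg_Aut_inv(2)[OF R.assoc_algebra_axioms \<rho>i \<rho>_props(1)[OF act.G_uminus[OF basis_mem[OF i]] s]])
  finally show ?thesis .
qed

lemma twisted_datum: "tgwd K R m \<sigma>' t"
proof -
  have "\<sigma>' i \<otimes>\<^bsub>alg_Aut K R\<^esub> \<sigma>' j = \<sigma>' j \<otimes>\<^bsub>alg_Aut K R\<^esub> \<sigma>' i" if i: "i \<in> {1..m}" and j: "j \<in> {1..m}" for i j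
  proof -
    interpret G: group "alg_Aut K R" by (rule group_alg_Aut[OF R.assoc_algebra_axioms])
    note a = twisted_sigma_Aut[OF i] and b = twisted_sigma_Aut[OF j]
    have comm: "\<sigma> i (\<sigma> j r) = \<sigma> j (\<sigma> i r)" if "r \<in> carrier R" for r
    proof -
      have "\<sigma> i \<otimes>\<^bsub>alg_Aut K R\<^esub> \<sigma> j = \<sigma> j \<otimes>\<^bsub>alg_Aut K R\<^esub> \<sigma> i" using datum i j by (simp add: tgwd_def)
      then have "compose (carrier R) (\<sigma> i) (\<sigma> j) r = compose (carrier R) (\<sigma> j) (\<sigma> i) r"
        by (simp add: alg_Aut_mult[OF sigma_aut[OF i] sigma_aut[OF j]] alg_Aut_mult[OF sigma_aut[OF j] sigma_aut[OF i]])
      then show ?thesis using that by (simp add: compose_eq)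
    qed
    show ?thesis
    proof (rule alg_Aut_eqI[OF G.m_closed[OF a b] G.m_closed[OF b a]])
      fix r assume r: "r \<in> carrier R"
      note ij = act.G_uminus[OF basis_mem[OF i]] act.G_uminus[OF basis_mem[OF j]]
      have twice: "\<sigma>' k (\<sigma>' l r) = \<rho> (- frag_of k + - frag_of l) (\<sigma> k (\<sigma> l r))"
        if k: "k \<in> {1..m}" and l: "l \<in> {1..m}" for k l
      proof -
        note kl = act.G_uminus[OF basis_mem[OF k]] act.G_uminus[OF basis_mem[OF l]]
        have "\<sigma>' k (\<sigma>' l r) = \<rho> (- frag_of k) (\<sigma> k (\<rho> (- frag_of l) (\<sigma> l r)))"
          using k l r kl by (simp add: twisted_sigma_apply sigma_closed \<rho>_props(1))
        also have "\<sigma> k (\<rho> (- frag_of l) (\<sigma> l r)) = \<rho> (- frag_of l) (\<sigma> k (\<sigma> l r))"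
          using \<rho>_commute[OF kl(2) k sigma_closed[OF l r]] by simp
        finally show ?thesis using \<rho>_add[OF kl] k l r by (simp add: sigma_closed)
      qed
      show "(\<sigma>' i \<otimes>\<^bsub>alg_Aut K R\<^esub> \<sigma>' j) r = (\<sigma>' j \<otimes>\<^bsub>alg_Aut K R\<^esub> \<sigma>' i) r"
        using r twice[OF i j] twice[OF j i] comm[OF r]
        by (simp add: alg_Aut_mult[OF a b] alg_Aut_mult[OF b a] compose_eq add.commute)
    qed
  qed
  then show ?thesis using datum twisted_sigma_Aut by (simp add: tgwd_def)
qed

text \<open>Let \<open>\<rho>\<^sub>i = \<rho> (frag_of i)\<close>. For the negative sign the inverse of \<open>\<sigma>' i = \<rho>\<^sub>i\<^sup>-\<^sup>1 \<sigma>\<^sub>i\<close> is \<open>\<sigma>\<^sub>i\<^sup>-\<^sup>1 \<rho>\<^sub>i\<close>, while the twisted product produces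
  \<open>\<rho>\<^sub>i \<sigma>\<^sub>i\<^sup>-\<^sup>1\<close>; the two agree because the factors commute.\<close>

lemma twisted_sigma_signed:
  assumes i: "i \<in> {1..m}" and r: "r \<in> carrier R"
  shows "signed_aut K R \<sigma>' s i r = \<rho> (- letter_degree (Gen s i :: 'r tgw_letter)) (signed_aut K R \<sigma> s i r)"
proof (cases s)
  case Plus
  then show ?thesis using twisted_sigma_apply[OF assms] by simp
next
  case Minus
  let ?\<tau> = "signed_aut K R \<sigma> Minus i"
  note e = basis_mem[OF i]
  have \<tau>: "?\<tau> r \<in> carrier R" by (rule signed_aut_hom(1)[OF i r])
  have x: "\<rho> (frag_of i) (?\<tau> r) \<in> carrier R" by (rule \<rho>_props(1)[OF e \<tau>])
  have "\<sigma>' i (\<rho> (frag_of i) (?\<tau> r)) = \<rho> (- frag_of i) (\<rho> (frag_of i) (\<sigma> i (?\<tau> r)))"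
    using twisted_sigma_apply[OF i x] \<rho>_commute[OF e i \<tau>] by simp
  also have "\<dots> = r" using \<rho>_inverse(2)[OF e] signed_aut_inverse[OF i r, of Minus] r by simp
  finally have "(inv\<^bsub>alg_Aut K R\<^esub> (\<sigma>' i)) r = \<rho> (frag_of i) (?\<tau> r)"
    using alg_Aut_inv(2)[OF R.assoc_algebra_axioms twisted_sigma_Aut[OF i] x] by simp
  then show ?thesis using Minus by simp
qed

text \<open>If \<open>R\<close> is nonzero then the generators are nonzero, so the scalars are determined by the action and
  depend multiplicatively on the group element.\<close>

lemma letter_gen_nonzero:
  assumes nz: "\<one>\<^bsub>R\<^esub> \<noteq> \<zero>\<^bsub>R\<^esub>" and i: "i \<in> {1..m}"
  shows "letter (Gen s i) \<noteq> \<zero>\<^bsub>construction\<^esub>"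
proof
  assume z: "letter (Gen s i) = \<zero>\<^bsub>construction\<^esub>"
  have "letter (Gen Minus i) \<otimes>\<^bsub>construction\<^esub> letter (Gen Plus i) = \<zero>\<^bsub>construction\<^esub>"
    using z i M.gen_closed by (cases s) simp_all
  then have "letter (Coeff (t i)) = letter (Coeff \<zero>\<^bsub>R\<^esub>)"
    using M.minus_plus[OF i] alg_hom_zero_minus(1)[OF M.coeff_hom R.assoc_algebra_axioms C.assoc_algebra_axioms]
    by simp
  then have "t i = \<zero>\<^bsub>R\<^esub>" using coeff_eq_iff t_closed[OF i] by simp
  moreover have "t i \<otimes>\<^bsub>R\<^esub> \<one>\<^bsub>R\<^esub> = \<zero>\<^bsub>R\<^esub> \<longrightarrow> \<one>\<^bsub>R\<^esub> = \<zero>\<^bsub>R\<^esub>"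
    using regular i R.A.one_closed unfolding tgwd_regular_def regular_element_def by blast
  ultimately show False using nz by simp
qed

lemma smult_unique:
  assumes "c \<in> carrier K" "e \<in> carrier K" "x \<in> carrier construction" "x \<noteq> \<zero>\<^bsub>construction\<^esub>"
    "c \<odot>\<^bsub>construction\<^esub> x = e \<odot>\<^bsub>construction\<^esub> x"
  shows "c = e"
proof (rule ccontr)
  assume "c \<noteq> e"
  then have u: "c \<ominus>\<^bsub>K\<^esub> e \<in> Units K"
    using assms(1,2) K.field_Units K.diff_eq_zeroD by auto
  have "(c \<ominus>\<^bsub>K\<^esub> e) \<odot>\<^bsub>construction\<^esub> x = \<zero>\<^bsub>construction\<^esub>"
    using assms by (simp add: a_minus_def C.smult_l_distr C.smult_l_minus C.M.r_neg)
  also have "\<dots> = (c \<ominus>\<^bsub>K\<^esub> e) \<odot>\<^bsub>construction\<^esub> \<zero>\<^bsub>construction\<^esub>"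
    using u K.Units_closed by (simp add: C.smult_r_null)
  finally show False using C.Units_smult_cancel[OF u assms(3) C.M.zero_closed] assms(4) by blast
qed

definition \<kappa> :: "(nat \<Rightarrow>\<^sub>0 int) \<Rightarrow> sign \<Rightarrow> nat \<Rightarrow> 'k"
  where "\<kappa> \<alpha> s i = (SOME c. c \<in> Units K \<and> \<chi> \<alpha> (letter (Gen s i)) = c \<odot>\<^bsub>construction\<^esub> letter (Gen s i))"

lemma \<kappa>_props:
  assumes "\<alpha> \<in> carrier (Z_pow m)" "i \<in> {1..m}"
  shows "\<kappa> \<alpha> s i \<in> Units K" "\<kappa> \<alpha> s i \<in> carrier K"
    "\<chi> \<alpha> (letter (Gen s i)) = \<kappa> \<alpha> s i \<odot>\<^bsub>construction\<^esub> letter (Gen s i)"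
proof -
  have "\<kappa> \<alpha> s i \<in> Units K \<and> \<chi> \<alpha> (letter (Gen s i)) = \<kappa> \<alpha> s i \<odot>\<^bsub>construction\<^esub> letter (Gen s i)"
    unfolding \<kappa>_def by (rule someI_ex) (use eigenvalue_exists[OF assms] in blast)
  then show "\<kappa> \<alpha> s i \<in> Units K" "\<kappa> \<alpha> s i \<in> carrier K"
    "\<chi> \<alpha> (letter (Gen s i)) = \<kappa> \<alpha> s i \<odot>\<^bsub>construction\<^esub> letter (Gen s i)" using K.Units_closed by auto
qed

lemma twist_pair:
  assumes nz: "\<one>\<^bsub>R\<^esub> \<noteq> \<zero>\<^bsub>R\<^esub>" 
    and \<nu>_units: "\<And>i j. \<lbrakk>i \<in> {1..m}; j \<in> {1..m}; i \<noteq> j\<rbrakk> \<Longrightarrow> \<nu> i j \<in> Units K"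
    and \<nu>: "\<And>i j. \<lbrakk>i \<in> {1..m}; j \<in> {1..m}; i \<noteq> j\<rbrakk> \<Longrightarrow>
      \<nu> i j = \<mu> i j \<otimes>\<^bsub>K\<^esub> q Minus Plus j i \<otimes>\<^bsub>K\<^esub> q Minus Minus i j"
  shows "tgw_twist_pair K R m t \<sigma> \<mu> \<sigma>' \<nu> \<rho> \<kappa>"
proof -
  have \<kappa>_eqI: "\<kappa> \<alpha> s i = c"
    if "\<alpha> \<in> carrier (Z_pow m)" "i \<in> {1..m}" "c \<in> carrier K"
      "\<chi> \<alpha> (letter (Gen s i)) = c \<odot>\<^bsub>construction\<^esub> letter (Gen s i)" for \<alpha> s i c
    using smult_unique[OF \<kappa>_props(2)[OF that(1,2)] that(3) M.gen_closed[OF that(2)] letter_gen_nonzero[OF nz that(2)]]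
      \<kappa>_props(3)[OF that(1,2)] that(4) by metis
  show ?thesis
  proof (intro tgw_twist_pair.intro tgw_twist_pair_axioms.intro)
    show "tgw_datum K R m \<sigma> t \<mu>" by (rule tgw_datum_axioms)
    show "tgw_datum K R m \<sigma>' t \<nu>" using field twisted_datum \<nu>_units by (simp add: tgw_datum_def)
    show "\<rho> \<alpha> \<in> alg_hom K R R" if "\<alpha> \<in> carrier (Z_pow m)" for \<alpha> by (rule \<rho>_hom[OF that])
    show "\<rho> (\<alpha> + \<beta>) r = \<rho> \<alpha> (\<rho> \<beta> r)"
      if "\<alpha> \<in> carrier (Z_pow m)" "\<beta> \<in> carrier (Z_pow m)" "r \<in> carrier R" for \<alpha> \<beta> r by (rule \<rho>_add[OF that])
    show "\<rho> 0 r = r" if "r \<in> carrier R" for r by (rule \<rho>_zero[OF that])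
    show "\<kappa> \<alpha> s i \<in> Units K" if "\<alpha> \<in> carrier (Z_pow m)" "i \<in> {1..m}" for \<alpha> s i by (rule \<kappa>_props(1)[OF that])
    show "\<kappa> (\<alpha> + \<beta>) s i = \<kappa> \<alpha> s i \<otimes>\<^bsub>K\<^esub> \<kappa> \<beta> s i"
      if "\<alpha> \<in> carrier (Z_pow m)" "\<beta> \<in> carrier (Z_pow m)" "i \<in> {1..m}" for \<alpha> \<beta> s i
    proof (rule \<kappa>_eqI[OF act.G_add[OF that(1,2)] that(3)])
      show "\<kappa> \<alpha> s i \<otimes>\<^bsub>K\<^esub> \<kappa> \<beta> s i \<in> carrier K" using that by (simp add: \<kappa>_props)
      have "\<chi> (\<alpha> + \<beta>) (letter (Gen s i)) = \<chi> \<alpha> (\<chi> \<beta> (letter (Gen s i)))"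
        by (rule act.act_add[OF that(1,2) M.gen_closed[OF that(3)]])
      then show "\<chi> (\<alpha> + \<beta>) (letter (Gen s i)) = (\<kappa> \<alpha> s i \<otimes>\<^bsub>K\<^esub> \<kappa> \<beta> s i) \<odot>\<^bsub>construction\<^esub> letter (Gen s i)"
        using that by (simp add: M.gen_closed \<kappa>_props act.act_simps(5) C.smult_assoc1 C.smult_lcomm)
    qed
    show "\<rho> \<alpha> (signed_aut K R \<sigma> s i r) = signed_aut K R \<sigma> s i (\<rho> \<alpha> r)"
      if "\<alpha> \<in> carrier (Z_pow m)" "i \<in> {1..m}" "r \<in> carrier R" for \<alpha> s i r
      by (rule \<rho>_commute_signed[OF that])
    show "\<rho> \<alpha> (t i) = (\<kappa> \<alpha> Plus i \<otimes>\<^bsub>K\<^esub> \<kappa> \<alpha> Minus i) \<odot>\<^bsub>R\<^esub> t i"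
      if "\<alpha> \<in> carrier (Z_pow m)" "i \<in> {1..m}" for \<alpha> i
    proof (rule \<rho>_eqI[OF that(1) t_closed[OF that(2)]])
      show "(\<kappa> \<alpha> Plus i \<otimes>\<^bsub>K\<^esub> \<kappa> \<alpha> Minus i) \<odot>\<^bsub>R\<^esub> t i \<in> carrier R"
        using that by (simp add: \<kappa>_props t_closed)
      have "\<chi> \<alpha> (letter (Coeff (t i))) = (\<kappa> \<alpha> Minus i \<odot>\<^bsub>construction\<^esub> letter (Gen Minus i)) \<otimes>\<^bsub>construction\<^esub>
          (\<kappa> \<alpha> Plus i \<odot>\<^bsub>construction\<^esub> letter (Gen Plus i))"
        using that by (simp add: M.minus_plus[symmetric] act.act_simps(2) M.gen_closed \<kappa>_props)
      also have "\<dots> = letter (Coeff ((\<kappa> \<alpha> Plus i \<otimes>\<^bsub>K\<^esub> \<kappa> \<alpha> Minus i) \<odot>\<^bsub>R\<^esub> t i))"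
        using that by (simp add: C.smult_mult_left C.smult_mult_right M.gen_closed \<kappa>_props M.minus_plus
            M.coeff_smult t_closed C.smult_assoc1 C.smult_lcomm M.coeff_closed)
      finally show "\<chi> \<alpha> (letter (Coeff (t i))) = letter (Coeff ((\<kappa> \<alpha> Plus i \<otimes>\<^bsub>K\<^esub> \<kappa> \<alpha> Minus i) \<odot>\<^bsub>R\<^esub> t i))" .
    qed
    show "signed_aut K R \<sigma>' s i r = \<rho> (- letter_degree (Gen s i :: 'r tgw_letter)) (signed_aut K R \<sigma> s i r)"
      if "i \<in> {1..m}" "r \<in> carrier R" for s i r by (rule twisted_sigma_signed[OF that])
    show "\<nu> i j = \<mu> i j \<otimes>\<^bsub>K\<^esub> \<kappa> (- frag_of j) Plus i \<otimes>\<^bsub>K\<^esub> \<kappa> (- frag_of i) Minus j"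
      if ij: "i \<in> {1..m}" "j \<in> {1..m}" "i \<noteq> j" for i j
    proof -
      have "\<kappa> (- frag_of j) Plus i = q Minus Plus j i"
        by (rule \<kappa>_eqI) (use ij \<chi>_minus q_Units K.Units_closed act.G_uminus basis_mem in auto)
      moreover have "\<kappa> (- frag_of i) Minus j = q Minus Minus i j"
        by (rule \<kappa>_eqI) (use ij \<chi>_minus q_Units K.Units_closed act.G_uminus basis_mem in auto)
      ultimately show ?thesis using \<nu>[OF ij] by simp
    qed
  qed
qed

lemma construction_trivial:
  assumes "\<one>\<^bsub>R\<^esub> = \<zero>\<^bsub>R\<^esub>"
  shows "carrier construction = {\<zero>\<^bsub>construction\<^esub>}"
proof -
  have "\<one>\<^bsub>construction\<^esub> = \<zero>\<^bsub>construction\<^esub>"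
    using M.coeff_one alg_hom_zero_minus(1)[OF M.coeff_hom R.assoc_algebra_axioms C.assoc_algebra_axioms] assms
    by simp
  then show ?thesis using C.A.one_zeroD by simp
qed

lemma twist_iso_construction:
  assumes \<nu>_units: "\<And>i j. \<lbrakk>i \<in> {1..m}; j \<in> {1..m}; i \<noteq> j\<rbrakk> \<Longrightarrow> \<nu> i j \<in> Units K"
    and \<nu>: "\<And>i j. \<lbrakk>i \<in> {1..m}; j \<in> {1..m}; i \<noteq> j\<rbrakk> \<Longrightarrow>
      \<nu> i j = \<mu> i j \<otimes>\<^bsub>K\<^esub> q Minus Plus j i \<otimes>\<^bsub>K\<^esub> q Minus Minus i j"
  shows "graded_alg_iso K (graded_twist \<chi> construction) (tgwc K R m \<sigma>' t \<nu>)"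
proof (cases "\<one>\<^bsub>R\<^esub> = \<zero>\<^bsub>R\<^esub>")
  case True
  (* The generators may vanish here, and then the action does not determine the scalars. *)
  interpret T: tgw_datum K R m \<sigma>' t \<nu> using field twisted_datum \<nu>_units by (simp add: tgw_datum_def)
  have "\<one>\<^bsub>T.construction\<^esub> = \<zero>\<^bsub>T.construction\<^esub>"
    using T.M.coeff_one alg_hom_zero_minus(1)[OF T.M.coeff_hom R.assoc_algebra_axioms T.C.assoc_algebra_axioms] True
    by simp
  then have "carrier T.construction = {\<zero>\<^bsub>T.construction\<^esub>}" using T.C.A.one_zeroD by simp
  then show ?thesis
    using construction_trivial[OF True] by (intro graded_alg_iso_zero act.graded_alg_twist T.C.graded_alg_axioms) simp_all
next
  case False
  interpret P: tgw_twist_pair K R m t \<sigma> \<mu> \<sigma>' \<nu> \<rho> \<kappa> by (rule twist_pair[OF False \<nu>_units \<nu>])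
  show ?thesis
    by (rule P.construction_twist_iso[OF graded_action_\<chi>]) (simp_all add: \<rho>_props \<kappa>_props)
qed

end

section \<open>Graded twists of twisted generalized Weyl algebras\<close>

theorem theorem4p4:
  fixes K :: "('k, 'x) ring_scheme"
    and R :: "('k, 'r, 'y) module_scheme"
    and m :: nat
    and \<sigma> :: "nat \<Rightarrow> 'r \<Rightarrow> 'r"
    and t :: "nat \<Rightarrow> 'r"
    and \<mu> :: "nat \<Rightarrow> nat \<Rightarrow> 'k"
    and C :: "('k, nat \<Rightarrow>\<^sub>0 int, ('r tgw_letter list \<Rightarrow> 'k) set) graded_algebra"
    and A :: "('k, nat \<Rightarrow>\<^sub>0 int, ('r tgw_letter list \<Rightarrow> 'k) set set) graded_algebra"
    and \<J> :: "('r tgw_letter list \<Rightarrow> 'k) set set"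
    and X :: "sign \<Rightarrow> nat \<Rightarrow> ('r tgw_letter list \<Rightarrow> 'k) set"
    and \<chi> :: "(nat \<Rightarrow>\<^sub>0 int) \<Rightarrow> ('r tgw_letter list \<Rightarrow> 'k) set \<Rightarrow> ('r tgw_letter list \<Rightarrow> 'k) set"
    and q :: "sign \<Rightarrow> sign \<Rightarrow> nat \<Rightarrow> nat \<Rightarrow> 'k"
    and \<sigma>' :: "nat \<Rightarrow> 'r \<Rightarrow> 'r"
  assumes field: "field K"
    and datum: "tgwd K R m \<sigma> t"
    and \<mu>_units: "\<forall>i\<in>{1..m}. \<forall>j\<in>{1..m}. \<mu> i j \<in> Units K"
    and regular: "tgwd_regular R m t"
    and consistent: "tgwd_consistent K R m \<sigma> t \<mu>"
    and C: "C = tgwc K R m \<sigma> t \<mu>"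
    and X: "X = tgwc_gen K R m \<sigma> t \<mu>"
    and J: "\<J> = canonical_ideal C"
    and A: "A = graded_quot C \<J>"
    and \<chi>_hom: "\<chi> \<in> hom (Z_pow m) (alg_Aut K C)"
    and \<chi>_graded: "\<forall>\<alpha>\<in>carrier (Z_pow m). graded_map C C (\<chi> \<alpha>)"
    and q_units: "\<forall>s s'. \<forall>i\<in>{1..m}. \<forall>j\<in>{1..m}. q s s' i j \<in> Units K"
    and \<chi>_plus: "\<forall>i\<in>{1..m}. \<forall>j\<in>{1..m}. \<forall>s. \<chi> (frag_of i) (X s j) = q Plus s i j \<odot>\<^bsub>C\<^esub> X s j"
    and \<chi>_minus: "\<forall>i\<in>{1..m}. \<forall>j\<in>{1..m}. \<forall>s. \<chi> (- frag_of i) (X s j) = q Minus s i j \<odot>\<^bsub>C\<^esub> X s j"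
    and \<sigma>': "\<sigma>' = twisted_sigma K R m \<sigma> t \<mu> \<chi>"
  shows
    "(\<forall>\<nu>. (\<forall>i\<in>{1..m}. \<forall>j\<in>{1..m}. \<nu> i j \<in> Units K) \<and>
          (\<forall>i\<in>{1..m}. \<forall>j\<in>{1..m}. i \<noteq> j \<longrightarrow>
             \<nu> i j = \<mu> i j \<otimes>\<^bsub>K\<^esub> q Minus Plus j i \<otimes>\<^bsub>K\<^esub> q Minus Minus i j) \<longrightarrow>
          tgwd K R m \<sigma>' t \<and>
          graded_alg_iso K (graded_twist \<chi> C) (tgwc K R m \<sigma>' t \<nu>))
     \<and> \<J> = canonical_ideal (graded_twist \<chi> C)
     \<and> graded_alg_iso K (graded_twist (induced_action C \<J> \<chi>) A)
         (graded_quot (graded_twist \<chi> C) (canonical_ideal (graded_twist \<chi> C)))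
     \<and> (\<forall>\<nu>. (\<forall>i\<in>{1..m}. \<forall>j\<in>{1..m}. \<nu> i j \<in> Units K) \<and>
          (\<forall>i\<in>{1..m}. \<forall>j\<in>{1..m}. i \<noteq> j \<longrightarrow>
             \<nu> i j = \<mu> i j \<otimes>\<^bsub>K\<^esub> q Minus Plus j i \<otimes>\<^bsub>K\<^esub> q Minus Minus i j) \<longrightarrow>
          graded_alg_iso K (graded_twist (induced_action C \<J> \<chi>) A) (tgwa K R m \<sigma>' t \<nu>))"
proof -
  interpret D: tgw_datum K R m \<sigma> t \<mu>
    using field datum \<mu>_units by (simp add: tgw_datum_def)
  have "inj_on (\<lambda>r. D.letter (Coeff r)) (carrier R)"
  proof (rule inj_onI)
    fix r r' assume "r \<in> carrier R" "r' \<in> carrier R" "D.letter (Coeff r) = D.letter (Coeff r')"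
    then show "r = r'" using consistent by (simp add: tgwd_consistent_def inj_on_def)
  qed
  then interpret a: tgw_action K R m \<sigma> t \<mu> \<chi> q
    using regular \<chi>_hom \<chi>_graded q_units \<chi>_plus \<chi>_minus unfolding C X
    by (intro tgw_action.intro D.tgw_datum_axioms tgw_action_axioms.intro) blast+
  let ?T = "graded_twist \<chi> C"
  interpret T: graded_alg K ?T unfolding C by (rule a.act.graded_alg_twist)
  have can: "\<J> = canonical_ideal ?T" unfolding J C by (rule a.act.canonical_ideal_twist[symmetric])
  have quot: "graded_alg_iso K (graded_twist (induced_action C \<J> \<chi>) A) (graded_quot ?T \<J>)"
    unfolding A C
  proof (rule a.act.graded_twist_quot_iso)
    show "graded_ideal D.construction \<J>" unfolding J C by (rule D.C.graded_ideal_canonical)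
    show "\<chi> \<alpha> x \<in> \<J>" if "\<alpha> \<in> carrier (Z_pow m)" "x \<in> \<J>" for \<alpha> x
      using a.act.canonical_ideal_stable that unfolding J C by blast
    show "graded_ideal (graded_twist \<chi> D.construction) \<J>"
      using T.graded_ideal_canonical unfolding can C .
  qed
  have iso: "graded_alg_iso K ?T (tgwc K R m \<sigma>' t \<nu>)"
    and iso_quot: "graded_alg_iso K (graded_twist (induced_action C \<J> \<chi>) A) (tgwa K R m \<sigma>' t \<nu>)"
    if \<nu>: "\<forall>i\<in>{1..m}. \<forall>j\<in>{1..m}. \<nu> i j \<in> Units K"
      "\<forall>i\<in>{1..m}. \<forall>j\<in>{1..m}. i \<noteq> j \<longrightarrow> \<nu> i j = \<mu> i j \<otimes>\<^bsub>K\<^esub> q Minus Plus j i \<otimes>\<^bsub>K\<^esub> q Minus Minus i j" for \<nu>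
  proof -
    interpret N: tgw_datum K R m \<sigma>' t \<nu>
      unfolding \<sigma>' by (intro tgw_datum.intro field a.twisted_datum) (use \<nu>(1) in blast)
    show iso: "graded_alg_iso K ?T (tgwc K R m \<sigma>' t \<nu>)"
      unfolding \<sigma>' C by (rule a.twist_iso_construction) (use \<nu> in blast)+
    show "graded_alg_iso K (graded_twist (induced_action C \<J> \<chi>) A) (tgwa K R m \<sigma>' t \<nu>)"
      unfolding tgwa_def
      using graded_alg_iso_trans[OF quot[unfolded can] 
          graded_alg_iso_quot_canonical[OF T.graded_alg_axioms N.C.graded_alg_axioms iso]]
      by (simp flip: can)
  qed
  show ?thesis
    using can quot iso iso_quot a.twisted_datum unfolding \<sigma>' by (metis (no_types, lifting))
qed

end
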